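(* Let $i=1$ and let the setting and standing assumptions described in the context hold. Assume that: (1) there are $b_0\ge 1$, $l\ge 0$ with $n_0(x,s):=\int_0^s b(x,m,s)\,dm\le b_0(1+s^l)$ for a.a. $x\in\Omega$ and $s\ge0$; (2) $\int_0^s\beta(m,s)\,dm\le\beta_0(1+s^l)$ for any $s\ge 0$ and some constant $\beta_0$; (3) there are $r_0\ge 0$, $s_0\ge 0$ such that the set $\{[0,1]\ni z\mapsto sz^{r_0}\beta(zs,s)\}_{s\ge s_0}$ is equi-integrable in $L_1([0,1],dz)$. Then there is $r_1>\max\{l,r_0\}$ such that for every $r\ge r_1$ the operator $(\mathfrak K^1,D(\mathbf T^1))$ generates a positive $C_0$-semigroup on $\mathcal X^1_r$. Hence, if also $b(x,m,s)\le\beta(m,s)$ for a.e. $x\in\Omega$ and $0\le m\le s$, then $(\mathbf K^1,D(\mathbf T^1))$ generates a positive $C_0$-semigroup on $\mathcal X^1_r$.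
   Context: Spaces. $N\ge1$, $\mathbb R_+=[0,\infty)$; $\Omega\subset\mathbb R^N$ is a bounded open set with $C^2$ boundary or $\Omega=\mathbb R^N$. $X_x^1=L_1(\Omega,dx)$. For $r\ge0$, $dm_r=(1+m^r)\,dm$ and $\mathcal X^1_r=L_1(\mathbb R_+,X^1_x,dm_r)$ is the Bochner space with norm $\int_0^\infty\|u(\cdot,m)\|_{X^1_x}(1+m^r)\,dm$; its elements are identified with functions $u(x,m)$ and $u(m):=u(\cdot,m)$. Properties for $m\in\mathbb R_+$ are meant for a.e. $m$. A positive $C_0$-semigroup is substochastic if it is contractive. Rate. $0\le a\in L_{\infty,loc}(\Omega\times\mathbb R_+)$, and there are $\alpha_1,\alpha_2\in L_{\infty,loc}(\mathbb R_+)$ and $0<M<\infty$ with $\alpha_1(m)\le a(x,m)\le\alpha_2(m)\le M\alpha_1(m)$. Transport. $(\mathcal T_{0,m})_{m\in\mathbb R_+}$ is a family of linear expressions acting on functions of $x$, $[\mathcal T_0u](x,m)=[\mathcal T_{0,m}u(\cdot,m)](x)$; for each $m$, the restriction $T^1_{0,m}$ of $\mathcal T_{0,m}$ to a domain $D(T^1_{0,m})\subset X^1_x$ generates a substochastic semigroup $(G_{T^1_{0,m}}(t))_{t\ge0}$ on $X^1_x$. $\mathbf T^1_0=\mathcal T_0$ on $D(\mathbf T_0^1)=\{u\in\mathcal X^1_r: u(m)\in D(T^1_{0,m}),\ \mathcal T_0u\in\mathcal X^1_r\}$. Standing assumption (A1): $(\mathbf T^1_0,D(\mathbf T^1_0))$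 generates a substochastic semigroup on $\mathcal X^1_r$ given by $[G_{\mathbf T^1_0}(t)u](x,m)=[G_{T^1_{0,m}}(t)u(m)](x)$. $\mathbf A^1u=-au$ on $D(\mathbf A^1)=\{u\in\mathcal X_r^1: au\in\mathcal X_r^1\}$; $\mathbf T^1=\mathbf T_0^1+\mathbf A^1$ on $D(\mathbf T^1)=D(\mathbf T_0^1)\cap D(\mathbf A^1)$. Fragmentation. $b\ge0$ is measurable with $b(x,m,s)=0$ for $m>s$; $[\mathbf B^1u](x,m)=\int_m^\infty b(x,m,s)a(x,s)u(x,s)\,ds$, and $\mathbf K^1=\mathbf T^1+\mathbf B^1$ on $D(\mathbf T^1)$. Majorising problem. $\beta\ge 0$ is measurable on $\mathbb R_+^2$ with support in $\{(m,s):m\le s\}$; $\mathfrak A^1u=-\alpha_1u$, $[\mathfrak B^1u](x,m)=\int_m^\infty\alpha_2(s)\beta(m,s)u(x,s)\,ds$, both on $D(\mathfrak A^1)=\{u\in\mathcal X^1_r:\alpha_1u\in\mathcal X^1_r\}=D(\mathbf A^1)$; $\mathfrak K^1=\mathbf T_0^1+\mathfrak A^1+\mathfrak B^1$ on $D(\mathbf T_0^1)\cap D(\mathfrak A^1)=D(\mathbf T^1)$. A bounded set $\mathcal E\subset L_1([0,1],dz)$ is equi-integrable if for any $\varepsilon>0$ there is $\delta>0$ such that $\sup_{f\in\mathcal E}\int_{\Theta_0}|f|\,dz<\varepsilon$ for every measurable $\Theta_0\subset[0,1]$ of measure less than $\delta$. *)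

theory Defs
  imports "HOL-Analysis.Analysis"
begin

section \<open>Open sets with boundary of class C2\<close>

definition C2_function :: "('a::real_normed_vector \<Rightarrow> real) \<Rightarrow> bool" where
  "C2_function \<gamma> \<longleftrightarrow>
     (\<exists>(\<gamma>' :: 'a \<Rightarrow> 'a \<Rightarrow>\<^sub>L real) (\<gamma>'' :: 'a \<Rightarrow> 'a \<Rightarrow>\<^sub>L ('a \<Rightarrow>\<^sub>L real)).
        (\<forall>x. (\<gamma> has_derivative blinfun_apply (\<gamma>' x)) (at x)) \<and>
        (\<forall>x. (\<gamma>' has_derivative blinfun_apply (\<gamma>'' x)) (at x)) \<and>
        continuous_on UNIV \<gamma>'')"

text \<open>Locally, in suitable Cartesian coordinates, the set lies above the graph of a C2 function:
  \<open>\<nu>\<close> is the direction of the last coordinate, and \<open>x - (x \<bullet> \<nu>) *\<^sub>R \<nu>\<close> collects the others.\<close>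

definition C2_boundary :: "'a::euclidean_space set \<Rightarrow> bool" where
  "C2_boundary \<Omega> \<longleftrightarrow>
     (\<forall>x0 \<in> frontier \<Omega>. \<exists>\<rho> > 0. \<exists>\<nu> \<gamma>. norm \<nu> = 1 \<and> C2_function \<gamma> \<and>
        \<Omega> \<inter> ball x0 \<rho> = {x \<in> ball x0 \<rho>. \<gamma> (x - (x \<bullet> \<nu>) *\<^sub>R \<nu>) < x \<bullet> \<nu>})"


section \<open>Spaces of functions\<close>

text \<open>Elements of \<open>L\<^sub>1(M)\<close> are handled through representatives; equality in \<open>L\<^sub>1(M)\<close> is equality
  almost everywhere, and everything below is invariant under it.\<close>

definition L1 :: "'a measure \<Rightarrow> ('a \<Rightarrow> real) set" where
  "L1 M = {u. integrable M u}"

definition L1_norm :: "'a measure \<Rightarrow> ('a \<Rightarrow> real) \<Rightarrow> real" where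
  "L1_norm M u = (LINT z|M. \<bar>u z\<bar>)"

definition Linf_loc :: "'a::euclidean_space set \<Rightarrow> ('a \<Rightarrow> real) \<Rightarrow> bool" where
  "Linf_loc S f \<longleftrightarrow> f \<in> borel_measurable (lebesgue_on S) \<and>
     (\<forall>K \<subseteq> S. compact K \<longrightarrow> (\<exists>C. AE z in lebesgue_on K. \<bar>f z\<bar> \<le> C))"

definition equi_integrable01 :: "(real \<Rightarrow> real) set \<Rightarrow> bool" where
  "equi_integrable01 E \<longleftrightarrow>
     E \<subseteq> L1 (lebesgue_on {0..1}) \<and>
     (\<exists>C. \<forall>f \<in> E. L1_norm (lebesgue_on {0..1}) f \<le> C) \<and>
     (\<forall>\<epsilon> > 0. \<exists>\<delta> > 0. \<forall>\<Theta>. \<Theta> \<in> sets lebesgue \<and> \<Theta> \<subseteq> {0..1} \<and> measure lebesgue \<Theta> < \<delta> \<longrightarrow>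
        (SUP f\<in>E. \<integral>\<^sup>+z\<in>\<Theta>. ennreal \<bar>f z\<bar> \<partial>lebesgue) < ennreal \<epsilon>)"

abbreviation (input) Xx :: "'x::euclidean_space set \<Rightarrow> 'x measure" where
  "Xx \<Omega> \<equiv> lebesgue_on \<Omega>"

text \<open>The Bochner space \<open>L\<^sub>1(\<real>\<^sub>+, L\<^sub>1(\<Omega>, dx), (1 + m\<^sup>r) dm)\<close>, with elements identified with functions
  of the pair \<open>(x, m)\<close>, is \<open>L1 (Xr \<Omega> r)\<close>; the lemmas \<open>L1_Xr_iff\<close> and \<open>L1_norm_Xr\<close> below identify
  its elements and its norm by iterated integrals.\<close>

definition Xr :: "'x::euclidean_space set \<Rightarrow> real \<Rightarrow> ('x \<times> real) measure" where
  "Xr \<Omega> r = density (lebesgue_on (\<Omega> \<times> {0..})) (\<lambda>(x, m). ennreal (1 + m powr r))"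


section \<open>Semigroups on L1 and their generators\<close>

text \<open>Linearity and boundedness imply that \<open>G t\<close> respects almost everywhere equality.\<close>

definition C0_semigroup :: "'a measure \<Rightarrow> (real \<Rightarrow> ('a \<Rightarrow> real) \<Rightarrow> 'a \<Rightarrow> real) \<Rightarrow> bool" where
  "C0_semigroup M G \<longleftrightarrow>
     (\<forall>t\<ge>0. \<forall>u\<in>L1 M. G t u \<in> L1 M) \<and>
     (\<forall>t\<ge>0. \<forall>u\<in>L1 M. \<forall>v\<in>L1 M. \<forall>c d.
        AE z in M. G t (\<lambda>y. c * u y + d * v y) z = c * G t u z + d * G t v z) \<and>
     (\<forall>t\<ge>0. \<exists>C. \<forall>u\<in>L1 M. L1_norm M (G t u) \<le> C * L1_norm M u) \<and>
     (\<forall>u\<in>L1 M. AE z in M. G 0 u z = u z) \<and>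
     (\<forall>s\<ge>0. \<forall>t\<ge>0. \<forall>u\<in>L1 M. AE z in M. G (s + t) u z = G s (G t u) z) \<and>
     (\<forall>u\<in>L1 M. ((\<lambda>t. L1_norm M (\<lambda>z. G t u z - u z)) \<longlongrightarrow> 0) (at_right 0))"

definition positive_semigroup :: "'a measure \<Rightarrow> (real \<Rightarrow> ('a \<Rightarrow> real) \<Rightarrow> 'a \<Rightarrow> real) \<Rightarrow> bool" where
  "positive_semigroup M G \<longleftrightarrow> C0_semigroup M G \<and>
     (\<forall>t\<ge>0. \<forall>u\<in>L1 M. (AE z in M. 0 \<le> u z) \<longrightarrow> (AE z in M. 0 \<le> G t u z))"

definition substochastic :: "'a measure \<Rightarrow> (real \<Rightarrow> ('a \<Rightarrow> real) \<Rightarrow> 'a \<Rightarrow> real) \<Rightarrow> bool" where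
  "substochastic M G \<longleftrightarrow> positive_semigroup M G \<and>
     (\<forall>t\<ge>0. \<forall>u\<in>L1 M. L1_norm M (G t u) \<le> L1_norm M u)"

definition right_derivative_at_0 ::
    "'a measure \<Rightarrow> (real \<Rightarrow> ('a \<Rightarrow> real) \<Rightarrow> 'a \<Rightarrow> real) \<Rightarrow> ('a \<Rightarrow> real) \<Rightarrow> ('a \<Rightarrow> real) \<Rightarrow> bool" where
  "right_derivative_at_0 M G u v \<longleftrightarrow> v \<in> L1 M \<and>
     ((\<lambda>h. L1_norm M (\<lambda>z. (G h u z - u z) / h - v z)) \<longlongrightarrow> 0) (at_right 0)"

text \<open>\<open>(A, D)\<close> is the generator of \<open>G\<close>. In particular \<open>D\<close> is a linear subspace closed under almost
  everywhere equality, and \<open>A\<close> is linear on \<open>D\<close> up to almost everywhere equality.\<close>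

definition is_generator ::
    "'a measure \<Rightarrow> (real \<Rightarrow> ('a \<Rightarrow> real) \<Rightarrow> 'a \<Rightarrow> real) \<Rightarrow>
     (('a \<Rightarrow> real) \<Rightarrow> 'a \<Rightarrow> real) \<Rightarrow> ('a \<Rightarrow> real) set \<Rightarrow> bool" where
  "is_generator M G A D \<longleftrightarrow>
     D = {u \<in> L1 M. \<exists>v. right_derivative_at_0 M G u v} \<and>
     (\<forall>u\<in>D. right_derivative_at_0 M G u (A u))"

definition generates_positive_semigroup ::
    "'a measure \<Rightarrow> (('a \<Rightarrow> real) \<Rightarrow> 'a \<Rightarrow> real) \<Rightarrow> ('a \<Rightarrow> real) set \<Rightarrow> bool" where
  "generates_positive_semigroup M A D \<longleftrightarrow> (\<exists>G. positive_semigroup M G \<and> is_generator M G A D)"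


section \<open>The transport operator\<close>

text \<open>Fibrewise equality of an element \<open>v\<close> of the Bochner space with a family \<open>w\<close> of elements
  of \<open>L\<^sub>1(\<Omega>, dx)\<close>. The family \<open>(\<T>\<^sub>0\<^sub>,\<^sub>m u(m))\<^sub>m\<close> is given for each \<open>m\<close> only up to a null set of \<open>x\<close>
  that depends on \<open>m\<close>, so \<open>(x, m) \<mapsto> [\<T>\<^sub>0\<^sub>,\<^sub>m u(m)](x)\<close> itself need not be jointly measurable; it
  belongs to the Bochner space if it agrees fibrewise with some element \<open>v\<close>, which is then unique
  almost everywhere.\<close>

definition fibre_eq ::
    "'x::euclidean_space set \<Rightarrow> ('x \<times> real \<Rightarrow> real) \<Rightarrow> (real \<Rightarrow> 'x \<Rightarrow> real) \<Rightarrow> bool" where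
  "fibre_eq \<Omega> v w \<longleftrightarrow> (AE m in lebesgue_on {0..}. AE x in Xx \<Omega>. v (x, m) = w m x)"

definition T0_dom ::
    "'x::euclidean_space set \<Rightarrow> real \<Rightarrow> (real \<Rightarrow> ('x \<Rightarrow> real) \<Rightarrow> 'x \<Rightarrow> real) \<Rightarrow>
     (real \<Rightarrow> ('x \<Rightarrow> real) set) \<Rightarrow> ('x \<times> real \<Rightarrow> real) set" where
  "T0_dom \<Omega> r T0 D0 = {u \<in> L1 (Xr \<Omega> r).
     (AE m in lebesgue_on {0..}. (\<lambda>x. u (x, m)) \<in> D0 m) \<and>
     (\<exists>v \<in> L1 (Xr \<Omega> r). fibre_eq \<Omega> v (\<lambda>m. T0 m (\<lambda>x. u (x, m))))}"

definition T0_op ::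
    "'x::euclidean_space set \<Rightarrow> real \<Rightarrow> (real \<Rightarrow> ('x \<Rightarrow> real) \<Rightarrow> 'x \<Rightarrow> real) \<Rightarrow>
     ('x \<times> real \<Rightarrow> real) \<Rightarrow> 'x \<times> real \<Rightarrow> real" where
  "T0_op \<Omega> r T0 u =
     (SOME v. v \<in> L1 (Xr \<Omega> r) \<and> fibre_eq \<Omega> v (\<lambda>m. T0 m (\<lambda>x. u (x, m))))"

text \<open>The transport operator with domain \<open>T0_dom\<close> generates a substochastic semigroup that acts
  fibrewise; \<open>Gx m\<close> is the semigroup on \<open>L\<^sub>1(\<Omega>, dx)\<close> generated by \<open>(T0 m, D0 m)\<close>. The linearity
  of \<open>T0 m\<close> on \<open>D0 m\<close> (up to null sets) is part of being a generator.\<close>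

definition generates_fibrewise ::
    "'x::euclidean_space set \<Rightarrow> real \<Rightarrow> (real \<Rightarrow> ('x \<Rightarrow> real) \<Rightarrow> 'x \<Rightarrow> real) \<Rightarrow>
     (real \<Rightarrow> ('x \<Rightarrow> real) set) \<Rightarrow> (real \<Rightarrow> real \<Rightarrow> ('x \<Rightarrow> real) \<Rightarrow> 'x \<Rightarrow> real) \<Rightarrow> bool" where
  "generates_fibrewise \<Omega> r T0 D0 Gx \<longleftrightarrow>
     (\<exists>G. substochastic (Xr \<Omega> r) G \<and>
          is_generator (Xr \<Omega> r) G (T0_op \<Omega> r T0) (T0_dom \<Omega> r T0 D0) \<and>
          (\<forall>t\<ge>0. \<forall>u\<in>L1 (Xr \<Omega> r). fibre_eq \<Omega> (G t u) (\<lambda>m. Gx m t (\<lambda>x. u (x, m)))))"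


section \<open>Fragmentation operators\<close>

definition A_op :: "('x \<times> real \<Rightarrow> real) \<Rightarrow> ('x \<times> real \<Rightarrow> real) \<Rightarrow> 'x \<times> real \<Rightarrow> real" where
  "A_op a u = (\<lambda>z. - (a z * u z))"

definition A_dom ::
    "'x::euclidean_space set \<Rightarrow> real \<Rightarrow> ('x \<times> real \<Rightarrow> real) \<Rightarrow> ('x \<times> real \<Rightarrow> real) set" where
  "A_dom \<Omega> r a = {u \<in> L1 (Xr \<Omega> r). (\<lambda>z. a z * u z) \<in> L1 (Xr \<Omega> r)}"

definition T_dom ::
    "'x::euclidean_space set \<Rightarrow> real \<Rightarrow> (real \<Rightarrow> ('x \<Rightarrow> real) \<Rightarrow> 'x \<Rightarrow> real) \<Rightarrow>
     (real \<Rightarrow> ('x \<Rightarrow> real) set) \<Rightarrow> ('x \<times> real \<Rightarrow> real) \<Rightarrow> ('x \<times> real \<Rightarrow> real) set" where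
  "T_dom \<Omega> r T0 D0 a = T0_dom \<Omega> r T0 D0 \<inter> A_dom \<Omega> r a"

definition B_op ::
    "('x \<times> real \<Rightarrow> real) \<Rightarrow> ('x \<times> real \<times> real \<Rightarrow> real) \<Rightarrow>
     ('x \<times> real \<Rightarrow> real) \<Rightarrow> 'x \<times> real \<Rightarrow> real" where
  "B_op a b u = (\<lambda>(x, m). LINT s:{m..}|lebesgue. b (x, m, s) * a (x, s) * u (x, s))"

definition K_op ::
    "'x::euclidean_space set \<Rightarrow> real \<Rightarrow> (real \<Rightarrow> ('x \<Rightarrow> real) \<Rightarrow> 'x \<Rightarrow> real) \<Rightarrow>
     ('x \<times> real \<Rightarrow> real) \<Rightarrow> ('x \<times> real \<times> real \<Rightarrow> real) \<Rightarrow>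
     ('x \<times> real \<Rightarrow> real) \<Rightarrow> 'x \<times> real \<Rightarrow> real" where
  "K_op \<Omega> r T0 a b u = (\<lambda>z. T0_op \<Omega> r T0 u z + A_op a u z + B_op a b u z)"

definition maj_A_op :: "(real \<Rightarrow> real) \<Rightarrow> ('x \<times> real \<Rightarrow> real) \<Rightarrow> 'x \<times> real \<Rightarrow> real" where
  "maj_A_op \<alpha>1 u = (\<lambda>(x, m). - (\<alpha>1 m * u (x, m)))"

definition maj_B_op ::
    "(real \<Rightarrow> real) \<Rightarrow> (real \<times> real \<Rightarrow> real) \<Rightarrow> ('x \<times> real \<Rightarrow> real) \<Rightarrow> 'x \<times> real \<Rightarrow> real" where
  "maj_B_op \<alpha>2 \<beta> u = (\<lambda>(x, m). LINT s:{m..}|lebesgue. \<alpha>2 s * \<beta> (m, s) * u (x, s))"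

definition maj_K_op ::
    "'x::euclidean_space set \<Rightarrow> real \<Rightarrow> (real \<Rightarrow> ('x \<Rightarrow> real) \<Rightarrow> 'x \<Rightarrow> real) \<Rightarrow>
     (real \<Rightarrow> real) \<Rightarrow> (real \<Rightarrow> real) \<Rightarrow> (real \<times> real \<Rightarrow> real) \<Rightarrow>
     ('x \<times> real \<Rightarrow> real) \<Rightarrow> 'x \<times> real \<Rightarrow> real" where
  "maj_K_op \<Omega> r T0 \<alpha>1 \<alpha>2 \<beta> u =
     (\<lambda>z. T0_op \<Omega> r T0 u z + maj_A_op \<alpha>1 u z + maj_B_op \<alpha>2 \<beta> u z)"

definition n0 :: "('x \<times> real \<times> real \<Rightarrow> real) \<Rightarrow> 'x \<Rightarrow> real \<Rightarrow> ennreal" where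
  "n0 b x s = (\<integral>\<^sup>+m\<in>{0..s}. ennreal (b (x, m, s)) \<partial>lebesgue)"


section \<open>The Bochner space by iterated integrals\<close>

lemma AE_lebesgue_fibres:
  fixes P :: "'x::euclidean_space \<times> 'y::euclidean_space \<Rightarrow> bool"
  assumes "AE z in lebesgue. P z"
  shows "AE m in lebesgue. AE x in lebesgue. P (x, m)"
proof -
  have "AE z in lborel \<Otimes>\<^sub>M lborel. P z"
    using assms unfolding lborel_prod by (simp add: AE_completion_iff)
  then obtain N where N: "{z \<in> space (lborel \<Otimes>\<^sub>M lborel). \<not> P z} \<subseteq> N"
      "emeasure (lborel \<Otimes>\<^sub>M lborel) N = 0" "N \<in> sets (lborel \<Otimes>\<^sub>M lborel)"
    by (rule AE_E)
  have "AE z in lborel \<Otimes>\<^sub>M lborel. z \<notin> N"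
    using N by (intro AE_not_in) (simp add: null_sets_def)
  then have "AE x in lborel. AE y in lborel. (x, y) \<notin> N"
    by (rule lborel_pair.AE_pair)
  moreover have "{z \<in> space (lborel \<Otimes>\<^sub>M lborel). (fst z, snd z) \<notin> N} \<in> sets (lborel \<Otimes>\<^sub>M lborel)"
    using sets.compl_sets[OF N(3)] by (simp add: set_diff_eq)
  ultimately have "AE y in lborel. AE x in lborel. (x, y) \<notin> N"
    by (subst lborel_pair.AE_commute[symmetric]) (auto simp: split_beta)
  then have "AE y in lborel. AE x in lborel. P (x, y)"
  proof (rule eventually_mono)
    fix y :: 'y assume "AE x in lborel. (x, y) \<notin> N"
    then show "AE x in lborel. P (x, y)"
      by (rule eventually_mono) (use N(1) in \<open>auto simp: space_pair_measure\<close>)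
  qed
  then show ?thesis by (simp add: AE_completion_iff)
qed

lemma tonelli_lebesgue:
  fixes f :: "'x::euclidean_space \<times> 'y::euclidean_space \<Rightarrow> ennreal"
  assumes "f \<in> borel_measurable lebesgue"
  shows "(\<integral>\<^sup>+z. f z \<partial>lebesgue) = (\<integral>\<^sup>+m. \<integral>\<^sup>+x. f (x, m) \<partial>lebesgue \<partial>lebesgue)"
proof -
  obtain g where g: "g \<in> borel_measurable lborel" "AE z in lborel. f z = g z"
    using completion_ex_borel_measurable[OF assms] by blast
  have g': "g \<in> borel_measurable (lborel \<Otimes>\<^sub>M lborel)"
    using g(1) by (simp add: lborel_prod)
  have fib: "AE m in lborel. AE x in lborel. f (x, m) = g (x, m)"
    using AE_lebesgue_fibres[of "\<lambda>z. f z = g z"] g(2) by (simp add: AE_completion_iff)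
  have "(\<integral>\<^sup>+z. f z \<partial>lebesgue) = (\<integral>\<^sup>+z. g z \<partial>lborel)"
    using g(2) by (simp add: nn_integral_completion nn_integral_cong_AE)
  also have "\<dots> = (\<integral>\<^sup>+m. \<integral>\<^sup>+x. g (x, m) \<partial>lborel \<partial>lborel)"
    using lborel_pair.nn_integral_snd[of g] g' by (simp add: lborel_prod)
  also have "\<dots> = (\<integral>\<^sup>+m. \<integral>\<^sup>+x. f (x, m) \<partial>lborel \<partial>lborel)"
    using fib by (intro nn_integral_cong_AE) (auto elim!: eventually_mono intro!: nn_integral_cong_AE)
  finally show ?thesis by (simp add: nn_integral_completion)
qed

lemma AE_finite_fibres:
  fixes f :: "'x::euclidean_space \<times> 'y::euclidean_space \<Rightarrow> ennreal"
  assumes "f \<in> borel_measurable lebesgue" "(\<integral>\<^sup>+z. f z \<partial>lebesgue) < \<infinity>"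
  shows "AE m in lebesgue. (\<integral>\<^sup>+x. f (x, m) \<partial>lebesgue) < \<infinity>"
proof -
  obtain g where g: "g \<in> borel_measurable lborel" "AE z in lborel. f z = g z"
    using completion_ex_borel_measurable[OF assms(1)] by blast
  have g': "g \<in> borel_measurable (lborel \<Otimes>\<^sub>M lborel)"
    using g(1) by (simp add: lborel_prod)
  have fib: "AE m in lborel. AE x in lborel. f (x, m) = g (x, m)"
    using AE_lebesgue_fibres[of "\<lambda>z. f z = g z"] g(2) by (simp add: AE_completion_iff)
  have "(\<integral>\<^sup>+z. f z \<partial>lebesgue) = (\<integral>\<^sup>+z. g z \<partial>lborel)"
    using g(2) by (simp add: nn_integral_completion nn_integral_cong_AE)
  also have "\<dots> = (\<integral>\<^sup>+m. \<integral>\<^sup>+x. g (x, m) \<partial>lborel \<partial>lborel)"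
    using lborel_pair.nn_integral_snd[of g] g' by (simp add: lborel_prod)
  finally have "(\<integral>\<^sup>+m. \<integral>\<^sup>+x. g (x, m) \<partial>lborel \<partial>lborel) \<noteq> \<infinity>"
    using assms(2) by auto
  moreover have "(\<lambda>m. \<integral>\<^sup>+x. g (x, m) \<partial>lborel) \<in> borel_measurable lborel"
    using g' by measurable
  ultimately have "AE m in lborel. (\<integral>\<^sup>+x. g (x, m) \<partial>lborel) \<noteq> \<infinity>"
    by (rule nn_integral_PInf_AE[rotated])
  with fib have "AE m in lborel. (\<integral>\<^sup>+x. f (x, m) \<partial>lborel) < \<infinity>"
  proof eventually_elim
    fix m assume "AE x in lborel. f (x, m) = g (x, m)" "(\<integral>\<^sup>+x. g (x, m) \<partial>lborel) \<noteq> \<infinity>"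
    then show "(\<integral>\<^sup>+x. f (x, m) \<partial>lborel) < \<infinity>"
      by (simp add: nn_integral_cong_AE top.not_eq_extremum)
  qed
  then show ?thesis by (simp add: nn_integral_completion AE_completion_iff)
qed

lemma borel_measurable_fibres:
  fixes f :: "'x::euclidean_space \<times> 'y::euclidean_space \<Rightarrow> real"
  assumes "f \<in> borel_measurable lebesgue"
  shows "AE m in lebesgue. (\<lambda>x. f (x, m)) \<in> borel_measurable lebesgue"
proof -
  obtain g where g: "g \<in> borel_measurable lborel" "AE z in lborel. f z = g z"
    using completion_ex_borel_measurable_real[OF assms] by blast
  have "AE m in lebesgue. AE x in lebesgue. f (x, m) = g (x, m)"
    using AE_lebesgue_fibres[of "\<lambda>z. f z = g z"] g(2) by (simp add: AE_completion_iff)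
  then show ?thesis
  proof eventually_elim
    fix m assume *: "AE x in lebesgue. f (x, m) = g (x, m)"
    have "(\<lambda>x. g (x, m)) \<in> borel_measurable lborel"
      using g(1) by (auto intro!: measurable_compose[where g = g and N = borel]
        borel_measurable_continuous_onI continuous_intros)
    then have "(\<lambda>x. g (x, m)) \<in> borel_measurable lebesgue"
      by (rule measurable_completion)
    then show "(\<lambda>x. f (x, m)) \<in> borel_measurable lebesgue"
      by (rule borel_measurable_AE) (use * in \<open>auto elim!: eventually_mono\<close>)
  qed
qed

lemma weight_measurable:
  "(\<lambda>(x, m). ennreal (1 + m powr r)) \<in> borel_measurable (lebesgue :: ('x::euclidean_space \<times> real) measure)"
proof -
  have "(snd :: 'x \<times> real \<Rightarrow> real) \<in> borel_measurable borel"
    by (intro borel_measurable_continuous_onI continuous_intros)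
  then have "(\<lambda>z :: 'x \<times> real. ennreal (1 + snd z powr r)) \<in> borel_measurable borel"
    by measurable
  then show ?thesis
    by (intro measurable_completion) (simp add: split_beta)
qed

lemma nn_integral_Xr:
  fixes \<Omega> :: "'x::euclidean_space set"
  assumes "open \<Omega>" and u: "u \<in> borel_measurable (lebesgue_on (\<Omega> \<times> {0..}))"
  shows "(\<integral>\<^sup>+z. ennreal \<bar>u z\<bar> \<partial>Xr \<Omega> r) =
    (\<integral>\<^sup>+m. (\<integral>\<^sup>+x. ennreal \<bar>u (x, m)\<bar> \<partial>Xx \<Omega>) * ennreal (1 + m powr r) \<partial>lebesgue_on {0..})"
proof -
  let ?S = "\<Omega> \<times> {0::real..}"
  have \<Omega>: "\<Omega> \<in> sets lebesgue" using assms(1) by auto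
  have S: "?S \<in> sets lebesgue"
    using assms(1) by (intro sets_completionI_sets) (auto intro!: borel_Times)
  note w = weight_measurable[of r]
  have uS: "(\<lambda>z. indicator ?S z * u z) \<in> borel_measurable lebesgue"
    using u S by (simp add: borel_measurable_restrict_space_iff)
  have f: "(\<lambda>z. ennreal \<bar>indicator ?S z * u z\<bar> * (case z of (x, m) \<Rightarrow> ennreal (1 + m powr r)))
      \<in> borel_measurable lebesgue"
    using uS w by measurable
  have wS: "(\<lambda>(x, m). ennreal (1 + m powr r)) \<in> borel_measurable (lebesgue_on ?S)"
    using w by (rule measurable_restrict_space1)
  have "(\<integral>\<^sup>+z. ennreal \<bar>u z\<bar> \<partial>Xr \<Omega> r) =
      (\<integral>\<^sup>+z. (case z of (x, m) \<Rightarrow> ennreal (1 + m powr r)) * ennreal \<bar>u z\<bar> \<partial>lebesgue_on ?S)"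
    unfolding Xr_def using u wS by (intro nn_integral_density) auto
  also have "\<dots> = (\<integral>\<^sup>+z. ennreal \<bar>indicator ?S z * u z\<bar> *
      (case z of (x, m) \<Rightarrow> ennreal (1 + m powr r)) \<partial>lebesgue)"
    using S by (subst nn_integral_restrict_space)
      (auto intro!: nn_integral_cong simp: indicator_def mult.commute)
  also have "\<dots> = (\<integral>\<^sup>+m. \<integral>\<^sup>+x. ennreal \<bar>indicator ?S (x, m) * u (x, m)\<bar> *
      ennreal (1 + m powr r) \<partial>lebesgue \<partial>lebesgue)"
    using tonelli_lebesgue[OF f] by simp
  also have "\<dots> = (\<integral>\<^sup>+m. (\<integral>\<^sup>+x. ennreal \<bar>u (x, m)\<bar> \<partial>Xx \<Omega>) * ennreal (1 + m powr r) * indicator {0..} m \<partial>lebesgue)"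
  proof (rule nn_integral_cong_AE)
    have "AE m in lebesgue. (\<lambda>x. indicator ?S (x, m) * u (x, m)) \<in> borel_measurable lebesgue"
      using borel_measurable_fibres[OF uS] .
    then show "AE m in lebesgue. (\<integral>\<^sup>+x. ennreal \<bar>indicator ?S (x, m) * u (x, m)\<bar> *
        ennreal (1 + m powr r) \<partial>lebesgue) =
      (\<integral>\<^sup>+x. ennreal \<bar>u (x, m)\<bar> \<partial>Xx \<Omega>) * ennreal (1 + m powr r) * indicator {0..} m"
    proof eventually_elim
      fix m :: real
      assume "(\<lambda>x. indicator ?S (x, m) * u (x, m)) \<in> borel_measurable lebesgue"
      then have "(\<integral>\<^sup>+x. ennreal \<bar>indicator ?S (x, m) * u (x, m)\<bar> * ennreal (1 + m powr r) \<partial>lebesgue) =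
        (\<integral>\<^sup>+x. ennreal \<bar>indicator ?S (x, m) * u (x, m)\<bar> \<partial>lebesgue) * ennreal (1 + m powr r)"
        by (intro nn_integral_multc) auto
      also have "(\<integral>\<^sup>+x. ennreal \<bar>indicator ?S (x, m) * u (x, m)\<bar> \<partial>lebesgue) =
        (\<integral>\<^sup>+x. ennreal \<bar>u (x, m)\<bar> \<partial>Xx \<Omega>) * indicator {0..} m"
        using \<Omega> by (cases "m \<ge> 0")
          (auto simp: nn_integral_restrict_space indicator_def intro!: nn_integral_cong)
      finally show "(\<integral>\<^sup>+x. ennreal \<bar>indicator ?S (x, m) * u (x, m)\<bar> * ennreal (1 + m powr r) \<partial>lebesgue) =
        (\<integral>\<^sup>+x. ennreal \<bar>u (x, m)\<bar> \<partial>Xx \<Omega>) * ennreal (1 + m powr r) * indicator {0..} m"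
        by (simp add: mult_ac)
    qed
  qed
  also have "\<dots> = (\<integral>\<^sup>+m. (\<integral>\<^sup>+x. ennreal \<bar>u (x, m)\<bar> \<partial>Xx \<Omega>) * ennreal (1 + m powr r) \<partial>lebesgue_on {0..})"
    by (subst nn_integral_restrict_space) auto
  finally show ?thesis .
qed

lemma borel_measurable_Xr_fibres:
  fixes \<Omega> :: "'x::euclidean_space set" and u :: "'x \<times> real \<Rightarrow> real"
  assumes "open \<Omega>" and u: "u \<in> borel_measurable (lebesgue_on (\<Omega> \<times> {0..}))"
  shows "AE m in lebesgue_on {0::real..}. (\<lambda>x. u (x, m)) \<in> borel_measurable (Xx \<Omega>)"
proof -
  let ?S = "\<Omega> \<times> {0::real..}"
  have \<Omega>: "\<Omega> \<in> sets lebesgue" using assms(1) by auto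
  have S: "?S \<in> sets lebesgue"
    using assms(1) by (intro sets_completionI_sets) (auto intro!: borel_Times)
  have "(\<lambda>z. indicator ?S z * u z) \<in> borel_measurable lebesgue"
    using u S by (simp add: borel_measurable_restrict_space_iff)
  from borel_measurable_fibres[OF this]
  have "AE m in lebesgue. m \<in> {0..} \<longrightarrow> (\<lambda>x. u (x, m)) \<in> borel_measurable (Xx \<Omega>)"
  proof eventually_elim
    fix m :: real
    assume "(\<lambda>x. indicator ?S (x, m) * u (x, m)) \<in> borel_measurable lebesgue"
    then show "m \<in> {0..} \<longrightarrow> (\<lambda>x. u (x, m)) \<in> borel_measurable (Xx \<Omega>)"
      using \<Omega> by (auto simp: borel_measurable_restrict_space_iff indicator_times)
  qed
  then show ?thesis by (subst AE_restrict_space_iff) auto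
qed

lemma ennreal_L1_norm:
  "u \<in> L1 M \<Longrightarrow> ennreal (L1_norm M u) = (\<integral>\<^sup>+z. ennreal \<bar>u z\<bar> \<partial>M)"
  by (simp add: L1_def L1_norm_def nn_integral_eq_integral)

lemma L1_Xr_measurable:
  "u \<in> borel_measurable (Xr \<Omega> r) \<longleftrightarrow> u \<in> borel_measurable (lebesgue_on (\<Omega> \<times> {0..}))"
  by (simp add: Xr_def)

lemma L1_Xr_fibres:
  fixes \<Omega> :: "'x::euclidean_space set"
  assumes "open \<Omega>" and u: "u \<in> L1 (Xr \<Omega> r)"
  shows "AE m in lebesgue_on {0..}. (\<lambda>x. u (x, m)) \<in> L1 (Xx \<Omega>)"
proof -
  have um: "u \<in> borel_measurable (lebesgue_on (\<Omega> \<times> {0..}))"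
    using u borel_measurable_integrable[of "Xr \<Omega> r" u] by (simp add: L1_def L1_Xr_measurable)
  let ?S = "\<Omega> \<times> {0::real..}"
  have \<Omega>: "\<Omega> \<in> sets lebesgue" using assms(1) by auto
  have S: "?S \<in> sets lebesgue"
    using assms(1) by (intro sets_completionI_sets) (auto intro!: borel_Times)
  have uS: "(\<lambda>z. indicator ?S z * u z) \<in> borel_measurable lebesgue"
    using um S by (simp add: borel_measurable_restrict_space_iff)
  have w: "(\<lambda>(x, m). ennreal (1 + m powr r)) \<in> borel_measurable (lebesgue_on ?S)"
    by (rule measurable_restrict_space1[OF weight_measurable])
  have "(\<integral>\<^sup>+z. ennreal \<bar>indicator ?S z * u z\<bar> \<partial>lebesgue) = (\<integral>\<^sup>+z. ennreal \<bar>u z\<bar> \<partial>lebesgue_on ?S)"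
    using S by (subst nn_integral_restrict_space)
      (auto intro!: nn_integral_cong simp: indicator_def)
  also have "\<dots> \<le> (\<integral>\<^sup>+z. (case z of (x, m) \<Rightarrow> ennreal (1 + m powr r)) * ennreal \<bar>u z\<bar> \<partial>lebesgue_on ?S)"
    by (intro nn_integral_mono) (auto simp: ennreal_mult[symmetric] algebra_simps intro!: ennreal_leI)
  also have "\<dots> = (\<integral>\<^sup>+z. ennreal \<bar>u z\<bar> \<partial>Xr \<Omega> r)"
    unfolding Xr_def using um w by (intro nn_integral_density[symmetric]) auto
  also have "\<dots> < \<infinity>"
    using u by (simp add: L1_def integrable_iff_bounded)
  finally have "AE m in lebesgue. (\<integral>\<^sup>+x. ennreal \<bar>indicator ?S (x, m) * u (x, m)\<bar> \<partial>lebesgue) < \<infinity>"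
    using uS by (intro AE_finite_fibres[of "\<lambda>z. ennreal \<bar>indicator ?S z * u z\<bar>"]) auto
  moreover have "AE m in lebesgue. m \<in> {0..} \<longrightarrow> (\<lambda>x. u (x, m)) \<in> borel_measurable (Xx \<Omega>)"
    using borel_measurable_Xr_fibres[OF assms(1) um] by (subst (asm) AE_restrict_space_iff) auto
  ultimately have "AE m in lebesgue. m \<in> {0..} \<longrightarrow> (\<lambda>x. u (x, m)) \<in> L1 (Xx \<Omega>)"
  proof eventually_elim
    fix m :: real
    assume *: "(\<integral>\<^sup>+x. ennreal \<bar>indicator ?S (x, m) * u (x, m)\<bar> \<partial>lebesgue) < \<infinity>"
      and m: "m \<in> {0..} \<longrightarrow> (\<lambda>x. u (x, m)) \<in> borel_measurable (Xx \<Omega>)"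
    show "m \<in> {0..} \<longrightarrow> (\<lambda>x. u (x, m)) \<in> L1 (Xx \<Omega>)"
    proof
      assume "m \<in> {0..}"
      then have "(\<integral>\<^sup>+x. ennreal \<bar>u (x, m)\<bar> \<partial>Xx \<Omega>) =
          (\<integral>\<^sup>+x. ennreal \<bar>indicator ?S (x, m) * u (x, m)\<bar> \<partial>lebesgue)"
        using \<Omega> by (subst nn_integral_restrict_space)
          (auto intro!: nn_integral_cong simp: indicator_def)
      with * m \<open>m \<in> {0..}\<close> show "(\<lambda>x. u (x, m)) \<in> L1 (Xx \<Omega>)"
        by (simp add: L1_def integrable_iff_bounded)
    qed
  qed
  then show ?thesis by (subst AE_restrict_space_iff) auto
qed

lemma L1_norm_Xr:
  fixes \<Omega> :: "'x::euclidean_space set"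
  assumes "open \<Omega>" and u: "u \<in> L1 (Xr \<Omega> r)"
  shows "ennreal (L1_norm (Xr \<Omega> r) u) =
    (\<integral>\<^sup>+m. ennreal (L1_norm (Xx \<Omega>) (\<lambda>x. u (x, m)) * (1 + m powr r)) \<partial>lebesgue_on {0..})"
proof -
  have um: "u \<in> borel_measurable (lebesgue_on (\<Omega> \<times> {0..}))"
    using u borel_measurable_integrable[of "Xr \<Omega> r" u] by (simp add: L1_def L1_Xr_measurable)
  have "ennreal (L1_norm (Xr \<Omega> r) u) =
    (\<integral>\<^sup>+m. (\<integral>\<^sup>+x. ennreal \<bar>u (x, m)\<bar> \<partial>Xx \<Omega>) * ennreal (1 + m powr r) \<partial>lebesgue_on {0..})"
    by (simp add: ennreal_L1_norm[OF u] nn_integral_Xr[OF assms(1) um])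
  also have "\<dots> =
    (\<integral>\<^sup>+m. ennreal (L1_norm (Xx \<Omega>) (\<lambda>x. u (x, m)) * (1 + m powr r)) \<partial>lebesgue_on {0..})"
    using L1_Xr_fibres[OF assms]
    by (intro nn_integral_cong_AE, eventually_elim)
      (simp add: ennreal_L1_norm[symmetric] ennreal_mult L1_norm_def)
  finally show ?thesis .
qed

lemma L1_Xr_iff:
  fixes \<Omega> :: "'x::euclidean_space set"
  assumes "open \<Omega>"
  shows "u \<in> L1 (Xr \<Omega> r) \<longleftrightarrow>
    u \<in> borel_measurable (lebesgue_on (\<Omega> \<times> {0..})) \<and>
    (AE m in lebesgue_on {0..}. (\<lambda>x. u (x, m)) \<in> L1 (Xx \<Omega>)) \<and>
    (\<integral>\<^sup>+m. ennreal (L1_norm (Xx \<Omega>) (\<lambda>x. u (x, m)) * (1 + m powr r)) \<partial>lebesgue_on {0..}) < \<infinity>"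
    (is "?L \<longleftrightarrow> ?m \<and> ?f \<and> ?i < \<infinity>")
proof
  assume L: ?L
  then show "?m \<and> ?f \<and> ?i < \<infinity>"
    using L1_Xr_fibres[OF assms L] L1_norm_Xr[OF assms L, symmetric]
      borel_measurable_integrable[of "Xr \<Omega> r" u]
    by (auto simp: L1_def L1_Xr_measurable)
next
  assume R: "?m \<and> ?f \<and> ?i < \<infinity>"
  then have ?f by blast
  then have nn: "AE m in lebesgue_on {0..}. (\<integral>\<^sup>+x. ennreal \<bar>u (x, m)\<bar> \<partial>Xx \<Omega>) * ennreal (1 + m powr r) =
      ennreal (L1_norm (Xx \<Omega>) (\<lambda>x. u (x, m)) * (1 + m powr r))"
    by eventually_elim (simp add: ennreal_L1_norm[symmetric] ennreal_mult L1_norm_def)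
  then have "(\<integral>\<^sup>+m. (\<integral>\<^sup>+x. ennreal \<bar>u (x, m)\<bar> \<partial>Xx \<Omega>) * ennreal (1 + m powr r) \<partial>lebesgue_on {0..}) = ?i"
    using nn by (intro nn_integral_cong_AE) auto
  then show ?L
    using R nn_integral_Xr[OF assms, of u r]
    by (simp add: L1_def integrable_iff_bounded L1_Xr_measurable)
qed

end

theory Submission
  imports Defs "HOL-Probability.Discrete_Topology"
begin

text \<open>
  On the positive cone of \<open>L\<^sub>1\<close> the norm is additive. For \<open>r\<close> large, equi-integrability makes the weighted
  mass of the fragments small, so that \<open>\<parallel>B u\<parallel> \<le> 1/2 \<parallel>q u\<parallel> + C \<parallel>u\<parallel>\<close>, where \<open>q\<close> is the absorption rate
  (\<open>\<alpha>\<^sub>1\<close> or \<open>a\<close>). Absorption commutes with the restriction to the slices \<open>n \<le> m < n + 1\<close>, on which it is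
  bounded, because the transport semigroup acts fibrewise; solving the resolvent equation slice by slice
  and summing shows that \<open>T\<^sub>0 - q\<close> has the full domain \<open>D(T\<^sub>0) \<inter> D(q)\<close> and that
  \<open>\<lambda> \<parallel>u\<parallel> + \<parallel>q u\<parallel> \<le> \<parallel>f\<parallel>\<close> for the solution \<open>u\<close> with right-hand side \<open>f \<ge> 0\<close>. Hence \<open>B\<close> composed with the
  resolvent is, after a shift of \<open>q\<close> by \<open>2 C\<close>, a contraction with constant \<open>1/2\<close>, and \<open>T\<^sub>0 - q + B\<close> has
  positive contractive resolvents; the exponential formula then yields the semigroup.
\<close>

section \<open>Positive contractions on a closed cone\<close>

text \<open>Absorption by \<open>a (x, m)\<close> need not commute with transport, which acts in
  \<open>x\<close>; cutting in \<open>m\<close> alone does commute, and on a cut the rate lies below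
  a local bound of \<open>\<alpha>2\<close>. The constant 1/2 leaves room: in
  \<open>l * norm u + norm y \<le> norm (f + B u)\<close> with y = q u, half of the absorption pays
  for all of B, so the sum generates on the plain intersection of the domains. It arises as 1/(4M) +
  1/(4M), with M leading from \<open>\<alpha>2\<close> back to q: one part is the r-th moment, made
  small by raising r, the other the number of fragments, of order s^l and so dominated by s^r for
  large s. Small s only contribute to C. The cases q = \<open>\<alpha>1\<close> and q =
  \<open>a\<close> share one argument, so the second claim is reached directly and not by comparing
  semigroups. Positivity comes from fixed points and series inside the cone; a signed right-hand
  side is split so that the norms add, which preserves constants. Generators appear as graphs
  because the given operators act on representatives and are linear only almost everywhere.\<close>

lemma filterlim_at_right_real:
  assumes "(f \<longlongrightarrow> l) (at_right (0::real))" and "\<And>n::nat. 0 < h n" "h \<longlonglongrightarrow> 0"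
  shows "(\<lambda>n. f (h n)) \<longlonglongrightarrow> l"
proof (rule filterlim_compose[OF assms(1)])
  have "h n \<noteq> 0" for n using assms(2)[of n] by simp
  then show "filterlim h (at_right 0) sequentially"
    using assms(2,3) by (simp add: filterlim_at)
qed

lemma norm_diff_add: "norm (a - b + c) \<le> norm a + norm b + norm c"
  for a b c :: "'b::real_normed_vector"
  using norm_triangle_ineq[of "a - b" c] norm_triangle_ineq4[of a b] by linarith

lemma norm_scaleR_inverse: "0 < h \<Longrightarrow> norm (z /\<^sub>R h) = norm z / h"
  for z :: "'b::real_normed_vector"
  by (simp add: divide_inverse mult.commute)

text \<open>An abstract L-space. \<open>X\<close> is a closed subspace of an ambient Banach type and
  not a type of its own, because it will be the image of \<open>L1 M\<close> for a variable measure
  \<open>M\<close>. In place of lattice operations, \<open>decomp\<close> supplies positive and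
  negative parts whose norms add up exactly, so that estimates proved on \<open>P\<close> pass to
  \<open>X\<close> with the same constant.\<close>

locale al_cone =
  fixes X P :: "'b::banach set"
  assumes X_subspace: "subspace X" and X_closed: "closed X"
    and P_X: "P \<subseteq> X" and P_closed: "closed P" and P_0: "0 \<in> P"
    and P_add: "x \<in> P \<Longrightarrow> y \<in> P \<Longrightarrow> x + y \<in> P"
    and P_scale: "0 \<le> c \<Longrightarrow> x \<in> P \<Longrightarrow> c *\<^sub>R x \<in> P"
    and norm_add: "x \<in> P \<Longrightarrow> y \<in> P \<Longrightarrow> norm (x + y) = norm x + norm y"
    and decomp: "x \<in> X \<Longrightarrow> \<exists>p\<in>P. \<exists>n\<in>P. x = p - n \<and> norm x = norm p + norm n"
begin

lemma PX: "x \<in> P \<Longrightarrow> x \<in> X"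
  using P_X by blast

lemmas X_add = subspace_add[OF X_subspace] and X_diff = subspace_diff[OF X_subspace]
  and X_scale = subspace_scale[OF X_subspace] and X_0 = subspace_0[OF X_subspace]
  and X_neg = subspace_neg[OF X_subspace]

definition lin_op :: "('b \<Rightarrow> 'b) \<Rightarrow> bool" where
  "lin_op L \<longleftrightarrow> (\<forall>x\<in>X. L x \<in> X) \<and> (\<forall>x\<in>X. \<forall>y\<in>X. L (x + y) = L x + L y) \<and>
     (\<forall>c. \<forall>x\<in>X. L (c *\<^sub>R x) = c *\<^sub>R L x)"

lemma lin_opD:
  assumes "lin_op L"
  shows "x \<in> X \<Longrightarrow> L x \<in> X" "x \<in> X \<Longrightarrow> y \<in> X \<Longrightarrow> L (x + y) = L x + L y"
    "x \<in> X \<Longrightarrow> L (c *\<^sub>R x) = c *\<^sub>R L x"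
  using assms by (auto simp: lin_op_def)

lemma lin_op_minus: "lin_op L \<Longrightarrow> x \<in> X \<Longrightarrow> L (- x) = - L x"
  using lin_opD(3)[of L x "- 1"] by simp

lemma lin_op_diff: "lin_op L \<Longrightarrow> x \<in> X \<Longrightarrow> y \<in> X \<Longrightarrow> L (x - y) = L x - L y"
  using lin_opD(2)[of L x "- y"] lin_op_minus[of L y] X_neg by simp

lemma lin_op_0: "lin_op L \<Longrightarrow> L 0 = 0"
  using lin_opD(3)[of L 0 0] X_0 by simp

lemma lin_op_sum:
  assumes "lin_op L" "finite A" "\<And>k. k \<in> A \<Longrightarrow> f k \<in> X"
  shows "L (sum f A) = (\<Sum>k\<in>A. L (f k))"
  using assms(2,3)
proof (induction A rule: finite_induct)
  case empty
  then show ?case using lin_op_0[OF assms(1)] by simp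
next
  case (insert k A)
  then have "sum f A \<in> X" by (intro subspace_sum[OF X_subspace]) auto
  with insert show ?case using lin_opD(2)[OF assms(1)] by simp
qed

definition pcontr :: "('b \<Rightarrow> 'b) \<Rightarrow> bool" where
  "pcontr L \<longleftrightarrow> lin_op L \<and> (\<forall>x\<in>P. L x \<in> P) \<and> (\<forall>x\<in>X. norm (L x) \<le> norm x)"

lemma pcontrD:
  assumes "pcontr L"
  shows "lin_op L" "x \<in> P \<Longrightarrow> L x \<in> P" "x \<in> X \<Longrightarrow> norm (L x) \<le> norm x"
  using assms by (auto simp: pcontr_def)

lemma pcontr_X: "pcontr L \<Longrightarrow> x \<in> X \<Longrightarrow> L x \<in> X"
  using pcontrD(1) lin_opD(1) by blast

lemma pcontr_diff: "pcontr L \<Longrightarrow> x \<in> X \<Longrightarrow> y \<in> X \<Longrightarrow> L (x - y) = L x - L y"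
  using pcontrD(1) lin_op_diff by blast

lemma pcontr_dist:
  "pcontr L \<Longrightarrow> x \<in> X \<Longrightarrow> y \<in> X \<Longrightarrow> norm (L x - L y) \<le> norm (x - y)"
  using pcontr_diff[of L x y] pcontrD(3)[of L "x - y"] X_diff[of x y] by simp

lemma pcontr_comp: "pcontr L \<Longrightarrow> pcontr K \<Longrightarrow> pcontr (\<lambda>x. L (K x))"
proof -
  assume L: "pcontr L" and K: "pcontr K"
  have "norm (L (K x)) \<le> norm x" if "x \<in> X" for x
    using L K that unfolding pcontr_def lin_op_def by (meson order_trans)
  with L K show ?thesis by (simp add: pcontr_def lin_op_def)
qed

lemma pcontr_funpow: "pcontr L \<Longrightarrow> pcontr (L ^^ n)"
proof (induction n)
  case 0
  show ?case by (simp add: pcontr_def lin_op_def)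
next
  case (Suc n)
  from pcontr_comp[OF Suc.prems Suc.IH[OF Suc.prems]] show ?case by (simp add: comp_def)
qed

text \<open>Every clause of \<open>pcontr\<close> is a closed condition on values, since
  \<open>X\<close> and \<open>P\<close> are closed. In this way the limit of the exponential formula
  inherits linearity, positivity and contractivity.\<close>

lemma pcontr_limit:
  assumes "\<And>n. pcontr (L n)" "\<And>x. x \<in> X \<Longrightarrow> (\<lambda>n. L n x) \<longlonglongrightarrow> L' x"
  shows "pcontr L'"
  unfolding pcontr_def lin_op_def
proof (intro conjI ballI allI)
  fix x assume x: "x \<in> X"
  show "L' x \<in> X"
    using assms(2)[OF x] pcontr_X[OF assms(1) x] X_closed
    by (meson closed_sequentially)
  show "norm (L' x) \<le> norm x"
    using tendsto_norm[OF assms(2)[OF x]] pcontrD(3)[OF assms(1) x]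
    by (intro tendsto_upperbound) auto
  show "L' (c *\<^sub>R x) = c *\<^sub>R L' x" for c
  proof -
    have "(\<lambda>n. L n (c *\<^sub>R x)) \<longlonglongrightarrow> c *\<^sub>R L' x"
      using tendsto_scaleR[OF tendsto_const assms(2)[OF x]]
      by (simp add: lin_opD(3)[OF pcontrD(1)[OF assms(1)] x])
    with assms(2)[OF X_scale[OF x]] show ?thesis by (rule LIMSEQ_unique)
  qed
  fix y assume y: "y \<in> X"
  have "(\<lambda>n. L n (x + y)) \<longlonglongrightarrow> L' x + L' y"
    using tendsto_add[OF assms(2)[OF x] assms(2)[OF y]]
    by (simp add: lin_opD(2)[OF pcontrD(1)[OF assms(1)] x y])
  with assms(2)[OF X_add[OF x y]] show "L' (x + y) = L' x + L' y" by (rule LIMSEQ_unique)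
next
  fix x assume x: "x \<in> P"
  show "L' x \<in> P"
    using assms(2)[OF PX[OF x]] pcontrD(2)[OF assms(1) x] P_closed
    by (meson closed_sequentially)
qed

lemma funpow_commute_on:
  assumes "pcontr U" "pcontr V" "\<And>x. x \<in> X \<Longrightarrow> U (V x) = V (U x)" "x \<in> X"
  shows "U ((V ^^ n) x) = (V ^^ n) (U x)"
proof (induction n)
  case (Suc n)
  have "(V ^^ n) x \<in> X" using pcontr_X[OF pcontr_funpow[OF assms(2)] assms(4)] .
  with Suc assms(3) show ?case by simp
qed simp

text \<open>Telescoping: U^n - V^n is a sum of n terms, and by commutation each is a product of n -
  1 contractions applied to \<open>U x - V x\<close>. The error grows only linearly in n, so
  one-step errors of order 1/n^2 are harmless.\<close>

lemma funpow_diff_bound: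
  assumes "pcontr U" "pcontr V" "\<And>x. x \<in> X \<Longrightarrow> U (V x) = V (U x)" "x \<in> X"
  shows "norm ((U ^^ n) x - (V ^^ n) x) \<le> real n * norm (U x - V x)"
proof (induction n)
  case (Suc n)
  have Ux: "(U ^^ n) x \<in> X" and Vx: "(V ^^ n) x \<in> X" and Vn: "pcontr (V ^^ n)"
    using pcontr_X[OF pcontr_funpow[OF assms(1)] assms(4)] pcontr_X[OF pcontr_funpow[OF assms(2)] assms(4)]
      pcontr_funpow[OF assms(2)] by auto
  have "U ((V ^^ n) x) - V ((V ^^ n) x) = (V ^^ n) (U x - V x)"
    using funpow_commute_on[OF assms(1,2,3,4)] pcontr_diff[OF Vn] pcontr_X[OF assms(1,4)]
      pcontr_X[OF assms(2,4)] by (simp add: funpow_swap1)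
  then have "(U ^^ Suc n) x - (V ^^ Suc n) x =
      (U ((U ^^ n) x) - U ((V ^^ n) x)) + (V ^^ n) (U x - V x)"
    by (metis (no_types, lifting) add_diff_cancel_left' diff_add_cancel diff_add_eq diff_diff_eq2 funpow.simps(2) o_apply)
  also have "norm \<dots> \<le> norm (U ((U ^^ n) x) - U ((V ^^ n) x)) + norm ((V ^^ n) (U x - V x))"
    by (rule norm_triangle_ineq)
  also have "\<dots> \<le> real n * norm (U x - V x) + norm (U x - V x)"
  proof (rule add_mono)
    show "norm (U ((U ^^ n) x) - U ((V ^^ n) x)) \<le> real n * norm (U x - V x)"
      using pcontr_dist[OF assms(1) Ux Vx] Suc by linarith
    show "norm ((V ^^ n) (U x - V x)) \<le> norm (U x - V x)"
      using pcontrD(3)[OF Vn] X_diff pcontr_X[OF assms(1,4)] pcontr_X[OF assms(2,4)] by blast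
  qed
  finally show ?case by (simp add: algebra_simps)
qed simp

section \<open>Semigroups of positive contractions\<close>

definition pc_semigroup :: "(real \<Rightarrow> 'b \<Rightarrow> 'b) \<Rightarrow> bool" where
  "pc_semigroup S \<longleftrightarrow> (\<forall>t\<ge>0. pcontr (S t)) \<and> (\<forall>x\<in>X. S 0 x = x) \<and>
     (\<forall>s\<ge>0. \<forall>t\<ge>0. \<forall>x\<in>X. S (s + t) x = S s (S t x)) \<and>
     (\<forall>x\<in>X. ((\<lambda>t. S t x) \<longlongrightarrow> x) (at_right 0))"

lemma pc_semigroupD:
  assumes "pc_semigroup S"
  shows "t \<ge> 0 \<Longrightarrow> pcontr (S t)" "x \<in> X \<Longrightarrow> S 0 x = x"
    "s \<ge> 0 \<Longrightarrow> t \<ge> 0 \<Longrightarrow> x \<in> X \<Longrightarrow> S (s + t) x = S s (S t x)"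
    "x \<in> X \<Longrightarrow> ((\<lambda>t. S t x) \<longlongrightarrow> x) (at_right 0)"
  using assms by (auto simp: pc_semigroup_def)

text \<open>A graph instead of an operator with a domain: sums, limits and equality of generators
  become statements about subspaces of the product space.\<close>

definition gen :: "(real \<Rightarrow> 'b \<Rightarrow> 'b) \<Rightarrow> ('b \<times> 'b) set" where
  "gen S = {(x, y). x \<in> X \<and> y \<in> X \<and> ((\<lambda>h. (S h x - x) /\<^sub>R h) \<longlongrightarrow> y) (at_right 0)}"

lemma genD:
  assumes "(x, y) \<in> gen S"
  shows "x \<in> X" "y \<in> X" "((\<lambda>h. (S h x - x) /\<^sub>R h) \<longlongrightarrow> y) (at_right 0)"
  using assms by (auto simp: gen_def)

lemma gen_subspace:
  assumes S: "pc_semigroup S"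
  shows "subspace (gen S)"
proof (rule subspaceI)
  have pos: "eventually (\<lambda>h::real. 0 < h) (at_right 0)"
    by (simp add: eventually_at_right_less)
  have "((\<lambda>h. (S h 0 - 0) /\<^sub>R h) \<longlongrightarrow> 0) (at_right 0)"
    by (rule tendsto_eventually, rule eventually_mono[OF pos])
      (simp add: lin_op_0[OF pcontrD(1)[OF pc_semigroupD(1)[OF S]]])
  then show "0 \<in> gen S" by (simp add: gen_def X_0 zero_prod_def)
next
  have pos: "eventually (\<lambda>h::real. 0 < h) (at_right 0)"
    by (simp add: eventually_at_right_less)
  fix a b assume a: "a \<in> gen S" and b: "b \<in> gen S"
  obtain x y x' y' where [simp]: "a = (x, y)" "b = (x', y')" by fastforce
  note A = genD[OF a[simplified]] and B = genD[OF b[simplified]]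
  have "((\<lambda>h. (S h (x + x') - (x + x')) /\<^sub>R h) \<longlongrightarrow> y + y') (at_right 0)"
    by (rule Lim_transform_eventually[OF tendsto_add[OF A(3) B(3)]], rule eventually_mono[OF pos])
      (simp only: lin_opD(2)[OF pcontrD(1)[OF pc_semigroupD(1)[OF S]] A(1) B(1)] less_imp_le
        scaleR_add_right[symmetric] add_diff_add)
  then show "a + b \<in> gen S" using A B by (simp add: gen_def X_add)
next
  have pos: "eventually (\<lambda>h::real. 0 < h) (at_right 0)"
    by (simp add: eventually_at_right_less)
  fix c a assume a: "a \<in> gen S"
  obtain x y where [simp]: "a = (x, y)" by fastforce
  note A = genD[OF a[simplified]]
  have "((\<lambda>h. (S h (c *\<^sub>R x) - c *\<^sub>R x) /\<^sub>R h) \<longlongrightarrow> c *\<^sub>R y) (at_right 0)"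
    by (rule Lim_transform_eventually[OF tendsto_scaleR[OF tendsto_const A(3)]], rule eventually_mono[OF pos])
      (simp add: lin_opD(3)[OF pcontrD(1)[OF pc_semigroupD(1)[OF S]] A(1)] algebra_simps)
  then show "c *\<^sub>R a \<in> gen S" using A by (simp add: gen_def X_scale)
qed

text \<open>Write \<open>x + h *\<^sub>R l *\<^sub>R x\<close> through \<open>S h x\<close>, whose
  norm is at most that of \<open>x\<close>, plus h times \<open>l *\<^sub>R x - y\<close> and h
  times the defect of the difference quotient; divide by h and let h tend to 0. Contractivity alone
  gives dissipativity, without duality maps.\<close>

lemma gen_dissipative:
  assumes S: "pc_semigroup S" and xy: "(x, y) \<in> gen S" and l: "0 \<le> l"
  shows "l * norm x \<le> norm (l *\<^sub>R x - y)"
proof -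
  note A = genD[OF xy]
  have pos: "eventually (\<lambda>h::real. 0 < h) (at_right 0)"
    by (simp add: eventually_at_right_less)
  let ?r = "\<lambda>h. norm ((S h x - x) /\<^sub>R h - y) + norm (l *\<^sub>R x - y)"
  have "(?r \<longlongrightarrow> norm (y - y) + norm (l *\<^sub>R x - y)) (at_right 0)"
    by (intro tendsto_intros A)
  then have lim: "(?r \<longlongrightarrow> norm (l *\<^sub>R x - y)) (at_right 0)" by simp
  show ?thesis
  proof (rule tendsto_lowerbound[OF lim], rule eventually_mono[OF pos])
    fix h :: real assume h: "0 < h"
    have "x + h *\<^sub>R l *\<^sub>R x = S h x - h *\<^sub>R ((S h x - x) /\<^sub>R h - y) + h *\<^sub>R (l *\<^sub>R x - y)"
      using h by (simp add: algebra_simps)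
    then have "norm (x + h *\<^sub>R l *\<^sub>R x) \<le> norm (S h x) +
        norm (h *\<^sub>R ((S h x - x) /\<^sub>R h - y)) + norm (h *\<^sub>R (l *\<^sub>R x - y))"
      by (simp only: norm_diff_add)
    also have "norm (x + h *\<^sub>R l *\<^sub>R x) = (1 + h * l) * norm x"
    proof -
      have "x + h *\<^sub>R l *\<^sub>R x = (1 + h * l) *\<^sub>R x" by (simp add: scaleR_left_distrib)
      then show ?thesis using h l by simp
    qed
    also have "norm (S h x) \<le> norm x"
      using pcontrD(3)[OF pc_semigroupD(1)[OF S] A(1)] h by simp
    finally have "h * (l * norm x) \<le> h * ?r h"
      using h by (simp add: distrib_left distrib_right mult.assoc)
    then show "l * norm x \<le> ?r h" using h by simp
  qed simp
qed

text \<open>Additivity of the norm on the cone turns the contractivity of \<open>S h\<close> into a bound with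
  constant one.\<close>

lemma gen_norm_le:
  assumes S: "pc_semigroup S" and xy: "(x, y) \<in> gen S" and x: "x \<in> P" and w: "w \<in> P"
  shows "norm w \<le> norm (w - y)"
proof -
  note A = genD[OF xy]
  have pos: "eventually (\<lambda>h::real. 0 < h) (at_right 0)"
    by (simp add: eventually_at_right_less)
  let ?r = "\<lambda>h. norm ((S h x - x) /\<^sub>R h - y) + norm (w - y)"
  have "(?r \<longlongrightarrow> norm (y - y) + norm (w - y)) (at_right 0)"
    by (intro tendsto_intros A)
  then have lim: "(?r \<longlongrightarrow> norm (w - y)) (at_right 0)" by simp
  show ?thesis
  proof (rule tendsto_lowerbound[OF lim], rule eventually_mono[OF pos])
    fix h :: real assume h: "0 < h"
    have "x + h *\<^sub>R w = S h x - h *\<^sub>R ((S h x - x) /\<^sub>R h - y) + h *\<^sub>R (w - y)"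
      using h by (simp add: algebra_simps)
    then have "norm (x + h *\<^sub>R w) \<le> norm (S h x) +
        norm (h *\<^sub>R ((S h x - x) /\<^sub>R h - y)) + norm (h *\<^sub>R (w - y))"
      by (simp only: norm_diff_add)
    also have "norm (x + h *\<^sub>R w) = norm x + h * norm w"
      using norm_add[OF x P_scale[OF _ w]] h by simp
    also have "norm (S h x) \<le> norm x"
      using pcontrD(3)[OF pc_semigroupD(1)[OF S] A(1)] h by simp
    finally have "h * norm w \<le> h * ?r h"
      using h by (simp add: distrib_left)
    then show "norm w \<le> ?r h" using h by simp
  qed simp
qed

end

section \<open>Generation by the exponential formula\<close>

text \<open>The hypotheses of a generation theorem in the form in which they can be checked on a
  cone: solvability and the norm bound are asked for positive right-hand sides, and for arbitrary
  elements of the graph only uniqueness is asked. Dissipativity on all of \<open>A\<close> is a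
  consequence of these.\<close>

locale dissipative_graph = al_cone X P for X P :: "'b::banach set" +
  fixes A :: "('b \<times> 'b) set"
  assumes A_X: "(x, y) \<in> A \<Longrightarrow> x \<in> X \<and> y \<in> X"
    and A_subspace: "subspace A"
    and A_range: "0 < l \<Longrightarrow> f \<in> P \<Longrightarrow>
          \<exists>u v. (u, v) \<in> A \<and> u \<in> P \<and> l *\<^sub>R u - v = f \<and> l * norm u \<le> norm f"
    and A_inj: "0 < l \<Longrightarrow> (u, l *\<^sub>R u) \<in> A \<Longrightarrow> u = 0"
    and A_dense: "X \<subseteq> closure (fst ` A)"
begin

section \<open>Resolvents of the graph as commuting positive contractions\<close>

lemma A_diff: "(x, y) \<in> A \<Longrightarrow> (x', y') \<in> A \<Longrightarrow> (x - x', y - y') \<in> A"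
  using subspace_diff[OF A_subspace, of "(x, y)" "(x', y')"] by simp

lemma A_add: "(x, y) \<in> A \<Longrightarrow> (x', y') \<in> A \<Longrightarrow> (x + x', y + y') \<in> A"
  using subspace_add[OF A_subspace, of "(x, y)" "(x', y')"] by simp

lemma A_scale: "(x, y) \<in> A \<Longrightarrow> (c *\<^sub>R x, c *\<^sub>R y) \<in> A"
  using subspace_scale[OF A_subspace, of "(x, y)" c] by simp

lemma resolvent_unique:
  assumes h: "0 < h" and "(u, v) \<in> A" "(u', v') \<in> A" "u - h *\<^sub>R v = u' - h *\<^sub>R v'"
  shows "u = u'"
proof -
  have "v - v' = (1 / h) *\<^sub>R (u - u')"
  proof -
    have "u - u' = h *\<^sub>R (v - v')" using assms(4) by (simp add: scaleR_diff_right algebra_simps)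
    then show ?thesis using h by simp
  qed
  with A_diff[OF assms(2,3)] have "(u - u', (1 / h) *\<^sub>R (u - u')) \<in> A" by simp
  with A_inj[of "1 / h" "u - u'"] h show ?thesis by simp
qed

text \<open>For signed \<open>f\<close> the two positive problems with data \<open>p\<close> and
  \<open>n\<close> are subtracted; because \<open>norm f = norm p + norm n\<close>, the constant
  stays one, which the powers of the resolvent require.\<close>

lemma resolvent_ex:
  assumes h: "0 < h" and f: "f \<in> X"
  shows "\<exists>u v. (u, v) \<in> A \<and> u - h *\<^sub>R v = f \<and> norm u \<le> norm f \<and> (f \<in> P \<longrightarrow> u \<in> P)"
proof -
  have pos: "\<exists>u v. (u, v) \<in> A \<and> u - h *\<^sub>R v = f \<and> norm u \<le> norm f \<and> u \<in> P" if f: "f \<in> P" for f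
  proof -
    obtain u v where *: "(u, v) \<in> A" "u \<in> P" "(1 / h) *\<^sub>R u - v = (1 / h) *\<^sub>R f"
        "(1 / h) * norm u \<le> norm ((1 / h) *\<^sub>R f)"
      using A_range[of "1 / h" "(1 / h) *\<^sub>R f"] h P_scale[OF _ f, of "1 / h"] by auto
    have "u - h *\<^sub>R v = h *\<^sub>R ((1 / h) *\<^sub>R u - v)"
      using h by (simp add: scaleR_diff_right)
    also have "\<dots> = f" using h *(3) by simp
    finally have "u - h *\<^sub>R v = f" .
    moreover have "norm u \<le> norm f" using *(4) h by (simp add: field_simps)
    ultimately show ?thesis using * by blast
  qed
  show ?thesis
  proof (cases "f \<in> P")
    case True
    then show ?thesis using pos by blast
  next
    case False
    obtain p n where pn: "p \<in> P" "n \<in> P" "f = p - n" "norm f = norm p + norm n"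
      using decomp[OF f] by blast
    obtain u v where u: "(u, v) \<in> A" "u - h *\<^sub>R v = p" "norm u \<le> norm p" using pos[OF pn(1)] by blast
    obtain u' v' where u': "(u', v') \<in> A" "u' - h *\<^sub>R v' = n" "norm u' \<le> norm n" using pos[OF pn(2)] by blast
    have "(u - u') - h *\<^sub>R (v - v') = f"
      using u(2) u'(2) pn(3) by (simp add: algebra_simps)
    moreover have "norm (u - u') \<le> norm f"
      using norm_triangle_ineq4[of u u'] u(3) u'(3) pn(4) by linarith
    ultimately show ?thesis using A_diff[OF u(1) u'(1)] False by blast
  qed
qed

text \<open>This is the inverse of 1 - h A, one backward Euler step of length h, and not the inverse
  of h - A.\<close>

definition resolvent :: "real \<Rightarrow> 'b \<Rightarrow> 'b" where
  "resolvent h f = (SOME u. \<exists>v. (u, v) \<in> A \<and> u - h *\<^sub>R v = f)"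

lemma resolvent_props:
  assumes h: "0 < h" and f: "f \<in> X"
  shows "\<exists>v. (resolvent h f, v) \<in> A \<and> resolvent h f - h *\<^sub>R v = f"
  unfolding resolvent_def by (rule someI_ex) (use resolvent_ex[OF assms] in blast)

lemma resolvent_eqI:
  assumes h: "0 < h" and "(u, v) \<in> A" "u - h *\<^sub>R v = f"
  shows "resolvent h f = u"
proof -
  have "f \<in> X" using A_X[OF assms(2)] assms(3) X_diff X_scale by blast
  then show ?thesis using resolvent_props[OF h] resolvent_unique[OF h _ assms(2)] assms(3) by blast
qed

lemma resolvent_pcontr: assumes h: "0 < h" shows "pcontr (resolvent h)"
  unfolding pcontr_def lin_op_def
proof (intro conjI ballI allI)
  fix x assume x: "x \<in> X"
  then obtain v where v: "(resolvent h x, v) \<in> A" "resolvent h x - h *\<^sub>R v = x" using resolvent_props[OF h] by blast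
  show "resolvent h x \<in> X" using A_X v by blast
  show "norm (resolvent h x) \<le> norm x" using resolvent_ex[OF h x] resolvent_eqI[OF h] by metis
  show "resolvent h (c *\<^sub>R x) = c *\<^sub>R resolvent h x" for c
    using v by (intro resolvent_eqI[OF h A_scale[OF v(1)]]) (metis scaleR_diff_right scaleR_left_commute)
  fix y assume y: "y \<in> X"
  then obtain w where w: "(resolvent h y, w) \<in> A" "resolvent h y - h *\<^sub>R w = y" using resolvent_props[OF h] by blast
  show "resolvent h (x + y) = resolvent h x + resolvent h y"
    using v w by (intro resolvent_eqI[OF h A_add[OF v(1) w(1)]]) (simp add: algebra_simps)
next
  fix x assume "x \<in> P"
  then show "resolvent h x \<in> P" using resolvent_ex[OF h PX] resolvent_eqI[OF h] by metis
qed

lemma resolvent_of_A: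
  assumes h: "0 < h" and xy: "(x, y) \<in> A"
  shows "resolvent h (x - h *\<^sub>R y) = x" "resolvent h x - x = h *\<^sub>R resolvent h y" "(resolvent h x, resolvent h y) \<in> A"
proof -
  note X = A_X[OF xy]
  show 1: "resolvent h (x - h *\<^sub>R y) = x" using resolvent_eqI[OF h xy] by blast
  have "resolvent h (x - h *\<^sub>R y) = resolvent h x - h *\<^sub>R resolvent h y"
    using X pcontr_diff[OF resolvent_pcontr[OF h]] lin_opD(3)[OF pcontrD(1)[OF resolvent_pcontr[OF h]]] X_scale by simp
  with 1 show 2: "resolvent h x - x = h *\<^sub>R resolvent h y" by (simp add: algebra_simps)
  obtain v where v: "(resolvent h x, v) \<in> A" "resolvent h x - h *\<^sub>R v = x" using resolvent_props[OF h] X by blast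
  have "h *\<^sub>R v = h *\<^sub>R resolvent h y" using v(2) 2 by (simp add: algebra_simps)
  with h v(1) show "(resolvent h x, resolvent h y) \<in> A" by simp
qed

lemma resolvent_bound: "0 < h \<Longrightarrow> (x, y) \<in> A \<Longrightarrow> norm (resolvent h x - x) \<le> h * norm y"
  using resolvent_of_A(2)[of h x y] pcontrD(3)[OF resolvent_pcontr, of h y] A_X[of x y] by simp

text \<open>Apply \<open>resolvent a\<close> to the equation solved by \<open>resolvent b x\<close>:
  it maps the graph of \<open>A\<close> into itself, so the result again solves a resolvent equation
  with step \<open>b\<close>, and the solution is unique.\<close>

lemma resolvent_commute:
  assumes "0 < a" "0 < b" "x \<in> X"
  shows "resolvent a (resolvent b x) = resolvent b (resolvent a x)"
proof -
  note X = pcontr_X[OF resolvent_pcontr]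
  obtain v where v: "(resolvent b x, v) \<in> A" "resolvent b x - b *\<^sub>R v = x" using resolvent_props assms by blast
  have "resolvent a (resolvent b x) - b *\<^sub>R resolvent a v = resolvent a (resolvent b x - b *\<^sub>R v)"
    using A_X[OF v(1)] pcontr_diff[OF resolvent_pcontr[OF assms(1)]] X_scale
      lin_opD(3)[OF pcontrD(1)[OF resolvent_pcontr[OF assms(1)]]] by simp
  with v(2) have "resolvent a (resolvent b x) - b *\<^sub>R resolvent a v = resolvent a x" by simp
  then show ?thesis using resolvent_eqI[OF assms(2) resolvent_of_A(3)[OF assms(1) v(1)]] by simp
qed

text \<open>\<open>(1 - a A) (1 - b A) - (1 - (a + b) A) = a b A\<^sup>2\<close>; both the convergence of the exponential formula
  and the semigroup property come from this.\<close>

lemma resolvent_add_bound: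
  assumes a: "0 < a" and b: "0 < b" and xy: "(x, y) \<in> A" and yz: "(y, z) \<in> A"
  shows "norm (resolvent (a + b) x - resolvent a (resolvent b x)) \<le> a * b * norm z"
proof -
  have ab: "0 < a + b" using a b by simp
  note Xm = A_X[OF xy] A_X[OF yz]
  note pa = resolvent_pcontr[OF a] and pb = resolvent_pcontr[OF b] and pc = resolvent_pcontr[OF ab]
  let ?w = "x - (a + b) *\<^sub>R y" and ?L = "\<lambda>x. resolvent a (resolvent b x)"
  have pL: "pcontr ?L" using pcontr_comp[OF pa pb] .
  have Xs: "?w \<in> X" "(a * b) *\<^sub>R z \<in> X" using Xm X_scale X_diff by auto
  have "?L x = ?L (resolvent (a + b) ?w)" using resolvent_of_A(1)[OF ab xy] by simp
  also have "\<dots> = resolvent (a + b) (?L ?w)"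
    using resolvent_commute a b ab Xs(1) pcontr_X[OF pb] by simp
  finally have 1: "?L x = resolvent (a + b) (?L ?w)" .
  have "(x - a *\<^sub>R y) - b *\<^sub>R (y - a *\<^sub>R z) = ?w + (a * b) *\<^sub>R z"
    by (simp add: algebra_simps)
  moreover have "(x - a *\<^sub>R y, y - a *\<^sub>R z) \<in> A" using A_diff[OF xy A_scale[OF yz]] .
  ultimately have "x = ?L (?w + (a * b) *\<^sub>R z)"
    using resolvent_of_A(1)[OF b, of "x - a *\<^sub>R y" "y - a *\<^sub>R z"] resolvent_of_A(1)[OF a xy] by metis
  then have "resolvent (a + b) x - ?L x = resolvent (a + b) (?L (?w + (a * b) *\<^sub>R z) - ?L ?w)"
    using 1 pcontr_diff[OF pc, of x "?L ?w"] pcontr_X[OF pL Xs(1)] Xm(1) by simp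
  also have "\<dots> = resolvent (a + b) (?L ((a * b) *\<^sub>R z))"
    using lin_opD(2)[OF pcontrD(1)[OF pL] Xs] by simp
  also have "norm \<dots> \<le> norm (?L ((a * b) *\<^sub>R z))"
    using pcontrD(3)[OF pc] pcontr_X[OF pL Xs(2)] by simp
  also have "\<dots> \<le> norm ((a * b) *\<^sub>R z)" using pcontrD(3)[OF pL Xs(2)] .
  finally show ?thesis using a b by simp
qed

section \<open>Convergence of the exponential formula\<close>

definition A2 :: "('b \<times> 'b) set" where
  "A2 = {(x, z). \<exists>y. (x, y) \<in> A \<and> (y, z) \<in> A}"

lemma resolvent_tendsto:
  assumes x: "x \<in> X"
  shows "((\<lambda>h. resolvent h x) \<longlongrightarrow> x) (at_right 0)"
proof (rule tendstoI)
  fix e :: real assume e: "0 < e"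
  obtain x' y where x': "(x', y) \<in> A" "dist x' x < e / 3"
  proof -
    have "x \<in> closure (fst ` A)" using x A_dense by blast
    then obtain w where "w \<in> fst ` A" "dist w x < e / 3"
      using e closure_approachable[of x "fst ` A"] by (meson divide_pos_pos zero_less_numeral)
    then show ?thesis using that by force
  qed
  have e3: "0 < e / 3" using e by simp
  have "eventually (\<lambda>h. h * norm y < e / 3) (at_right 0)"
    by (rule order_tendstoD(2)[OF tendsto_mult_left_zero[OF tendsto_ident_at] e3])
  then have "eventually (\<lambda>h. 0 < h \<and> h * norm y < e / 3) (at_right 0)"
    using eventually_at_right_less by (rule eventually_conj[rotated])
  then show "eventually (\<lambda>h. dist (resolvent h x) x < e) (at_right 0)"
  proof eventually_elim
    fix h assume h: "0 < h \<and> h * norm y < e / 3"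
    then have "dist (resolvent h x) (resolvent h x') \<le> dist x x'"
      using pcontr_dist[OF resolvent_pcontr x] A_X[OF x'(1)] by (simp add: dist_norm)
    moreover have "dist (resolvent h x') x' < e / 3"
      using resolvent_bound[OF _ x'(1), of h] h by (simp add: dist_norm)
    ultimately show "dist (resolvent h x) x < e" using x'(2)
      using dist_triangle[of "resolvent h x" x "resolvent h x'"] dist_triangle[of "resolvent h x'" x x'] dist_commute[of x x']
      by linarith
  qed
qed

text \<open>Two applications of the resolvent with small steps move any point into the domain of the
  square of \<open>A\<close> without moving it far. Comparing products of resolvents is quantitative
  only on that domain; density and contractivity do the rest.\<close>

lemma A2_approx:
  assumes x: "x \<in> X" and e: "0 < e"
  shows "\<exists>(x', z)\<in>A2. norm (x' - x) < e"
proof -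
  have lim: "(\<lambda>n. resolvent (1 / real (Suc n)) w) \<longlonglongrightarrow> w" if "w \<in> X" for w
    using filterlim_at_right_real[OF resolvent_tendsto[OF that], of "\<lambda>n. 1 / real (Suc n)"]
      LIMSEQ_inverse_real_of_nat by (simp add: inverse_eq_divide)
  obtain n where n: "norm (resolvent (1 / real (Suc n)) x - x) < e / 2"
    using LIMSEQ_D[OF lim[OF x], of "e / 2"] e by auto
  let ?a = "1 / real (Suc n)"
  have a: "0 < ?a" by simp
  obtain y where y: "(resolvent ?a x, y) \<in> A" using resolvent_props[OF a x] by blast
  then obtain m where m: "norm (resolvent (1 / real (Suc m)) (resolvent ?a x) - resolvent ?a x) < e / 2"
    using LIMSEQ_D[OF lim[of "resolvent ?a x"], of "e / 2"] A_X e by auto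
  let ?b = "1 / real (Suc m)"
  have b: "0 < ?b" by simp
  obtain z where z: "(resolvent ?b y, z) \<in> A" using resolvent_props[OF b] A_X[OF y] by blast
  have "(resolvent ?b (resolvent ?a x), z) \<in> A2" unfolding A2_def using resolvent_of_A(3)[OF b y] z by blast
  moreover have "norm (resolvent ?b (resolvent ?a x) - x) < e"
    using norm_triangle_lt[of "resolvent ?b (resolvent ?a x) - resolvent ?a x" "resolvent ?a x - x" e] n m by simp
  ultimately show ?thesis by blast
qed

text \<open>Step sizes are halved, so that consecutive approximants differ by replacing each step
  with its two halves. The differences then decay geometrically and can be summed.\<close>

definition euler :: "nat \<Rightarrow> real \<Rightarrow> 'b \<Rightarrow> 'b" where
  "euler n t = resolvent (t / 2 ^ n) ^^ (2 ^ n)"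

lemma euler_pcontr: "0 < t \<Longrightarrow> pcontr (euler n t)"
  unfolding euler_def by (intro pcontr_funpow resolvent_pcontr) simp

text \<open>One step of length 2h and two steps of length h differ by at most h^2 times
  \<open>norm z\<close>. With h = t / 2^(n+1) and 2^n such replacements, this adds up to t^2/4 times
  2^(-n).\<close>

lemma euler_step:
  assumes t: "0 < t" and x: "(x, z) \<in> A2"
  shows "norm (euler (Suc n) t x - euler n t x) \<le> t\<^sup>2 / 4 * norm z * (1 / 2) ^ n"
proof -
  obtain y where y: "(x, y) \<in> A" "(y, z) \<in> A" using x by (auto simp: A2_def)
  let ?h = "t / 2 ^ Suc n"
  have h: "0 < ?h" using t by simp
  have hh: "?h + ?h = t / 2 ^ n" by simp
  let ?U = "resolvent (t / 2 ^ n)" and ?V = "\<lambda>x. resolvent ?h (resolvent ?h x)"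
  have U: "pcontr ?U" using resolvent_pcontr t by simp
  have V: "pcontr ?V" using pcontr_comp resolvent_pcontr[OF h] by blast
  have "resolvent ?h ^^ (2 ^ Suc n) = ?V ^^ (2 ^ n)"
    using funpow_mult[where m = 2 and f = "resolvent ?h" and n = "2 ^ n"] by (simp add: numeral_2_eq_2 comp_def)
  then have eq: "euler (Suc n) t x = (?V ^^ (2 ^ n)) x" by (simp add: euler_def)
  have comm: "?U (?V w) = ?V (?U w)" if "w \<in> X" for w
    using resolvent_commute[of "t / 2 ^ n" ?h] t that pcontr_X[OF resolvent_pcontr[OF h]] by simp
  have "norm (euler n t x - euler (Suc n) t x) \<le> real (2 ^ n) * norm (?U x - ?V x)"
    unfolding eq euler_def[of n] using funpow_diff_bound[OF U V comm] A_X[OF y(1)] by blast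
  also have "norm (?U x - ?V x) \<le> ?h * ?h * norm z"
    using resolvent_add_bound[OF h h y] unfolding hh .
  also have "real (2 ^ n) * (?h * ?h * norm z) = t\<^sup>2 / 4 * norm z * (1 / 2) ^ n"
    by (simp add: power2_eq_square field_simps power_add[symmetric])
  finally show ?thesis by (simp add: norm_minus_commute)
qed

lemma euler_sub:
  assumes t: "0 < t" and x: "(x, z) \<in> A2"
  shows "norm (euler (n + k) t x - euler n t x) \<le> t\<^sup>2 / 2 * norm z * (1 / 2) ^ n"
proof -
  \<comment> \<open>The geometric sum is kept in closed form, with its tail subtracted, so that the
    next step of the induction adds exactly the bound of \<open>euler_step\<close>.\<close>
  have "norm (euler (n + k) t x - euler n t x) \<le> t\<^sup>2 / 2 * norm z * ((1 / 2) ^ n - (1 / 2) ^ (n + k))"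
  proof (induction k)
    case (Suc k)
    have "norm (euler (n + Suc k) t x - euler n t x) \<le>
        norm (euler (Suc (n + k)) t x - euler (n + k) t x) + norm (euler (n + k) t x - euler n t x)"
      using norm_triangle_ineq[of "euler (Suc (n + k)) t x - euler (n + k) t x" "euler (n + k) t x - euler n t x"]
      by simp
    also have "\<dots> \<le> t\<^sup>2 / 4 * norm z * (1 / 2) ^ (n + k) +
        t\<^sup>2 / 2 * norm z * ((1 / 2) ^ n - (1 / 2) ^ (n + k))"
      using euler_step[OF t x] Suc by (rule add_mono)
    also have "\<dots> = t\<^sup>2 / 2 * norm z * ((1 / 2) ^ n - (1 / 2) ^ (n + Suc k))"
      by (simp add: algebra_simps)
    finally show ?case .
  qed simp
  also have "\<dots> \<le> t\<^sup>2 / 2 * norm z * (1 / 2) ^ n"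
    by (intro mult_left_mono) auto
  finally show ?thesis .
qed

text \<open>The approximants form a Cauchy sequence on the domain of the square; since all of them
  are contractions, the Cauchy property passes to the closure of that domain.\<close>

lemma euler_convergent:
  assumes t: "0 < t" and x: "x \<in> X"
  shows "convergent (\<lambda>n. euler n t x)"
proof (intro Cauchy_convergent CauchyI')
  fix e :: real assume e: "0 < e"
  obtain x' z where z: "(x', z) \<in> A2" "norm (x' - x) < e / 8"
    using A2_approx[OF x, of "e / 8"] e by auto
  have x': "x' \<in> X" using z A_X by (auto simp: A2_def)
  have "(\<lambda>n. t\<^sup>2 / 2 * norm z * (1 / 2) ^ n) \<longlonglongrightarrow> t\<^sup>2 / 2 * norm z * 0"
    by (intro tendsto_mult_left LIMSEQ_power_zero) auto
  then have "eventually (\<lambda>n. t\<^sup>2 / 2 * norm z * (1 / 2) ^ n < e / 8) sequentially"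
    by (rule order_tendstoD(2)) (use e in simp)
  then obtain N where N: "t\<^sup>2 / 2 * norm z * (1 / 2) ^ N < e / 8"
    by (auto simp: eventually_sequentially)
  have near: "norm (euler m t x - euler N t x) < e / 2" if "m \<ge> N" for m
  proof -
    have "norm (euler m t x' - euler N t x') < e / 8"
      using le_less_trans[OF euler_sub[OF t z(1), of N "m - N"] N] that by simp
    moreover have "norm (euler k t x - euler k t x') < e / 8" for k
      using pcontr_dist[OF euler_pcontr[OF t] x x', of k] z(2) by (simp add: norm_minus_commute)
    ultimately have "dist (euler m t x) (euler m t x') < e / 8" "dist (euler m t x') (euler N t x') < e / 8"
        "dist (euler N t x) (euler N t x') < e / 8"
      by (simp_all add: dist_norm)
    then have "dist (euler m t x) (euler N t x) < e / 2"
      using dist_triangle[of "euler m t x" "euler N t x" "euler m t x'"]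
        dist_triangle[of "euler m t x'" "euler N t x" "euler N t x'"] dist_commute[of "euler N t x" "euler N t x'"] e
      by linarith
    then show ?thesis by (simp add: dist_norm)
  qed
  show "\<exists>M. \<forall>m\<ge>M. \<forall>n>m. dist (euler m t x) (euler n t x) < e"
  proof (intro exI[of _ N] allI impI)
    fix m n assume "m \<ge> N" "n > m"
    then show "dist (euler m t x) (euler n t x) < e"
      unfolding dist_norm using norm_triangle_lt[of "euler m t x - euler N t x" "euler N t x - euler n t x" e] near[of m] near[of n]
      by (simp add: norm_minus_commute)
  qed
qed

text \<open>The case t = 0 is set apart because the chosen value of \<open>resolvent 0 f\<close> is
  \<open>f\<close> only when \<open>f\<close> lies in the domain of \<open>A\<close>.\<close>

definition S :: "real \<Rightarrow> 'b \<Rightarrow> 'b" where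
  "S t x = (if t = 0 then x else lim (\<lambda>n. euler n t x))"

lemma euler_tendsto: "0 < t \<Longrightarrow> x \<in> X \<Longrightarrow> (\<lambda>n. euler n t x) \<longlonglongrightarrow> S t x"
  unfolding S_def using euler_convergent[of t x] by (simp add: convergent_LIMSEQ_iff)

section \<open>Semigroup law and generator of the limit\<close>

lemma S_pcontr: assumes "0 \<le> t" shows "pcontr (S t)"
proof (cases "t = 0")
  case True
  then show ?thesis by (simp add: S_def pcontr_def lin_op_def)
next
  case False
  with assms have "0 < t" by simp
  then show ?thesis using pcontr_limit[OF euler_pcontr euler_tendsto] by blast
qed

lemma eq_on_X:
  assumes "pcontr U" "pcontr V" "\<And>x z. (x, z) \<in> A2 \<Longrightarrow> U x = V x" "x \<in> X"
  shows "U x = V x"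
proof (rule ccontr)
  assume ne: "U x \<noteq> V x"
  let ?e = "norm (U x - V x) / 2"
  obtain x' z where z: "(x', z) \<in> A2" "norm (x' - x) < ?e"
    using A2_approx[OF assms(4), of ?e] ne by auto
  have x': "x' \<in> X" using z A_X by (auto simp: A2_def)
  have "norm (U x - U x') < ?e" "norm (V x' - V x) < ?e"
    using pcontr_dist[OF assms(1,4) x'] pcontr_dist[OF assms(2) x' assms(4)] z(2)
    by (auto simp: norm_minus_commute)
  then have "norm ((U x - U x') + (V x' - V x)) < norm (U x - V x)"
    by (intro norm_triangle_lt) simp
  with assms(3)[OF z(1)] show False by simp
qed

text \<open>On the domain of the square, a step of length (s+t)/2^n and the composition of steps
  s/2^n and t/2^n differ by s t / 4^n times \<open>norm z\<close>. Over 2^n steps this still tends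
  to 0, and \<open>eq_on_X\<close> extends the identity to \<open>X\<close>.\<close>

lemma S_add:
  assumes s: "0 \<le> s" and t: "0 \<le> t" and x: "x \<in> X"
  shows "S (s + t) x = S s (S t x)"
proof (cases "s = 0 \<or> t = 0")
  case True
  then show ?thesis by (auto simp: S_def)
next
  case False
  with s t have s: "0 < s" and t: "0 < t" by auto
  note ps = S_pcontr[OF less_imp_le[OF s]] and pt = S_pcontr[OF less_imp_le[OF t]]
  have pst: "pcontr (S (s + t))" using S_pcontr s t by simp
  show ?thesis
  proof (rule eq_on_X[OF pst pcontr_comp[OF ps pt] _ x])
    fix x z assume xz: "(x, z) \<in> A2"
    then obtain y where y: "(x, y) \<in> A" "(y, z) \<in> A" by (auto simp: A2_def)
    have x: "x \<in> X" using A_X y by blast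
    have bound: "norm (euler n (s + t) x - euler n s (euler n t x)) \<le> s * t * norm z * (1 / 2) ^ n" for n
    proof -
      have a: "0 < s / 2 ^ n" "0 < t / 2 ^ n" "0 < (s + t) / 2 ^ n" using s t by auto
      let ?U = "resolvent ((s + t) / 2 ^ n)" and ?V1 = "resolvent (s / 2 ^ n)" and ?V2 = "resolvent (t / 2 ^ n)"
      let ?V = "\<lambda>x. ?V1 (?V2 x)"
      note p1 = resolvent_pcontr[OF a(1)] and p2 = resolvent_pcontr[OF a(2)] and pU = resolvent_pcontr[OF a(3)]
      have pV: "pcontr ?V" using pcontr_comp[OF p1 p2] .
      \<comment> \<open>Commutation regroups the two blocks of steps into one power of a composed
        step, as \<open>funpow_diff_bound\<close> expects.\<close>
      have V: "(?V1 ^^ k) ((?V2 ^^ k) x) = (?V ^^ k) x" for k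
      proof (induction k)
        case (Suc k)
        have "(?V2 ^^ k) x \<in> X" using pcontr_X[OF pcontr_funpow[OF p2] x] .
        then have "(?V1 ^^ k) (?V2 ((?V2 ^^ k) x)) = ?V2 ((?V1 ^^ k) ((?V2 ^^ k) x))"
          using funpow_commute_on[OF p2 p1 resolvent_commute[OF a(2,1)]] by simp
        with Suc show ?case by simp
      qed simp
      have comm: "?U (?V w) = ?V (?U w)" if "w \<in> X" for w
        using resolvent_commute a that pcontr_X[OF p2] by simp
      have "euler n s (euler n t x) = (?V ^^ (2 ^ n)) x" by (simp add: euler_def V)
      then have "norm (euler n (s + t) x - euler n s (euler n t x)) \<le> real (2 ^ n) * norm (?U x - ?V x)"
        using funpow_diff_bound[OF pU pV comm x, of "2 ^ n"] by (simp add: euler_def)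
      also have "norm (?U x - ?V x) \<le> s / 2 ^ n * (t / 2 ^ n) * norm z"
        using resolvent_add_bound[OF a(1,2) y] by (simp add: add_divide_distrib)
      also have "real (2 ^ n) * (s / 2 ^ n * (t / 2 ^ n) * norm z) = s * t * norm z * (1 / 2) ^ n"
        by (simp add: field_simps)
      finally show ?thesis by simp
    qed
    have "(\<lambda>n. s * t * norm z * (1 / 2) ^ n) \<longlonglongrightarrow> s * t * norm z * 0"
      by (intro tendsto_mult_left LIMSEQ_power_zero) auto
    then have "(\<lambda>n. euler n (s + t) x - euler n s (euler n t x)) \<longlonglongrightarrow> 0"
      by (intro Lim_null_comparison[OF always_eventually[OF allI[OF bound]]]) simp
    then have 1: "(\<lambda>n. euler n s (euler n t x)) \<longlonglongrightarrow> S (s + t) x"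
      using tendsto_diff[OF euler_tendsto[OF _ x, of "s + t"]] s t by fastforce
    \<comment> \<open>The argument of the outer approximant still depends on n. Contractivity of
      \<open>euler n s\<close>, uniform in n, allows it to be replaced by its limit.\<close>
    have "(\<lambda>n. euler n s (euler n t x) - euler n s (S t x)) \<longlonglongrightarrow> 0"
    proof (rule Lim_null_comparison)
      show "(\<lambda>n. norm (euler n t x - S t x)) \<longlonglongrightarrow> 0"
        using euler_tendsto[OF t x] by (simp add: LIM_zero tendsto_norm_zero)
      show "\<forall>\<^sub>F n in sequentially. norm (euler n s (euler n t x) - euler n s (S t x)) \<le> norm (euler n t x - S t x)"
        using pcontr_dist[OF euler_pcontr[OF s] pcontr_X[OF euler_pcontr[OF t] x] pcontr_X[OF pt x]] by simp
    qed
    then have "(\<lambda>n. euler n s (euler n t x)) \<longlonglongrightarrow> S s (S t x)"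
      using tendsto_add[OF _ euler_tendsto[OF s pcontr_X[OF pt x]]] by fastforce
    with 1 show "S (s + t) x = S s (S t x)" by (rule LIMSEQ_unique)
  qed
qed

text \<open>The identity is also a contraction commuting with the resolvents, so comparing 2^n
  resolvent steps with 2^n identity steps costs 2^n times (t/2^n) \<open>norm y\<close>.\<close>

lemma S_bound:
  assumes t: "0 < t" and xy: "(x, y) \<in> A"
  shows "norm (S t x - x) \<le> t * norm y"
proof -
  have x: "x \<in> X" using A_X xy by blast
  have "norm (euler n t x - x) \<le> t * norm y" for n
  proof -
    have h: "0 < t / 2 ^ n" using t by simp
    have "norm ((resolvent (t / 2 ^ n) ^^ (2 ^ n)) x - (id ^^ (2 ^ n)) x) \<le>
        real (2 ^ n) * norm (resolvent (t / 2 ^ n) x - id x)"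
      by (rule funpow_diff_bound[OF resolvent_pcontr[OF h] _ _ x]) (auto simp: pcontr_def lin_op_def)
    also have "\<dots> \<le> real (2 ^ n) * (t / 2 ^ n * norm y)"
      using resolvent_bound[OF h xy] by (intro mult_left_mono) auto
    finally show ?thesis by (simp add: euler_def)
  qed
  then show ?thesis
    by (intro tendsto_upperbound[OF tendsto_norm[OF tendsto_diff[OF euler_tendsto[OF t x] tendsto_const]]]) auto
qed

text \<open>\<open>euler 0 t\<close> is a single resolvent step, so \<open>euler_sub\<close> with n
  = 0 bounds its distance to the limit. The error is of second order in t and disappears in the
  derivative at 0.\<close>

lemma S_resolvent_bound:
  assumes t: "0 < t" and xz: "(x, z) \<in> A2"
  shows "norm (S t x - resolvent t x) \<le> t\<^sup>2 / 2 * norm z"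
proof -
  have x: "x \<in> X" using A_X xz by (auto simp: A2_def)
  have "norm (euler n t x - resolvent t x) \<le> t\<^sup>2 / 2 * norm z" for n
    using euler_sub[OF t xz, of 0 n] by (simp add: euler_def)
  then show ?thesis
    by (intro tendsto_upperbound[OF tendsto_norm[OF tendsto_diff[OF euler_tendsto[OF t x] tendsto_const]]]) auto
qed

lemma S_semigroup: "pc_semigroup S"
  unfolding pc_semigroup_def
proof (intro conjI allI ballI impI)
  fix x assume x: "x \<in> X"
  show "((\<lambda>t. S t x) \<longlongrightarrow> x) (at_right 0)"
  proof (rule tendstoI)
    fix e :: real assume e: "0 < e"
    obtain x' z where z: "(x', z) \<in> A2" "norm (x' - x) < e / 3"
      using A2_approx[OF x, of "e / 3"] e by auto
    then obtain y where y: "(x', y) \<in> A" by (auto simp: A2_def)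
    have e3: "0 < e / 3" using e by simp
  have "eventually (\<lambda>h. h * norm y < e / 3) (at_right 0)"
      by (rule order_tendstoD(2)[OF tendsto_mult_left_zero[OF tendsto_ident_at] e3])
    then have "eventually (\<lambda>h. 0 < h \<and> h * norm y < e / 3) (at_right 0)"
      using eventually_at_right_less by (rule eventually_conj[rotated])
    then show "eventually (\<lambda>t. dist (S t x) x < e) (at_right 0)"
    proof eventually_elim
      fix t assume t: "0 < t \<and> t * norm y < e / 3"
      then have "dist (S t x) (S t x') \<le> dist x x'"
        using pcontr_dist[OF S_pcontr x] A_X[OF y] by (simp add: dist_norm)
      moreover have "dist (S t x') x' < e / 3"
        using S_bound[OF _ y, of t] t by (simp add: dist_norm)
      moreover have "dist x x' < e / 3" using z(2) by (simp add: dist_norm norm_minus_commute)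
      ultimately show "dist (S t x) x < e"
        using dist_triangle[of "S t x" x "S t x'"] dist_triangle[of "S t x'" x x'] dist_commute[of x x']
        by linarith
    qed
  qed
qed (auto simp: S_pcontr S_add, simp add: S_def)

text \<open>\<open>S_resolvent_bound\<close> needs two applications of \<open>A\<close>, while
  \<open>x\<close> admits one. Hence \<open>x\<close> and \<open>y\<close> are first replaced by
  their images under a fixed \<open>resolvent a\<close>, close enough to \<open>y\<close>; only
  afterwards h tends to 0. The price for the replacement is \<open>norm (y - y')\<close>,
  independent of h, by \<open>S_bound\<close>.\<close>

lemma A_le_gen: "A \<subseteq> gen S"
proof (rule subrelI)
  fix x y assume xy: "(x, y) \<in> A"
  note Xxy = A_X[OF xy]
  have "((\<lambda>h. (S h x - x) /\<^sub>R h) \<longlongrightarrow> y) (at_right 0)"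
  proof (rule tendstoI)
    fix e :: real assume e: "0 < e"
    have lim: "(\<lambda>n. resolvent (1 / real (Suc n)) y) \<longlonglongrightarrow> y"
      using filterlim_at_right_real[OF resolvent_tendsto, of y "\<lambda>n. 1 / real (Suc n)"]
        LIMSEQ_inverse_real_of_nat Xxy by (simp add: inverse_eq_divide)
    obtain n where n: "norm (resolvent (1 / real (Suc n)) y - y) < e / 4"
      using LIMSEQ_D[OF lim, of "e / 4"] e by auto
    define a where "a = 1 / real (Suc n)"
    have a: "0 < a" by (simp add: a_def)
    define x' y' where "x' = resolvent a x" "y' = resolvent a y"
    have x'y': "(x', y') \<in> A" using resolvent_of_A(3)[OF a xy] by (simp add: x'_y'_def)
    obtain z where z: "(y', z) \<in> A" using resolvent_props[OF a] Xxy by (auto simp: x'_y'_def)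
    have A2: "(x', z) \<in> A2" using x'y' z by (auto simp: A2_def)
    note X' = A_X[OF x'y']
    have dy: "norm (y' - y) < e / 4" using n by (simp add: x'_y'_def a_def)
    have l1: "((\<lambda>h. h / 2 * norm z) \<longlongrightarrow> 0 / 2 * norm z) (at_right 0)"
      by (auto intro!: tendsto_eq_intros)
    have ev1: "eventually (\<lambda>h. h / 2 * norm z < e / 4) (at_right 0)"
      by (rule order_tendstoD(2)[OF l1]) (use e in simp)
    have ev2: "eventually (\<lambda>h. dist (resolvent h y') y' < e / 4) (at_right 0)"
      by (rule tendstoD[OF resolvent_tendsto[OF conjunct2[OF X']]]) (use e in simp)
    from ev1 ev2 eventually_at_right_less
    show "eventually (\<lambda>h. dist ((S h x - x) /\<^sub>R h) y < e) (at_right 0)"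
    proof eventually_elim
      fix h :: real assume h1: "h / 2 * norm z < e / 4" and h2: "dist (resolvent h y') y' < e / 4" and h: "0 < h"
      have Sh: "pcontr (S h)" using S_pcontr h by simp
      \<comment> \<open>Four errors, each below e/4: the replacement of x by x', the distance from S
        h to one resolvent step at x', the convergence of the resolvents at y', and the distance of
        y' from y.\<close>
      have "(S h x - x) /\<^sub>R h - y =
          ((S h (x - x') - (x - x')) /\<^sub>R h) + ((S h x' - resolvent h x') /\<^sub>R h) + ((resolvent h x' - x') /\<^sub>R h - y') + (y' - y)"
      proof -
        have "S h (x - x') = S h x - S h x'" using pcontr_diff[OF Sh] Xxy X' by blast
        then show ?thesis by (simp only:) (simp add: algebra_simps)
      qed
      also have "(resolvent h x' - x') /\<^sub>R h = resolvent h y'" using resolvent_of_A(2)[OF h x'y'] h by simp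
      finally have eq: "(S h x - x) /\<^sub>R h - y = ((S h (x - x') - (x - x')) /\<^sub>R h) +
          ((S h x' - resolvent h x') /\<^sub>R h) + (resolvent h y' - y') + (y' - y)" .
      have "norm (S h (x - x') - (x - x')) \<le> h * norm (y - y')"
        by (rule S_bound[OF h A_diff[OF xy x'y']])
      then have 1: "norm ((S h (x - x') - (x - x')) /\<^sub>R h) < e / 4"
      proof -
        have "norm (S h (x - x') - (x - x')) < h * (e / 4)"
          by (rule le_less_trans[OF \<open>_ \<le> h * norm (y - y')\<close>])
            (use dy h in \<open>simp add: norm_minus_commute\<close>)
        then have "norm (S h (x - x') - (x - x')) / h < e / 4" using h by (simp add: pos_divide_less_eq mult.commute)
        then show ?thesis by (simp only: norm_scaleR_inverse[OF h])
      qed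
      have "norm (S h x' - resolvent h x') \<le> h\<^sup>2 / 2 * norm z" by (rule S_resolvent_bound[OF h A2])
      then have "norm ((S h x' - resolvent h x') /\<^sub>R h) \<le> h / 2 * norm z"
        using h by (simp only: norm_scaleR_inverse[OF h]) (simp add: field_simps power2_eq_square)
      then have 2: "norm ((S h x' - resolvent h x') /\<^sub>R h) < e / 4" using h1 by simp
      have 3: "norm (resolvent h y' - y') < e / 4" using h2 by (simp add: dist_norm)
      have "norm ((S h x - x) /\<^sub>R h - y) < e / 4 + e / 4 + e / 4 + e / 4"
        unfolding eq by (intro norm_triangle_lt[OF add_strict_mono] 1 2 3 dy)
      then show "dist ((S h x - x) /\<^sub>R h) y < e" by (simp add: dist_norm)
    qed
  qed
  with Xxy show "(x, y) \<in> gen S" by (simp add: gen_def)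
qed

text \<open>A surjective restriction of an injective map is the whole map: 1 - A is onto
  \<open>X\<close>, while 1 minus the generator is injective by dissipativity, so the generator
  cannot properly extend \<open>A\<close>.\<close>

theorem generation: "pc_semigroup S" "gen S = A"
proof -
  show "pc_semigroup S" by (rule S_semigroup)
  have "(x, y) \<in> A" if xy: "(x, y) \<in> gen S" for x y
  proof -
    note Xxy = genD(1,2)[OF xy]
    obtain v where v: "(resolvent 1 (x - y), v) \<in> A" "resolvent 1 (x - y) - 1 *\<^sub>R v = x - y"
      using resolvent_props[of 1 "x - y"] X_diff Xxy by auto
    let ?u = "resolvent 1 (x - y)"
    have "(x - ?u, y - v) \<in> gen S"
      using subspace_diff[OF gen_subspace[OF S_semigroup] xy] A_le_gen v(1) by fastforce
    moreover have "y - v = x - ?u" using v(2) by (simp add: algebra_simps)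
    ultimately have "x = ?u" using gen_dissipative[OF S_semigroup, of "x - ?u" "y - v" 1] by simp
    with v show ?thesis by (simp add: algebra_simps)
  qed
  with A_le_gen show "gen S = A" by auto
qed

end

section \<open>The resolvent of a semigroup of positive contractions\<close>

text \<open>Riemann sums have nonnegative weights and therefore lie in the cone; the integral is
  approximated by them and the cone is closed.\<close>

lemma integral_in_closed_cone:
  fixes f :: "real \<Rightarrow> 'b::banach"
  assumes C: "closed C" "0 \<in> C" "\<And>x y. x \<in> C \<Longrightarrow> y \<in> C \<Longrightarrow> x + y \<in> C"
      "\<And>c x. 0 \<le> c \<Longrightarrow> x \<in> C \<Longrightarrow> c *\<^sub>R x \<in> C"
    and f: "f integrable_on {a..b}" "\<And>t. t \<in> {a..b} \<Longrightarrow> f t \<in> C"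
  shows "integral {a..b} f \<in> C"
proof -
  have "\<exists>y\<in>C. dist y (integral {a..b} f) < e" if e: "0 < e" for e :: real
  proof -
    have fI: "(f has_integral integral {a..b} f) (cbox a b)"
      using f(1) by (simp add: integrable_integral)
    then obtain \<gamma> where \<gamma>: "gauge \<gamma>" "\<And>D. D tagged_division_of cbox a b \<Longrightarrow> \<gamma> fine D \<Longrightarrow>
        norm ((\<Sum>(x, k)\<in>D. measure lborel k *\<^sub>R f x) - integral {a..b} f) < e"
      using has_integral[THEN iffD1, OF fI, rule_format, OF e] by metis
    obtain D where D: "D tagged_division_of cbox a b" "\<gamma> fine D"
      using fine_division_exists[OF \<gamma>(1)] by blast
    have "finite D" using D(1) by blast
    have sum_in: "(\<And>d. d \<in> F \<Longrightarrow> g d \<in> C) \<Longrightarrow> sum g F \<in> C" if "finite F" for F and g :: "real \<times> real set \<Rightarrow> 'b"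
      using that by (induction F rule: finite_induct) (auto intro: C)
    have "(\<Sum>(x, k)\<in>D. measure lborel k *\<^sub>R f x) \<in> C"
    proof (rule sum_in[OF \<open>finite D\<close>])
      fix d assume d: "d \<in> D"
      obtain x k where xk: "d = (x, k)" by fastforce
      then have "x \<in> {a..b}" using tag_in_interval[OF D(1)] d by auto
      then show "(case d of (x, k) \<Rightarrow> measure lborel k *\<^sub>R f x) \<in> C"
        using C(4)[OF _ f(2)] xk by simp
    qed
    then show ?thesis using \<gamma>(2)[OF D] by (auto simp: dist_norm)
  qed
  then have "integral {a..b} f \<in> closure C" by (simp add: closure_approachable)
  with C(1) show ?thesis by simp
qed

context al_cone
begin

text \<open>The iteration runs inside \<open>P\<close>, so that positivity of a solution is obtained
  together with its existence.\<close>

lemma fixpoint: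
  assumes "0 \<le> c" "c < 1" "\<And>x. x \<in> P \<Longrightarrow> F x \<in> P"
    "\<And>x y. x \<in> P \<Longrightarrow> y \<in> P \<Longrightarrow> norm (F x - F y) \<le> c * norm (x - y)"
  shows "\<exists>x\<in>P. F x = x"
  using Banach_fix[of P c F] assms P_0 P_closed by (auto simp: dist_norm complete_eq_closed)

lemma integral_X:
  fixes f :: "real \<Rightarrow> 'b"
  assumes "f integrable_on {a..b}" "\<And>t. t \<in> {a..b} \<Longrightarrow> f t \<in> X"
  shows "integral {a..b} f \<in> X"
  using assms by (intro integral_in_closed_cone) (auto simp: X_closed X_0 X_add X_scale)

lemma integral_P:
  fixes f :: "real \<Rightarrow> 'b"
  assumes "f integrable_on {a..b}" "\<And>t. t \<in> {a..b} \<Longrightarrow> f t \<in> P"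
  shows "integral {a..b} f \<in> P"
  using assms by (intro integral_in_closed_cone) (auto simp: P_closed P_0 P_add P_scale)

text \<open>\<open>L\<close> is linear on \<open>X\<close> only, so the exchange with the integral
  is made on Riemann sums, all of whose terms lie in \<open>X\<close>; contractivity keeps the same
  gauge valid.\<close>

lemma has_integral_pcontr:
  fixes f :: "real \<Rightarrow> 'b"
  assumes L: "pcontr L" and f: "f integrable_on {a..b}" "\<And>t. t \<in> {a..b} \<Longrightarrow> f t \<in> X"
  shows "((\<lambda>t. L (f t)) has_integral L (integral {a..b} f)) {a..b}"
proof -
  let ?I = "integral {a..b} f"
  have I: "?I \<in> X" using integral_X f by blast
  have fI: "(f has_integral ?I) (cbox a b)"
    using f(1) by (simp add: integrable_integral)
  have *: "\<exists>\<gamma>. gauge \<gamma> \<and> (\<forall>D. D tagged_division_of cbox a b \<and> \<gamma> fine D \<longrightarrow>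
      norm ((\<Sum>(x, k)\<in>D. measure lborel k *\<^sub>R L (f x)) - L ?I) < e)" if e: "0 < e" for e :: real
  proof -
    obtain \<gamma> where \<gamma>: "gauge \<gamma>" "\<And>D. D tagged_division_of cbox a b \<Longrightarrow> \<gamma> fine D \<Longrightarrow>
        norm ((\<Sum>(x, k)\<in>D. measure lborel k *\<^sub>R f x) - ?I) < e"
      using has_integral[THEN iffD1, OF fI, rule_format, OF e] by metis
    have "norm ((\<Sum>(x, k)\<in>D. measure lborel k *\<^sub>R L (f x)) - L ?I) < e"
      if D: "D tagged_division_of cbox a b" "\<gamma> fine D" for D
    proof -
      have fin: "finite D" using D(1) by blast
      have fX: "f (fst d) \<in> X" if "d \<in> D" for d
        using tag_in_interval[OF D(1), of "fst d" "snd d"] f(2) that by auto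
      then have tX: "(case d of (x, k) \<Rightarrow> measure lborel k *\<^sub>R f x) \<in> X" if "d \<in> D" for d
        using that X_scale by (auto simp: split_beta)
      have "(\<Sum>(x, k)\<in>D. measure lborel k *\<^sub>R L (f x)) = (\<Sum>d\<in>D. L (case d of (x, k) \<Rightarrow> measure lborel k *\<^sub>R f x))"
        using lin_opD(3)[OF pcontrD(1)[OF L] fX] by (intro sum.cong) (auto simp: split_beta)
      also have "\<dots> = L (\<Sum>(x, k)\<in>D. measure lborel k *\<^sub>R f x)"
        using lin_op_sum[OF pcontrD(1)[OF L] fin tX] by simp
      finally have "(\<Sum>(x, k)\<in>D. measure lborel k *\<^sub>R L (f x)) - L ?I =
          L (\<Sum>(x, k)\<in>D. measure lborel k *\<^sub>R f x) - L ?I" by simp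
      moreover have "norm (L (\<Sum>(x, k)\<in>D. measure lborel k *\<^sub>R f x) - L ?I) \<le>
          norm ((\<Sum>(x, k)\<in>D. measure lborel k *\<^sub>R f x) - ?I)"
        using tX by (intro pcontr_dist[OF L _ I] subspace_sum[OF X_subspace]) auto
      ultimately show ?thesis using \<gamma>(2)[OF D] by simp
    qed
    with \<gamma>(1) show ?thesis by (intro exI[of _ \<gamma>]) simp
  qed
  have "((\<lambda>t. L (f t)) has_integral L ?I) (cbox a b)"
    by (rule has_integral[THEN iffD2], intro allI impI, rule *)
  then show ?thesis by simp
qed

text \<open>For a \<le> b the difference of the values at b and a is \<open>S a\<close> applied to
  \<open>S (b - a) x - x\<close>. Continuity at 0 thus gives a modulus that is uniform in time and
  serves both sides.\<close>

lemma semigroup_continuous: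
  assumes S: "pc_semigroup S" and x: "x \<in> X"
  shows "continuous_on {0..} (\<lambda>t. S t x)"
  unfolding continuous_on_iff
proof (intro ballI allI impI)
  fix t e :: real assume t: "t \<in> {0..}" and e: "0 < e"
  obtain d where d: "0 < d" "\<And>h. 0 < h \<Longrightarrow> h < d \<Longrightarrow> dist (S h x) x < e"
    using tendstoD[OF pc_semigroupD(4)[OF S x] e] unfolding eventually_at_right_field by blast
  have near: "dist (S b x) (S a x) < e" if "0 \<le> a" "a \<le> b" "b - a < d" for a b
  proof -
    have "S b x = S a (S (b - a) x)" using pc_semigroupD(3)[OF S _ _ x, of a "b - a"] that by simp
    moreover have "pcontr (S a)" "pcontr (S (b - a))" using pc_semigroupD(1)[OF S] that by auto
    ultimately have "dist (S b x) (S a x) \<le> dist (S (b - a) x) x"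
      using pcontr_dist[of "S a" "S (b - a) x" x] pcontr_X x by (simp add: dist_norm)
    also have "\<dots> < e"
      using d that e pc_semigroupD(2)[OF S x] by (cases "a = b") auto
    finally show ?thesis .
  qed
  show "\<exists>d>0. \<forall>t'\<in>{0..}. dist t' t < d \<longrightarrow> dist (S t' x) (S t x) < e"
  proof (intro exI[of _ d] conjI d ballI impI)
    fix t' assume t': "t' \<in> {0..}" "dist t' t < d"
    show "dist (S t' x) (S t x) < e"
    proof (cases "t \<le> t'")
      case True
      then show ?thesis using near[of t t'] t t' by (auto simp: dist_real_def)
    next
      case False
      then show ?thesis using near[of t' t] t t' by (auto simp: dist_real_def dist_commute)
    qed
  qed
qed

lemma semigroup_integrable:
  assumes "pc_semigroup S" "x \<in> X" "0 \<le> a"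
  shows "(\<lambda>t. S t x) integrable_on {a..b}"
  using assms by (intro integrable_continuous_real continuous_on_subset[OF semigroup_continuous]) auto

lemma semigroup_mean_tendsto:
  assumes S: "pc_semigroup S" and x: "x \<in> X"
  shows "((\<lambda>h. integral {0..h} (\<lambda>t. S t x) /\<^sub>R h) \<longlongrightarrow> x) (at_right 0)"
proof (rule tendstoI)
  fix e :: real assume e: "0 < e"
  have "eventually (\<lambda>h. dist (S h x) x < e / 2) (at_right 0)"
    using tendstoD[OF pc_semigroupD(4)[OF S x]] e half_gt_zero by blast
  then obtain d where d: "0 < d" "\<And>h. 0 < h \<Longrightarrow> h < d \<Longrightarrow> dist (S h x) x < e / 2"
    unfolding eventually_at_right_field by blast
  have "eventually (\<lambda>h. 0 < h \<and> h < d) (at_right 0)"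
    unfolding eventually_at_right_field using d(1) by blast
  then show "eventually (\<lambda>h. dist (integral {0..h} (\<lambda>t. S t x) /\<^sub>R h) x < e) (at_right 0)"
  proof eventually_elim
    fix h :: real assume h: "0 < h \<and> h < d"
    have "norm (integral {0..h} (\<lambda>t. S t x - x)) \<le> e / 2 * (h - 0)"
    proof (rule integral_bound)
      show "continuous_on {0..h} (\<lambda>t. S t x - x)"
        by (intro continuous_intros continuous_on_subset[OF semigroup_continuous[OF S x]]) auto
      fix t assume t: "t \<in> {0..h}"
      show "norm (S t x - x) \<le> e / 2"
        using d(2)[of t] t h e pc_semigroupD(2)[OF S x] by (cases "t = 0") (auto simp: dist_norm)
    qed (use h in auto)
    also have "integral {0..h} (\<lambda>t. S t x - x) = integral {0..h} (\<lambda>t. S t x) - h *\<^sub>R x"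
      using h by (subst integral_diff[OF semigroup_integrable[OF S x]]) auto
    also have "\<dots> = h *\<^sub>R (integral {0..h} (\<lambda>t. S t x) /\<^sub>R h - x)"
      using h by (simp add: scaleR_diff_right)
    finally have "h * dist (integral {0..h} (\<lambda>t. S t x) /\<^sub>R h) x \<le> h * (e / 2)"
      using h by (simp add: dist_norm mult.commute)
    then have "dist (integral {0..h} (\<lambda>t. S t x) /\<^sub>R h) x \<le> e / 2"
      using h by simp
    then show "dist (integral {0..h} (\<lambda>t. S t x) /\<^sub>R h) x < e" using e by simp
  qed
qed

text \<open>With I_t the integral of the orbit over [0,t], both S_h I_t - I_t and S_t I_h - I_h
  equal the integral over [0,t+h] minus those over [0,t] and [0,h]. Divided by h, the second form
  converges, because I_h / h is a mean tending to \<open>x\<close>.\<close>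

lemma integral_gen:
  assumes S: "pc_semigroup S" and x: "x \<in> X" and t: "0 \<le> t"
  shows "(integral {0..t} (\<lambda>s. S s x), S t x - x) \<in> gen S"
proof -
  let ?f = "\<lambda>s. S s x" and ?m = "\<lambda>h. integral {0..h} (\<lambda>s. S s x) /\<^sub>R h"
  note int = semigroup_integrable[OF S x]
  have fX: "?f s \<in> X" if "0 \<le> s" for s
    using pcontr_X[OF pc_semigroupD(1)[OF S that] x] .
  have IX: "integral {0..s} ?f \<in> X" for s
    using integral_X[OF int] fX by auto
  \<comment> \<open>Applying \<open>S h\<close> to the integral translates the interval of
    integration by h; it is used with the roles of h and t exchanged as well.\<close>
  have shift: "S h (integral {0..s} ?f) = integral {h..s + h} ?f" if h: "0 \<le> h" "0 \<le> s" for h s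
  proof -
    have "((\<lambda>r. S h (S r x)) has_integral S h (integral {0..s} ?f)) {0..s}"
      using fX h by (intro has_integral_pcontr pc_semigroupD(1)[OF S] int) auto
    moreover have "S h (S r x) = S (r + h) x" if "r \<in> {0..s}" for r
      using pc_semigroupD(3)[OF S h(1) _ x, of r] that by (simp add: add.commute)
    ultimately have "((\<lambda>r. S (r + h) x) has_integral S h (integral {0..s} ?f)) {0..s}"
      using has_integral_cong[of "{0..s}" "\<lambda>r. S h (S r x)" "\<lambda>r. S (r + h) x"] by blast
    then have "S h (integral {0..s} ?f) = integral {0..s} (\<lambda>r. S (r + h) x)"
      by (simp add: integral_unique)
    also have "\<dots> = integral {h..s + h} ?f"
      using integral_shift_Icc_real[of 0 s ?f h] by (simp add: comp_def add.commute)
    finally show ?thesis .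
  qed
  have "((\<lambda>h. S t (?m h) - ?m h) \<longlongrightarrow> S t x - x) (at_right 0)"
  proof (rule tendsto_diff)
    show lim: "(?m \<longlongrightarrow> x) (at_right 0)" by (rule semigroup_mean_tendsto[OF S x])
    have mX: "?m h \<in> X" for h using IX X_scale by blast
    show "((\<lambda>h. S t (?m h)) \<longlongrightarrow> S t x) (at_right 0)"
    proof (rule LIM_zero_cancel, rule Lim_null_comparison)
      show "\<forall>\<^sub>F h in at_right 0. norm (S t (?m h) - S t x) \<le> norm (?m h - x)"
        using pcontr_dist[OF pc_semigroupD(1)[OF S t] mX x] by simp
      show "((\<lambda>h. norm (?m h - x)) \<longlongrightarrow> 0) (at_right 0)"
        using lim by (simp add: LIM_zero tendsto_norm_zero)
    qed
  qed
  then have "((\<lambda>h. (S h (integral {0..t} ?f) - integral {0..t} ?f) /\<^sub>R h) \<longlongrightarrow> S t x - x) (at_right 0)"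
  proof (rule Lim_transform_eventually, intro eventually_mono[OF eventually_at_right_less])
    fix h :: real assume h: "0 < h"
    have "integral {0..h} ?f + integral {h..t + h} ?f = integral {0..t + h} ?f"
      using h t by (intro Henstock_Kurzweil_Integration.integral_combine int) auto
    moreover have "integral {0..t} ?f + integral {t..t + h} ?f = integral {0..t + h} ?f"
      using h t by (intro Henstock_Kurzweil_Integration.integral_combine int) auto
    ultimately have "S h (integral {0..t} ?f) - integral {0..t} ?f = S t (integral {0..h} ?f) - integral {0..h} ?f"
      using shift[of h t] shift[of t h] h t by (simp add: algebra_simps)
    then show "S t (?m h) - ?m h = (S h (integral {0..t} ?f) - integral {0..t} ?f) /\<^sub>R h"
      using lin_opD(3)[OF pcontrD(1)[OF pc_semigroupD(1)[OF S t]] IX] by (simp add: scaleR_diff_right)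
  qed
  then show ?thesis using IX fX[OF t] x X_diff by (simp add: gen_def)
qed

lemma gen_dense:
  assumes S: "pc_semigroup S"
  shows "X \<subseteq> closure (fst ` gen S)"
proof
  fix x assume x: "x \<in> X"
  let ?u = "\<lambda>n. integral {0..1 / real (Suc n)} (\<lambda>t. S t x) /\<^sub>R (1 / real (Suc n))"
  have "?u \<longlonglongrightarrow> x"
    using filterlim_at_right_real[OF semigroup_mean_tendsto[OF S x], of "\<lambda>n. 1 / real (Suc n)"]
      LIMSEQ_inverse_real_of_nat by (simp add: inverse_eq_divide)
  moreover have "?u n \<in> fst ` gen S" for n
    using subspace_scale[OF gen_subspace[OF S] integral_gen[OF S x, of "1 / real (Suc n)"],
        of "inverse (1 / real (Suc n))"] by force
  ultimately show "x \<in> closure (fst ` gen S)"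
    unfolding closure_sequential by (intro exI[of _ ?u]) simp
qed

section \<open>Exponential rescaling, and the resolvent as an orbit integral\<close>

definition rescale :: "real \<Rightarrow> (real \<Rightarrow> 'b \<Rightarrow> 'b) \<Rightarrow> real \<Rightarrow> 'b \<Rightarrow> 'b" where
  "rescale c S t x = exp (c * t) *\<^sub>R S t x"

lemma gen_rescale_imp:
  assumes lim: "((\<lambda>t. S t x) \<longlongrightarrow> x) (at_right 0)" and xy: "(x, y) \<in> gen S"
  shows "(x, y + c *\<^sub>R x) \<in> gen (rescale c S)"
proof -
  note A = genD[OF xy]
  have "((\<lambda>h. exp (c * h)) has_real_derivative c) (at 0)"
    by (auto intro!: derivative_eq_intros)
  then have d: "((\<lambda>h. (exp (c * h) - 1) / h) \<longlongrightarrow> c) (at_right 0)"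
    by (intro filterlim_at_split[THEN iffD1, THEN conjunct2]) (simp add: DERIV_def)
  have e: "((\<lambda>h. exp (c * h)) \<longlongrightarrow> exp (c * 0)) (at_right 0)" by (intro tendsto_intros)
  have "((\<lambda>h. exp (c * h) *\<^sub>R ((S h x - x) /\<^sub>R h) + ((exp (c * h) - 1) / h) *\<^sub>R x) \<longlongrightarrow>
      exp (c * 0) *\<^sub>R y + c *\<^sub>R x) (at_right 0)"
    by (intro tendsto_intros d e A(3))
  then have "((\<lambda>h. (rescale c S h x - x) /\<^sub>R h) \<longlongrightarrow> y + c *\<^sub>R x) (at_right 0)"
    by (rule Lim_transform_eventually[OF _ always_eventually, THEN tendsto_eq_rhs])
      (auto simp: rescale_def algebra_simps divide_inverse)
  with A show ?thesis by (simp add: gen_def X_add X_scale)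
qed

lemma rescale_rescale: "rescale (- c) (rescale c S) = S"
  by (simp add: fun_eq_iff rescale_def exp_minus)

lemma rescale_tendsto:
  assumes "((\<lambda>t. S t x) \<longlongrightarrow> x) (at_right 0)"
  shows "((\<lambda>t. rescale c S t x) \<longlongrightarrow> x) (at_right 0)"
proof -
  have "((\<lambda>t. exp (c * t) *\<^sub>R S t x) \<longlongrightarrow> exp (c * 0) *\<^sub>R x) (at_right 0)"
    by (intro tendsto_intros assms)
  then show ?thesis by (simp add: rescale_def)
qed

lemma gen_rescale:
  assumes "\<And>x. x \<in> X \<Longrightarrow> ((\<lambda>t. S t x) \<longlongrightarrow> x) (at_right 0)"
  shows "(x, y) \<in> gen (rescale c S) \<longleftrightarrow> (x, y - c *\<^sub>R x) \<in> gen S"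
proof
  assume *: "(x, y) \<in> gen (rescale c S)"
  show "(x, y - c *\<^sub>R x) \<in> gen S"
    using gen_rescale_imp[OF rescale_tendsto[OF assms] *, of "- c"] genD(1)[OF *]
    by (simp add: rescale_rescale)
next
  assume *: "(x, y - c *\<^sub>R x) \<in> gen S"
  show "(x, y) \<in> gen (rescale c S)"
    using gen_rescale_imp[OF assms *, of c] genD(1)[OF *] by simp
qed

lemma pc_semigroup_rescale:
  assumes S: "pc_semigroup S" and c: "c \<le> 0"
  shows "pc_semigroup (rescale c S)"
  unfolding pc_semigroup_def
proof (intro conjI allI ballI impI)
  fix t :: real assume t: "0 \<le> t"
  note p = pc_semigroupD(1)[OF S t]
  have e: "exp (c * t) \<le> 1" using c t by (simp add: mult_nonpos_nonneg)
  show "pcontr (rescale c S t)"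
    unfolding pcontr_def lin_op_def rescale_def
  proof (intro conjI ballI allI)
    fix x assume x: "x \<in> X"
    show "norm (exp (c * t) *\<^sub>R S t x) \<le> norm x"
      using mult_mono[OF e pcontrD(3)[OF p x]] by simp
    show "exp (c * t) *\<^sub>R S t x \<in> X" using pcontr_X[OF p x] X_scale by blast
    show "exp (c * t) *\<^sub>R S t (a *\<^sub>R x) = a *\<^sub>R exp (c * t) *\<^sub>R S t x" for a
      using lin_opD(3)[OF pcontrD(1)[OF p] x] by simp
    fix y assume y: "y \<in> X"
    show "exp (c * t) *\<^sub>R S t (x + y) = exp (c * t) *\<^sub>R S t x + exp (c * t) *\<^sub>R S t y"
      using lin_opD(2)[OF pcontrD(1)[OF p] x y] by (simp add: scaleR_add_right)
  next
    fix x assume "x \<in> P"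
    then show "exp (c * t) *\<^sub>R S t x \<in> P" using pcontrD(2)[OF p] P_scale by simp
  qed
  fix s :: real and x assume s: "0 \<le> s" and x: "x \<in> X"
  have "S s (exp (c * t) *\<^sub>R S t x) = exp (c * t) *\<^sub>R S s (S t x)"
    using lin_opD(3)[OF pcontrD(1)[OF pc_semigroupD(1)[OF S s]]] pcontr_X[OF p x] by blast
  then show "rescale c S (s + t) x = rescale c S s (rescale c S t x)"
    using pc_semigroupD(3)[OF S s t x] by (simp add: rescale_def distrib_left exp_add)
next
  fix x assume "x \<in> X"
  then show "((\<lambda>t. rescale c S t x) \<longlongrightarrow> x) (at_right 0)"
    using rescale_tendsto pc_semigroupD(4)[OF S] by blast
qed (simp add: rescale_def pc_semigroupD(2)[OF S])

text \<open>The Laplace transform of the orbit of \<open>f\<close>, with the integral over the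
  half-line folded into [0,1]. For Q_t = exp(-l t) S_t the fixed point g = f + Q_1 g collects the
  orbit at integer times, and integrating Q_t g over [0,1] produces an element that the generator of
  Q sends to Q_1 g - g = -f. The contraction constant is exp(-l).\<close>

lemma semigroup_resolvent:
  assumes S: "pc_semigroup S" and l: "0 < l" and f: "f \<in> P"
  shows "\<exists>u v. (u, v) \<in> gen S \<and> u \<in> P \<and> l *\<^sub>R u - v = f"
proof -
  let ?Q = "rescale (- l) S"
  have Q: "pc_semigroup ?Q" using pc_semigroup_rescale[OF S] l by simp
  note p = pc_semigroupD(1)[OF S zero_le_one]
  have "\<exists>g\<in>P. f + ?Q 1 g = g"
  proof (rule fixpoint[of "exp (- l)"])
    fix x y assume xy: "x \<in> P" "y \<in> P"
    show "f + ?Q 1 x \<in> P"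
      using P_add[OF f] pcontrD(2)[OF pc_semigroupD(1)[OF Q zero_le_one]] xy by blast
    have "f + ?Q 1 x - (f + ?Q 1 y) = exp (- l) *\<^sub>R (S 1 x - S 1 y)"
      by (simp add: rescale_def algebra_simps)
    then show "norm (f + ?Q 1 x - (f + ?Q 1 y)) \<le> exp (- l) * norm (x - y)"
      using pcontr_dist[OF p PX[OF xy(1)] PX[OF xy(2)]] by simp
  qed (use l in auto)
  then obtain g where g: "g \<in> P" "f + ?Q 1 g = g" by blast
  let ?u = "integral {0..1} (\<lambda>t. ?Q t g)"
  have "(?u, ?Q 1 g - g) \<in> gen ?Q" by (rule integral_gen[OF Q PX[OF g(1)]]) simp
  moreover have "?Q 1 g - g = - f" using g(2) by (metis add_diff_cancel_right' minus_diff_eq)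
  ultimately have "(?u, - f) \<in> gen ?Q" by simp
  then have "(?u, l *\<^sub>R ?u - f) \<in> gen S"
    by (subst (asm) gen_rescale[OF pc_semigroupD(4)[OF S]]) simp_all
  moreover have "?u \<in> P"
    using pcontrD(2)[OF pc_semigroupD(1)[OF Q] g(1)]
    by (intro integral_P semigroup_integrable[OF Q PX[OF g(1)]]) auto
  ultimately show ?thesis by force
qed

end

section \<open>Absorption and a relatively bounded positive perturbation\<close>

text \<open>\<open>Q\<close> is the graph of an unbounded multiplication operator, which is bounded on each of the
  slices onto which the \<open>p n\<close> project.\<close>

locale sliced_perturbation = al_cone X P for X P :: "'b::banach set" +
  fixes S :: "real \<Rightarrow> 'b \<Rightarrow> 'b" and p W :: "nat \<Rightarrow> 'b \<Rightarrow> 'b" and N :: "nat \<Rightarrow> real"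
    and Q :: "('b \<times> 'b) set" and B :: "'b \<Rightarrow> 'b"
  assumes S: "pc_semigroup S"
    and p: "pcontr (p n)"
    and p_S: "0 \<le> t \<Longrightarrow> x \<in> X \<Longrightarrow> p n (S t x) = S t (p n x)"
    and p_idem: "x \<in> X \<Longrightarrow> p n (p n x) = p n x"
    and p_sums: "x \<in> X \<Longrightarrow> (\<lambda>n. p n x) sums x"
    and p_summable: "x \<in> X \<Longrightarrow> summable (\<lambda>n. norm (p n x))"
    and Q_X: "(x, y) \<in> Q \<Longrightarrow> x \<in> X \<and> y \<in> X"
    and Q_subspace: "subspace Q"
    and Q_closed: "closed Q"
    and Q_unique: "(x, y) \<in> Q \<Longrightarrow> (x, y') \<in> Q \<Longrightarrow> y = y'"
    and Q_pos: "(x, y) \<in> Q \<Longrightarrow> x \<in> P \<Longrightarrow> y \<in> P"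
    and p_W: "x \<in> X \<Longrightarrow> (p n x, W n x) \<in> Q"
    and p_Q: "(x, y) \<in> Q \<Longrightarrow> p n y = W n x"
    and N: "0 \<le> N n"
    and W_le: "x \<in> P \<Longrightarrow> N n *\<^sub>R p n x - W n x \<in> P"
    and B_pos: "(x, y) \<in> Q \<Longrightarrow> x \<in> P \<Longrightarrow> B x \<in> P"
    and B_add: "(x, y) \<in> Q \<Longrightarrow> (x', y') \<in> Q \<Longrightarrow> B (x + x') = B x + B x'"
    and B_scale: "(x, y) \<in> Q \<Longrightarrow> B (c *\<^sub>R x) = c *\<^sub>R B x"
    and B_bound: "(x, y) \<in> Q \<Longrightarrow> B x \<in> X \<and> norm (B x) \<le> 1 / 2 * norm y"
begin

section \<open>The generator and the multiplication operator on slices\<close>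

lemma gen_diff: "(x, y) \<in> gen S \<Longrightarrow> (x', y') \<in> gen S \<Longrightarrow> (x - x', y - y') \<in> gen S"
  using subspace_diff[OF gen_subspace[OF S], of "(x, y)" "(x', y')"] by simp

lemma Q_diff: "(x, y) \<in> Q \<Longrightarrow> (x', y') \<in> Q \<Longrightarrow> (x - x', y - y') \<in> Q"
  using subspace_diff[OF Q_subspace, of "(x, y)" "(x', y')"] by simp

lemma Q_add: "(x, y) \<in> Q \<Longrightarrow> (x', y') \<in> Q \<Longrightarrow> (x + x', y + y') \<in> Q"
  using subspace_add[OF Q_subspace, of "(x, y)" "(x', y')"] by simp

lemma Q_scale: "(x, y) \<in> Q \<Longrightarrow> (c *\<^sub>R x, c *\<^sub>R y) \<in> Q"
  using subspace_scale[OF Q_subspace, of "(x, y)" c] by simp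

lemma B_diff:
  assumes "(x, y) \<in> Q" "(x', y') \<in> Q"
  shows "B (x - x') = B x - B x'"
  using B_add[OF assms(1) Q_scale[OF assms(2), of "- 1"]] B_scale[OF assms(2), of "- 1"] by simp

lemma p_X: "x \<in> X \<Longrightarrow> p n x \<in> X"
  using pcontr_X[OF p] .

lemma p_gen:
  assumes "(x, y) \<in> gen S"
  shows "(p n x, p n y) \<in> gen S"
proof -
  note A = genD[OF assms]
  have "((\<lambda>h. (S h (p n x) - p n x) /\<^sub>R h) \<longlongrightarrow> p n y) (at_right 0)"
  proof (rule Lim_transform_eventually)
    show "((\<lambda>h. p n ((S h x - x) /\<^sub>R h)) \<longlongrightarrow> p n y) (at_right 0)"
    proof (rule LIM_zero_cancel, rule Lim_null_comparison)
      show "((\<lambda>h. norm ((S h x - x) /\<^sub>R h - y)) \<longlongrightarrow> 0) (at_right 0)"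
        using A(3) by (simp add: LIM_zero tendsto_norm_zero)
      show "\<forall>\<^sub>F h in at_right 0. norm (p n ((S h x - x) /\<^sub>R h) - p n y) \<le> norm ((S h x - x) /\<^sub>R h - y)"
        by (rule eventually_mono[OF eventually_at_right_less])
          (use A pcontr_X[OF pc_semigroupD(1)[OF S]] in \<open>intro pcontr_dist[OF p] X_scale X_diff; simp\<close>)
    qed
    show "\<forall>\<^sub>F h in at_right 0. p n ((S h x - x) /\<^sub>R h) = (S h (p n x) - p n x) /\<^sub>R h"
    proof (rule eventually_mono[OF eventually_at_right_less])
      fix h :: real assume h: "0 < h"
      then have Sx: "S h x \<in> X" using pcontr_X[OF pc_semigroupD(1)[OF S]] A(1) by simp
      then show "p n ((S h x - x) /\<^sub>R h) = (S h (p n x) - p n x) /\<^sub>R h"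
        using lin_opD(3)[OF pcontrD(1)[OF p] X_diff[OF Sx A(1)]] pcontr_diff[OF p Sx A(1)]
          p_S[OF _ A(1), of h] h by simp
    qed
  qed
  then show ?thesis using A p_X by (simp add: gen_def)
qed

lemma W_X: "x \<in> X \<Longrightarrow> W n x \<in> X"
  using p_W Q_X by blast

lemma W_diff: "x \<in> X \<Longrightarrow> y \<in> X \<Longrightarrow> W n (x - y) = W n x - W n y"
  using Q_unique[OF p_W[OF X_diff]] Q_diff[OF p_W p_W] pcontr_diff[OF p] by metis

lemma W_p: "x \<in> X \<Longrightarrow> W n (p n x) = W n x"
  using Q_unique[OF _ p_W] p_W[OF p_X] p_idem by metis

lemma p_W_eq: "x \<in> X \<Longrightarrow> p n (W n x) = W n x"
  using p_Q[OF p_W] W_p by metis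

text \<open>The missing absorption: on slice n the rate q is written as N n minus a nonnegative
  bounded remainder. The constant N n is absorbed into the resolvent parameter, and
  \<open>V n\<close> stands on the right-hand side as a positive gain.\<close>

definition V :: "nat \<Rightarrow> 'b \<Rightarrow> 'b" where
  "V n x = N n *\<^sub>R p n x - W n x"

lemma V_X: "x \<in> X \<Longrightarrow> V n x \<in> X"
  unfolding V_def by (intro X_diff X_scale p_X W_X)

lemma V_diff: "x \<in> X \<Longrightarrow> y \<in> X \<Longrightarrow> V n (x - y) = V n x - V n y"
  by (simp add: V_def W_diff pcontr_diff[OF p] scaleR_diff_right)

lemma V_p: "x \<in> X \<Longrightarrow> V n (p n x) = V n x"
  by (simp add: V_def W_p p_idem)

lemma p_V: "x \<in> X \<Longrightarrow> p n (V n x) = V n x"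
  using lin_opD(3)[OF pcontrD(1)[OF p] p_X] pcontr_diff[OF p X_scale[OF p_X] W_X]
  by (simp add: V_def p_idem p_W_eq)

text \<open>For \<open>x\<close> in \<open>P\<close> both \<open>V n x\<close> and
  \<open>W n x\<close> are in \<open>P\<close> and add up to \<open>N n *\<^sub>R p n x\<close>, so
  additivity of the norm bounds each summand by the whole. \<open>decomp\<close> carries the
  constant N n to signed \<open>x\<close>, where a plain triangle inequality for the difference
  would give 2 N n.\<close>

lemma V_bound:
  assumes x: "x \<in> X"
  shows "norm (V n x) \<le> N n * norm x"
proof -
  have pos: "norm (V n x) \<le> N n * norm x" if x: "x \<in> P" for x :: 'b
  proof -
    have "W n x \<in> P" using Q_pos[OF p_W[OF PX[OF x]]] pcontrD(2)[OF p x] .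
    then have "norm (V n x + W n x) = norm (V n x) + norm (W n x)"
      using W_le[OF x] by (intro norm_add) (simp_all add: V_def)
    moreover have "norm (V n x + W n x) \<le> N n * norm x"
      using pcontrD(3)[OF p PX[OF x]] N by (simp add: V_def mult_left_mono)
    ultimately show ?thesis using norm_ge_zero[of "W n x"] by linarith
  qed
  obtain a b where ab: "a \<in> P" "b \<in> P" "x = a - b" "norm x = norm a + norm b"
    using decomp[OF x] by blast
  have "norm (V n x) \<le> norm (V n a) + norm (V n b)"
    using V_diff[OF PX[OF ab(1)] PX[OF ab(2)]] ab(3) norm_triangle_ineq4 by metis
  also have "\<dots> \<le> N n * norm x"
    using pos[OF ab(1)] pos[OF ab(2)] by (simp add: ab(4) distrib_left)
  finally show ?thesis .
qed

section \<open>Transport with absorption\<close>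

lemma gen_zeroI:
  assumes "(u, v) \<in> gen S" "0 < l" "norm (l *\<^sub>R u - v) \<le> c * norm u" "c < l"
  shows "u = 0"
proof (rule ccontr)
  assume "u \<noteq> 0"
  with assms(4) have "c * norm u < l * norm u" by simp
  with gen_dissipative[OF S assms(1), of l] assms(2,3) show False by simp
qed

text \<open>The homogeneous equation is projected to slice n, where it reads (l + N n) u_n - v_n = V
  u_n. Dissipativity with parameter l + N n against the bound N n forces u_n = 0, and
  \<open>u\<close> is the sum of its slices.\<close>

lemma absorption_unique:
  assumes l: "0 < l" and uv: "(u, v) \<in> gen S" and uy: "(u, y) \<in> Q" and eq: "l *\<^sub>R u - v + y = 0"
  shows "u = 0"
proof -
  have u: "u \<in> X" and v: "v \<in> X" and y: "y \<in> X" using genD[OF uv] Q_X[OF uy] by auto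
  have "p n u = 0" for n
  proof (rule gen_zeroI[OF p_gen[OF uv]])
    note L = pcontrD(1)[OF p[of n]]
    have "p n (l *\<^sub>R u - v + y) = l *\<^sub>R p n u - p n v + W n u"
      using lin_opD(2,3)[OF L] lin_op_diff[OF L] u v y X_scale X_diff p_Q[OF uy] by simp
    moreover have "p n (l *\<^sub>R u - v + y) = 0" using lin_op_0[OF L] eq by simp
    ultimately have "(l + N n) *\<^sub>R p n u - p n v = V n u"
      by (simp add: V_def algebra_simps)
    then show "norm ((l + N n) *\<^sub>R p n u - p n v) \<le> N n * norm (p n u)"
      using V_bound[OF p_X[OF u], of n n] V_p[OF u] by simp
  qed (use l N[of n] in auto)
  with p_sums[OF u] show "u = 0" using sums_unique2[OF sums_zero] by simp
qed

text \<open>The bounded problem (l + N n) u - v = p_n f + V u is solved by iterating the resolvent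
  of \<open>S\<close>. The constant is N n / (l + N n) < 1, and the iteration stays positive because
  \<open>V n\<close> maps \<open>P\<close> to \<open>P\<close>; iterating directly with -q would
  lose the sign.\<close>

lemma absorption_slice:
  assumes l: "0 < l" and f: "f \<in> P"
  shows "\<exists>u v y. (u, v) \<in> gen S \<and> (u, y) \<in> Q \<and> u \<in> P \<and> l *\<^sub>R u - v + y = p n f"
proof -
  let ?l = "l + N n"
  have l': "0 < ?l" using l N[of n] by simp
  have "\<exists>u v. (u, v) \<in> gen S \<and> u \<in> P \<and> ?l *\<^sub>R u - v = g" if "g \<in> P" for g
    using semigroup_resolvent[OF S l' that] .
  then obtain R R' where R: "\<And>g. g \<in> P \<Longrightarrow> (R g, R' g) \<in> gen S \<and> R g \<in> P \<and> ?l *\<^sub>R R g - R' g = g"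
    by metis
  have fn: "p n f \<in> P" using pcontrD(2)[OF p f] .
  have VP: "V n u \<in> P" if "u \<in> P" for u using W_le[OF that] by (simp add: V_def)
  have "\<exists>u\<in>P. R (p n f + V n u) = u"
  proof (rule fixpoint[of "N n / ?l"])
    fix x y assume x: "x \<in> P" and y: "y \<in> P"
    have fx: "p n f + V n x \<in> P" and fy: "p n f + V n y \<in> P"
      using P_add[OF fn VP] x y by auto
    show "R (p n f + V n x) \<in> P" using R[OF fx] by blast
    have "(R (p n f + V n x) - R (p n f + V n y), R' (p n f + V n x) - R' (p n f + V n y)) \<in> gen S"
      using gen_diff R[OF fx] R[OF fy] by blast
    then have "?l * norm (R (p n f + V n x) - R (p n f + V n y)) \<le>
        norm (?l *\<^sub>R (R (p n f + V n x) - R (p n f + V n y)) - (R' (p n f + V n x) - R' (p n f + V n y)))"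
      using gen_dissipative[OF S] l' by auto
    also have "?l *\<^sub>R (R (p n f + V n x) - R (p n f + V n y)) - (R' (p n f + V n x) - R' (p n f + V n y)) =
        (?l *\<^sub>R R (p n f + V n x) - R' (p n f + V n x)) - (?l *\<^sub>R R (p n f + V n y) - R' (p n f + V n y))"
      by (simp add: scaleR_diff_right)
    also have "\<dots> = V n (x - y)"
      using R[OF fx] R[OF fy] V_diff[OF PX[OF x] PX[OF y]] by simp
    also have "norm (V n (x - y)) \<le> N n * norm (x - y)"
      by (rule V_bound) (use PX x y X_diff in blast)
    finally show "norm (R (p n f + V n x) - R (p n f + V n y)) \<le> N n / ?l * norm (x - y)"
      using l' by (simp add: field_simps)
  qed (use l N[of n] in auto)
  then obtain u where u: "u \<in> P" "R (p n f + V n u) = u" by blast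
  let ?g = "p n f + V n u"
  let ?v = "R' ?g"
  have uX: "u \<in> X" using PX[OF u(1)] .
  have fX: "p n f \<in> X" using PX[OF fn] .
  have uv: "(u, ?v) \<in> gen S" "?l *\<^sub>R u - ?v = ?g"
    using R[OF P_add[OF fn VP[OF u(1)]]] u(2) by auto
  have vX: "?v \<in> X" using genD(2)[OF uv(1)] .
  \<comment> \<open>The solution must live on slice n, since only there do N n and
    \<open>W n\<close> combine to q. Data in slice n give it: \<open>u\<close> and
    \<open>p n u\<close> solve the same resolvent equation.\<close>
  have "u - p n u = 0"
  proof (rule gen_zeroI[OF gen_diff[OF uv(1) p_gen[OF uv(1)]] l'])
    have "p n ?g = ?g"
      using lin_opD(2)[OF pcontrD(1)[OF p] fX V_X[OF uX]] p_idem[OF PX[OF f]] p_V[OF uX] by simp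
    moreover have "p n (?l *\<^sub>R u - ?v) = ?l *\<^sub>R p n u - p n ?v"
      using pcontr_diff[OF p X_scale[OF uX] vX] lin_opD(3)[OF pcontrD(1)[OF p] uX]
      by (simp only:)
    ultimately have "?l *\<^sub>R p n u - p n ?v = ?l *\<^sub>R u - ?v"
      using uv(2) by metis
    then have "?l *\<^sub>R (u - p n u) - (?v - p n ?v) = 0"
      by (simp only: scaleR_diff_right) (simp add: algebra_simps)
    then show "norm (?l *\<^sub>R (u - p n u) - (?v - p n ?v)) \<le> 0 * norm (u - p n u)" by simp
  qed (use l' in simp)
  then have pu: "p n u = u" by simp
  have "(u, W n u) \<in> Q" using p_W[OF uX, of n] pu by simp
  moreover have "l *\<^sub>R u - ?v + W n u = p n f"
    using uv(2) pu by (simp add: V_def algebra_simps)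
  ultimately show ?thesis using uv(1) u(1) by blast
qed

text \<open>\<open>gen_norm_le\<close> is applied to the positive element l u + y, whose norm
  splits. The constant one in front of \<open>norm y\<close> is what leaves half of the absorption
  available against the perturbation.\<close>

lemma absorption_bound:
  assumes l: "0 < l" and uv: "(u, v) \<in> gen S" and uy: "(u, y) \<in> Q" and u: "u \<in> P"
  shows "l * norm u + norm y \<le> norm (l *\<^sub>R u - v + y)"
proof -
  have y: "y \<in> P" using Q_pos[OF uy u] .
  have lu: "l *\<^sub>R u \<in> P" using P_scale[OF _ u] l by simp
  have "norm (l *\<^sub>R u + y) \<le> norm (l *\<^sub>R u + y - v)"
    by (rule gen_norm_le[OF S uv u P_add[OF lu y]])
  also have "l *\<^sub>R u + y - v = l *\<^sub>R u - v + y" by simp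
  finally show ?thesis using norm_add[OF lu y] l by simp
qed

text \<open>The equation with right-hand side \<open>u - v\<close> has a solution in the graph,
  obtained by splitting into positive parts. Dissipativity with parameter 1 makes the given sequence
  converge to that solution, so the limit is a point of the graph.\<close>

lemma gen_closed:
  assumes u: "u' \<longlonglongrightarrow> u" and v: "v' \<longlonglongrightarrow> v" and uv: "\<And>n. (u' n, v' n) \<in> gen S"
  shows "(u, v) \<in> gen S"
proof -
  have uX: "u \<in> X" and vX: "v \<in> X"
    using closed_sequentially[OF X_closed] genD(1,2)[OF uv] u v by blast+
  obtain a b where ab: "a \<in> P" "b \<in> P" "u - v = a - b" using decomp[OF X_diff[OF uX vX]] by blast
  obtain x y where xy: "(x, y) \<in> gen S" "1 *\<^sub>R x - y = a" using semigroup_resolvent[OF S zero_less_one ab(1)] by blast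
  obtain x' y' where xy': "(x', y') \<in> gen S" "1 *\<^sub>R x' - y' = b" using semigroup_resolvent[OF S zero_less_one ab(2)] by blast
  have w: "(x - x', y - y') \<in> gen S" using gen_diff xy(1) xy'(1) by blast
  have eq: "(x - x') - (y - y') = u - v" using xy(2) xy'(2) ab(3) by (simp add: algebra_simps)
  have "norm (u' n - (x - x')) \<le> norm ((u' n - u) - (v' n - v))" for n
  proof -
    have "1 * norm (u' n - (x - x')) \<le> norm (1 *\<^sub>R (u' n - (x - x')) - (v' n - (y - y')))"
      by (rule gen_dissipative[OF S gen_diff[OF uv w]]) simp
    also have "1 *\<^sub>R (u' n - (x - x')) - (v' n - (y - y')) = (u' n - u) - (v' n - v)"
      using eq by (simp add: algebra_simps)
    finally show ?thesis by simp
  qed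
  note bound = this
  have "(\<lambda>n. norm ((u' n - u) - (v' n - v))) \<longlonglongrightarrow> 0"
    using tendsto_norm[OF tendsto_diff[OF LIM_zero[OF u] LIM_zero[OF v]]] by simp
  then have "(\<lambda>n. u' n - (x - x')) \<longlonglongrightarrow> 0"
    by (rule Lim_null_comparison[OF always_eventually[OF allI[OF bound]]])
  then have "u' \<longlonglongrightarrow> x - x'" by (rule LIM_zero_cancel)
  then have "u = x - x'" using LIMSEQ_unique[OF u] by blast
  moreover have "v = y - y'"
    using eq unfolding \<open>u = x - x'\<close> by (metis diff_diff_eq2 add_diff_cancel_left' diff_add_cancel)
  ultimately show ?thesis using w by simp
qed

text \<open>By \<open>absorption_bound\<close> the slice solutions and their products with q are
  dominated by the absolutely summable \<open>norm (p n f)\<close>. The images under the generator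
  need no estimate of their own: the equation expresses them through convergent series. Closedness
  of both graphs then passes to the sum, which hence lies in both domains.\<close>

lemma absorption_pos:
  assumes l: "0 < l" and f: "f \<in> P"
  shows "\<exists>u v y. (u, v) \<in> gen S \<and> (u, y) \<in> Q \<and> u \<in> P \<and> l *\<^sub>R u - v + y = f"
proof -
  obtain u v y where uvy: "\<And>n. (u n, v n) \<in> gen S" "\<And>n. (u n, y n) \<in> Q" "\<And>n. u n \<in> P"
      "\<And>n. l *\<^sub>R u n - v n + y n = p n f"
    using absorption_slice[OF l f] by metis
  have bound: "l * norm (u n) + norm (y n) \<le> norm (p n f)" for n
    using absorption_bound[OF l uvy(1,2,3), of n] uvy(4) by simp
  have sf: "summable (\<lambda>n. norm (p n f))" using p_summable[OF PX[OF f]] .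
  have "summable (\<lambda>n. norm (p n f) / l)" using sf by (rule summable_divide)
  moreover have "norm (u n) \<le> norm (p n f) / l" for n
  proof -
    have "l * norm (u n) \<le> norm (p n f)" using bound[of n] norm_ge_zero[of "y n"] by linarith
    then show ?thesis using l by (simp add: field_simps)
  qed
  ultimately have su: "summable u"
    using summable_comparison_test'[of "\<lambda>n. norm (p n f) / l" 0 u] by simp
  have "norm (y n) \<le> norm (p n f)" for n
  proof -
    have "0 \<le> l * norm (u n)" using l by simp
    then show ?thesis using bound[of n] by linarith
  qed
  then have sy: "summable y"
    using summable_comparison_test'[OF sf, of 0 y] by simp
  have v_eq: "v n = l *\<^sub>R u n + y n - p n f" for n using uvy(4)[of n] by (simp add: algebra_simps)
  have v_sums: "v sums (l *\<^sub>R suminf u + suminf y - f)"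
    unfolding v_eq[abs_def] using su sy p_sums[OF PX[OF f]]
    by (intro sums_diff sums_add sums_scaleR_right summable_sums)
  have partial: "(\<Sum>k<n. u k, \<Sum>k<n. v k) \<in> gen S" "(\<Sum>k<n. u k, \<Sum>k<n. y k) \<in> Q" for n
    using subspace_sum[OF gen_subspace[OF S], of "{..<n}" "\<lambda>k. (u k, v k)"]
      subspace_sum[OF Q_subspace, of "{..<n}" "\<lambda>k. (u k, y k)"] uvy(1,2)
    by (simp_all add: sum_prod)
  have uS: "(\<lambda>n. \<Sum>k<n. u k) \<longlonglongrightarrow> suminf u" and yS: "(\<lambda>n. \<Sum>k<n. y k) \<longlonglongrightarrow> suminf y"
    using su sy by (simp_all add: summable_LIMSEQ)
  have "(suminf u, l *\<^sub>R suminf u + suminf y - f) \<in> gen S"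
    using gen_closed[OF uS _ partial(1)] v_sums by (simp add: sums_def)
  moreover have "(suminf u, suminf y) \<in> Q"
    by (rule closed_sequentially[OF Q_closed partial(2) tendsto_Pair[OF uS yS]])
  moreover have "(\<Sum>k<n. u k) \<in> P" for n by (induction n) (auto simp: P_0 P_add uvy(3))
  then have "suminf u \<in> P" using closed_sequentially[OF P_closed _ uS] by blast
  ultimately show ?thesis by force
qed

lemma absorption_ex:
  assumes l: "0 < l" and f: "f \<in> X"
  shows "\<exists>u v y. (u, v) \<in> gen S \<and> (u, y) \<in> Q \<and> l *\<^sub>R u - v + y = f \<and> norm y \<le> norm f"
proof -
  obtain a b where ab: "a \<in> P" "b \<in> P" "f = a - b" "norm f = norm a + norm b" using decomp[OF f] by blast
  obtain u v y where 1: "(u, v) \<in> gen S" "(u, y) \<in> Q" "u \<in> P" "l *\<^sub>R u - v + y = a"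
    using absorption_pos[OF l ab(1)] by blast
  obtain u' v' y' where 2: "(u', v') \<in> gen S" "(u', y') \<in> Q" "u' \<in> P" "l *\<^sub>R u' - v' + y' = b"
    using absorption_pos[OF l ab(2)] by blast
  have "0 \<le> l * norm u" "0 \<le> l * norm u'" using l by simp_all
  then have "norm y \<le> norm a" "norm y' \<le> norm b"
    using absorption_bound[OF l 1(1-3)] absorption_bound[OF l 2(1-3)] unfolding 1(4) 2(4)
    by linarith+
  then have "norm (y - y') \<le> norm f" using norm_triangle_ineq4[of y y'] ab(4) by linarith
  moreover have "l *\<^sub>R (u - u') - (v - v') + (y - y') = f"
    using 1(4) 2(4) ab(3) by (simp add: algebra_simps)
  ultimately show ?thesis using gen_diff[OF 1(1) 2(1)] Q_diff[OF 1(2) 2(2)] by blast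
qed

section \<open>The perturbed operator on the full domain\<close>

definition R :: "real \<Rightarrow> 'b \<Rightarrow> 'b" where
  "R l f = (SOME u. \<exists>v y. (u, v) \<in> gen S \<and> (u, y) \<in> Q \<and> l *\<^sub>R u - v + y = f)"

lemma R_eqI:
  assumes l: "0 < l" and u: "(u, v) \<in> gen S" "(u, y) \<in> Q" "l *\<^sub>R u - v + y = f"
  shows "R l f = u"
proof -
  have "\<exists>v y. (R l f, v) \<in> gen S \<and> (R l f, y) \<in> Q \<and> l *\<^sub>R R l f - v + y = f"
    unfolding R_def by (rule someI_ex) (use u in blast)
  then obtain v' y' where *: "(R l f, v') \<in> gen S" "(R l f, y') \<in> Q" "l *\<^sub>R R l f - v' + y' = f"
    by blast
  have "l *\<^sub>R (R l f - u) - (v' - v) + (y' - y) = 0"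
    using u(3) *(3) by (simp add: algebra_simps)
  then show ?thesis
    using absorption_unique[OF l gen_diff[OF *(1) u(1)] Q_diff[OF *(2) u(2)]] by simp
qed

text \<open>The difference of two solutions solves the equation with data f - g, for which
  \<open>absorption_ex\<close> bounds the absorbed part by \<open>norm (f - g)\<close>;
  \<open>B_bound\<close> contributes the factor 1/2.\<close>

lemma BR_contraction:
  assumes l: "0 < l" and f: "f \<in> X" and g: "g \<in> X"
  shows "norm (B (R l f) - B (R l g)) \<le> 1 / 2 * norm (f - g)"
proof -
  have ex: "\<exists>v y. (R l f, v) \<in> gen S \<and> (R l f, y) \<in> Q \<and> l *\<^sub>R R l f - v + y = f" if "f \<in> X" for f
    using absorption_ex[OF l that] R_eqI[OF l] by metis
  obtain v y where 1: "(R l f, v) \<in> gen S" "(R l f, y) \<in> Q" "l *\<^sub>R R l f - v + y = f" using ex[OF f] by blast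
  obtain v' y' where 2: "(R l g, v') \<in> gen S" "(R l g, y') \<in> Q" "l *\<^sub>R R l g - v' + y' = g" using ex[OF g] by blast
  obtain u w z where 3: "(u, w) \<in> gen S" "(u, z) \<in> Q" "l *\<^sub>R u - w + z = f - g" "norm z \<le> norm (f - g)"
    using absorption_ex[OF l X_diff[OF f g]] by blast
  have "l *\<^sub>R (R l f - R l g) - (v - v') + (y - y') = f - g"
    using 1(3) 2(3) by (simp add: algebra_simps)
  from R_eqI[OF l gen_diff[OF 1(1) 2(1)] Q_diff[OF 1(2) 2(2)] this]
  have "u = R l f - R l g" using R_eqI[OF l 3(1-3)] by metis
  then have "B (R l f) - B (R l g) = B u" using B_diff[OF 1(2) 2(2)] by simp
  then show ?thesis using B_bound[OF 3(2)] 3(4) by simp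
qed

text \<open>No closure is taken. The generator is to have exactly the intersection of the two
  domains, so this plain sum must itself satisfy the range condition.\<close>

definition K :: "('b \<times> 'b) set" where
  "K = {(x, w). \<exists>v y. (x, v) \<in> gen S \<and> (x, y) \<in> Q \<and> w = v - y + B x}"

lemma K_I: "(x, v) \<in> gen S \<Longrightarrow> (x, y) \<in> Q \<Longrightarrow> (x, v - y + B x) \<in> K"
  by (auto simp: K_def)

text \<open>The unknown is the total source g = f + B u and not u itself: g is a fixed point of a
  contraction with constant 1/2 on \<open>P\<close>, and u = R l g. From l |u| + |y| \<le> |f + B u|
  \<le> |f| + |y|/2 the terms in y drop out with the right sign, giving the contractive resolvent
  bound.\<close>

lemma K_range:
  assumes l: "0 < l" and f: "f \<in> P"
  shows "\<exists>u w. (u, w) \<in> K \<and> u \<in> P \<and> l *\<^sub>R u - w = f \<and> l * norm u \<le> norm f"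
proof -
  have RP: "\<exists>v y. (R l g, v) \<in> gen S \<and> (R l g, y) \<in> Q \<and> R l g \<in> P \<and> l *\<^sub>R R l g - v + y = g" if "g \<in> P" for g
    using absorption_pos[OF l that] R_eqI[OF l] by metis
  have "\<exists>g\<in>P. f + B (R l g) = g"
  proof (rule fixpoint[of "1 / 2"])
    fix x y assume x: "x \<in> P" and y: "y \<in> P"
    show "f + B (R l x) \<in> P" using RP[OF x] B_pos P_add[OF f] by blast
    show "norm (f + B (R l x) - (f + B (R l y))) \<le> 1 / 2 * norm (x - y)"
      using BR_contraction[OF l PX[OF x] PX[OF y]] by simp
  qed auto
  then obtain g where g: "g \<in> P" "f + B (R l g) = g" by blast
  obtain v y where u: "(R l g, v) \<in> gen S" "(R l g, y) \<in> Q" "R l g \<in> P" "l *\<^sub>R R l g - v + y = g"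
    using RP[OF g(1)] by blast
  let ?u = "R l g"
  have "l * norm ?u + norm y \<le> norm (f + B ?u)"
    using absorption_bound[OF l u(1-3)] u(4) g(2) by simp
  also have "\<dots> \<le> norm f + 1 / 2 * norm y"
    using norm_triangle_ineq[of f "B ?u"] B_bound[OF u(2)] by linarith
  finally have "l * norm ?u \<le> norm f" using norm_ge_zero[of y] by linarith
  moreover have "l *\<^sub>R ?u - (v - y + B ?u) = f" using u(4) g(2) by (simp add: algebra_simps)
  ultimately show ?thesis using K_I[OF u(1,2)] u(3) by blast
qed

text \<open>If l u is the image of u, then u = R l (B u), so B u is a fixed point of B composed with
  \<open>R l\<close>. So is 0, and the map contracts; hence B u = 0 and u = R l 0 = 0.\<close>

lemma K_inj:
  assumes l: "0 < l" and u: "(u, l *\<^sub>R u) \<in> K"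
  shows "u = 0"
proof -
  obtain v y where *: "(u, v) \<in> gen S" "(u, y) \<in> Q" "l *\<^sub>R u = v - y + B u"
    using u by (auto simp: K_def)
  have "l *\<^sub>R u - v + y = B u" using *(3) by (simp add: algebra_simps)
  then have 1: "R l (B u) = u" using R_eqI[OF l *(1,2)] by blast
  have "R l 0 = 0"
    using R_eqI[OF l, of 0 0 0 0] subspace_0[OF gen_subspace[OF S]] subspace_0[OF Q_subspace]
    by (simp add: zero_prod_def)
  moreover have "B 0 = 0" using B_scale[OF *(2), of 0] by simp
  ultimately have "norm (B u) \<le> 1 / 2 * norm (B u)"
    using BR_contraction[OF l, of "B u" 0] B_bound[OF *(2)] X_0 1 by simp
  then have "B u = 0" by simp
  with 1 \<open>R l 0 = 0\<close> show ?thesis by simp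
qed

text \<open>Elements of the dense domain of the generator are cut down to finitely many slices. The
  cut commutes with the generator and leaves a region where q is bounded, so it stays in both
  domains.\<close>

lemma K_dense: "X \<subseteq> closure (fst ` K)"
proof
  fix x assume x: "x \<in> X"
  show "x \<in> closure (fst ` K)"
    unfolding closure_approachable
  proof (intro allI impI)
    fix e :: real assume e: "0 < e"
    have "x \<in> closure (fst ` gen S)" using gen_dense[OF S] x by blast
    then obtain a where "a \<in> fst ` gen S" "dist a x < e / 2"
      using e closure_approachable[of x "fst ` gen S"] by (meson half_gt_zero)
    then obtain x' v where x': "(x', v) \<in> gen S" "dist x' x < e / 2" by force
    have x'X: "x' \<in> X" using genD(1)[OF x'(1)] .
    obtain n where n: "dist (\<Sum>k<n. p k x') x' < e / 2"
      using LIMSEQ_D[OF p_sums[OF x'X, unfolded sums_def], of "e / 2"] e by (auto simp: dist_norm)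
    have "(\<Sum>k<n. p k x', \<Sum>k<n. p k v) \<in> gen S" "(\<Sum>k<n. p k x', \<Sum>k<n. W k x') \<in> Q"
      using subspace_sum[OF gen_subspace[OF S], of "{..<n}" "\<lambda>k. (p k x', p k v)"]
        subspace_sum[OF Q_subspace, of "{..<n}" "\<lambda>k. (p k x', W k x')"] p_gen[OF x'(1)] p_W[OF x'X]
      by (simp_all add: sum_prod)
    then have "(\<Sum>k<n. p k x') \<in> fst ` K" using K_I by force
    moreover have "dist (\<Sum>k<n. p k x') x < e"
      using dist_triangle[of "\<Sum>k<n. p k x'" x x'] n x'(2) by linarith
    ultimately show "\<exists>y\<in>fst ` K. dist y x < e" by blast
  qed
qed

lemma K_subspace: "subspace K"
proof (rule subspaceI)
  have "B 0 = 0"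
    using B_scale[of 0 0 0] subspace_0[OF Q_subspace] by (simp add: zero_prod_def)
  then show "0 \<in> K"
    using K_I[of 0 0 0] subspace_0[OF gen_subspace[OF S]] subspace_0[OF Q_subspace]
    by (simp add: zero_prod_def)
next
  fix a b assume "a \<in> K" "b \<in> K"
  then obtain x v y x' v' y' where a: "a = (x, v - y + B x)" "(x, v) \<in> gen S" "(x, y) \<in> Q"
      and b: "b = (x', v' - y' + B x')" "(x', v') \<in> gen S" "(x', y') \<in> Q"
    by (auto simp: K_def)
  have "(x + x', v + v') \<in> gen S"
    using subspace_add[OF gen_subspace[OF S] a(2) b(2)] by simp
  from K_I[OF this Q_add[OF a(3) b(3)]]
  have "(x + x', (v - y + B x) + (v' - y' + B x')) \<in> K"
    unfolding B_add[OF a(3) b(3)] by (simp add: algebra_simps)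
  then show "a + b \<in> K" using a(1) b(1) by simp
next
  fix c a assume "a \<in> K"
  then obtain x v y where a: "a = (x, v - y + B x)" "(x, v) \<in> gen S" "(x, y) \<in> Q"
    by (auto simp: K_def)
  have "(c *\<^sub>R x, c *\<^sub>R v) \<in> gen S"
    using subspace_scale[OF gen_subspace[OF S] a(2)] by simp
  from K_I[OF this Q_scale[OF a(3)]]
  have "(c *\<^sub>R x, c *\<^sub>R (v - y + B x)) \<in> K"
    unfolding B_scale[OF a(3)] by (simp add: algebra_simps)
  then show "c *\<^sub>R a \<in> K" using a(1) by simp
qed

sublocale K: dissipative_graph X P K
proof
  fix x y assume "(x, y) \<in> K"
  then obtain v z where "(x, v) \<in> gen S" "(x, z) \<in> Q" "y = v - z + B x"
    by (auto simp: K_def)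
  then show "x \<in> X \<and> y \<in> X"
    using genD Q_X B_bound X_add X_diff by metis
qed (use K_subspace K_range K_inj K_dense in auto)

theorem perturbed_generation: "\<exists>S'. pc_semigroup S' \<and> gen S' = K"
  using K.generation by blast

end

section \<open>Spaces of integrable functions as closed subspaces of a Banach space\<close>

instance bcontfun :: (metric_space, banach) banach ..

text \<open>The function \<open>u\<close> becomes the functional \<open>\<phi> \<mapsto> \<integral> \<phi> u\<close> on measurable functions with values in
  \<open>[-1, 1]\<close>. This turns almost everywhere equality into equality, without a quotient type.\<close>

definition test_fun :: "'a measure \<Rightarrow> ('a \<Rightarrow> real) \<Rightarrow> bool" where
  "test_fun M \<phi> \<longleftrightarrow> \<phi> \<in> borel_measurable M \<and> (\<forall>z. \<bar>\<phi> z\<bar> \<le> 1)"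

text \<open>The discrete topology on the index set makes every bounded function of the test function
  continuous, so the supremum norm of the ambient Banach space is available. The value 0 off the
  test functions merely makes the functional total; for u outside \<open>L1 M\<close> the term
  carries no information.\<close>

definition emb :: "'a measure \<Rightarrow> ('a \<Rightarrow> real) \<Rightarrow> (('a \<Rightarrow> real) discrete \<Rightarrow>\<^sub>C real)" where
  "emb M u = Bcontfun (\<lambda>d. if test_fun M (of_discrete d) then LINT z|M. of_discrete d z * u z else 0)"

lemma L1_lin: "u \<in> L1 M \<Longrightarrow> v \<in> L1 M \<Longrightarrow> (\<lambda>z. c * u z + d * v z) \<in> L1 M"
  by (simp add: L1_def)

lemma L1_diff: "u \<in> L1 M \<Longrightarrow> v \<in> L1 M \<Longrightarrow> (\<lambda>z. u z - v z) \<in> L1 M"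
  by (simp add: L1_def)

lemma L1_norm_nonneg: "0 \<le> L1_norm M u"
  by (simp add: L1_norm_def)

lemma integrable_test:
  assumes "test_fun M \<phi>" "u \<in> L1 M"
  shows "integrable M (\<lambda>z. \<phi> z * u z)"
proof (rule Bochner_Integration.integrable_bound[of M u])
  show "AE z in M. norm (\<phi> z * u z) \<le> norm (u z)"
    using assms(1) by (intro AE_I2) (simp add: test_fun_def abs_mult mult_left_le_one_le)
  show "(\<lambda>z. \<phi> z * u z) \<in> borel_measurable M"
    using assms by (auto simp: test_fun_def L1_def)
qed (use assms in \<open>simp add: L1_def\<close>)

lemma test_bound:
  assumes "test_fun M \<phi>" "u \<in> L1 M"
  shows "\<bar>LINT z|M. \<phi> z * u z\<bar> \<le> L1_norm M u"
proof -
  have "\<bar>LINT z|M. \<phi> z * u z\<bar> \<le> (LINT z|M. \<bar>\<phi> z * u z\<bar>)"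
    by (rule integral_abs_bound)
  also have "\<dots> \<le> (LINT z|M. \<bar>u z\<bar>)"
  proof (rule integral_mono)
    show "\<bar>\<phi> z * u z\<bar> \<le> \<bar>u z\<bar>" for z
      using assms(1) by (simp add: test_fun_def abs_mult mult_left_le_one_le)
  qed (use assms integrable_test[OF assms] in \<open>auto simp: L1_def intro: integrable_abs\<close>)
  finally show ?thesis by (simp add: L1_norm_def)
qed

lemma emb_apply:
  assumes "u \<in> L1 M"
  shows "apply_bcontfun (emb M u) d =
    (if test_fun M (of_discrete d) then LINT z|M. of_discrete d z * u z else 0)"
  unfolding emb_def
proof (subst Bcontfun_inverse)
  let ?f = "\<lambda>d. if test_fun M (of_discrete d) then LINT z|M. of_discrete d z * u z else 0"
  show "?f \<in> bcontfun"
  proof (rule bcontfun_normI)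
    show "continuous_on UNIV ?f"
      by (simp add: continuous_on_open_vimage open_discrete)
    show "norm (?f d) \<le> L1_norm M u" for d
      using test_bound[OF _ assms] by (simp add: L1_norm_nonneg)
  qed
qed simp

lemma emb_lin:
  assumes "u \<in> L1 M" "v \<in> L1 M"
  shows "emb M (\<lambda>z. c * u z + d * v z) = c *\<^sub>R emb M u + d *\<^sub>R emb M v"
proof (rule bcontfun_eqI)
  fix x
  show "apply_bcontfun (emb M (\<lambda>z. c * u z + d * v z)) x = apply_bcontfun (c *\<^sub>R emb M u + d *\<^sub>R emb M v) x"
  proof (cases "test_fun M (of_discrete x)")
    case True
    have "(LINT z|M. of_discrete x z * (c * u z + d * v z)) =
        (LINT z|M. c * (of_discrete x z * u z) + d * (of_discrete x z * v z))"
      by (simp add: algebra_simps)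
    also have "\<dots> = c * (LINT z|M. of_discrete x z * u z) + d * (LINT z|M. of_discrete x z * v z)"
      using integrable_test[OF True] assms by simp
    finally show ?thesis using True by (simp add: emb_apply assms emb_apply[OF L1_lin[OF assms]])
  qed (simp add: emb_apply assms emb_apply[OF L1_lin[OF assms]])
qed

lemma emb_diff: "u \<in> L1 M \<Longrightarrow> v \<in> L1 M \<Longrightarrow> emb M (\<lambda>z. u z - v z) = emb M u - emb M v"
  using emb_lin[of u M v 1 "- 1"] by simp

lemma emb_add: "u \<in> L1 M \<Longrightarrow> v \<in> L1 M \<Longrightarrow> emb M (\<lambda>z. u z + v z) = emb M u + emb M v"
  using emb_lin[of u M v 1 1] by simp

lemma emb_scale: "u \<in> L1 M \<Longrightarrow> emb M (\<lambda>z. c * u z) = c *\<^sub>R emb M u"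
  using emb_lin[of u M u c 0] by simp

lemma zero_L1: "(\<lambda>z. 0) \<in> L1 M"
  by (simp add: L1_def)

lemma emb_0: "emb M (\<lambda>z. 0) = 0"
  using emb_scale[OF zero_L1, of M 0] by simp

lemma norm_emb:
  assumes u: "u \<in> L1 M"
  shows "norm (emb M u) = L1_norm M u"
proof (rule antisym)
  show "norm (emb M u) \<le> L1_norm M u"
    using test_bound[OF _ u] by (intro norm_bound) (simp add: emb_apply[OF u] L1_norm_nonneg)
  \<comment> \<open>The sign of u is a test function that attains the supremum; its value where u
    vanishes has no effect on the integral.\<close>
  let ?s = "\<lambda>z. if 0 \<le> u z then 1 else - 1 :: real"
  have "test_fun M ?s" using u by (auto simp: test_fun_def L1_def)
  then have "apply_bcontfun (emb M u) (discrete ?s) = (LINT z|M. ?s z * u z)"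
    by (simp add: emb_apply[OF u] discrete_inverse)
  also have "\<dots> = L1_norm M u"
    unfolding L1_norm_def by (intro Bochner_Integration.integral_cong) auto
  finally show "L1_norm M u \<le> norm (emb M u)"
    using norm_bounded[of "emb M u" "discrete ?s"] by simp
qed

lemma L1_norm_eq_0:
  assumes "u \<in> L1 M"
  shows "L1_norm M u = 0 \<longleftrightarrow> (AE z in M. u z = 0)"
  using assms integral_nonneg_eq_0_iff_AE[of M "\<lambda>z. \<bar>u z\<bar>"] by (simp add: L1_norm_def L1_def)

lemma emb_eq_iff:
  assumes "u \<in> L1 M" "v \<in> L1 M"
  shows "emb M u = emb M v \<longleftrightarrow> (AE z in M. u z = v z)"
proof -
  have "emb M u = emb M v \<longleftrightarrow> norm (emb M (\<lambda>z. u z - v z)) = 0"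
    using emb_diff[OF assms] by simp
  then show ?thesis
    using L1_norm_eq_0[OF L1_diff[OF assms]] norm_emb[OF L1_diff[OF assms]] by simp
qed

section \<open>Representatives, completeness and the positive cone of the embedding\<close>

definition rep :: "'a measure \<Rightarrow> (('a \<Rightarrow> real) discrete \<Rightarrow>\<^sub>C real) \<Rightarrow> 'a \<Rightarrow> real" where
  "rep M x = (SOME u. u \<in> L1 M \<and> emb M u = x)"

abbreviation "embX M \<equiv> emb M ` L1 M"
abbreviation "embP M \<equiv> emb M ` {u \<in> L1 M. AE z in M. 0 \<le> u z}"

lemma rep:
  assumes "x \<in> embX M"
  shows "rep M x \<in> L1 M" "emb M (rep M x) = x"
proof -
  have "\<exists>u. u \<in> L1 M \<and> emb M u = x" using assms by auto
  from someI_ex[OF this] show "rep M x \<in> L1 M" "emb M (rep M x) = x" by (simp_all add: rep_def)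
qed

lemma rep_emb:
  assumes "u \<in> L1 M"
  shows "AE z in M. rep M (emb M u) z = u z" "rep M (emb M u) \<in> L1 M"
  using rep[of "emb M u" M] emb_eq_iff[of "rep M (emb M u)" M u] assms by auto

lemma emb_nonneg_iff:
  assumes "u \<in> L1 M"
  shows "emb M u \<in> embP M \<longleftrightarrow> (AE z in M. 0 \<le> u z)"
proof
  assume "emb M u \<in> embP M"
  then obtain v where v: "v \<in> L1 M" "AE z in M. 0 \<le> v z" "emb M u = emb M v" by auto
  then have "AE z in M. u z = v z" using emb_eq_iff[OF assms] by blast
  with v(2) show "AE z in M. 0 \<le> u z" by eventually_elim simp
qed (use assms in auto)

text \<open>Absolutely summable series converge: the sum of the absolute values is integrable, hence
  finite almost everywhere, which defines the limit pointwise. The distance to a partial sum is at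
  most the tail of the series of norms.\<close>

lemma L1_complete:
  assumes u: "\<And>n. u n \<in> L1 M" and s: "summable (\<lambda>n. L1_norm M (u n))"
  shows "\<exists>v\<in>L1 M. (\<lambda>n. emb M (\<lambda>z. \<Sum>k<n. u k z)) \<longlonglongrightarrow> emb M v"
proof -
  have i: "integrable M (u n)" for n using u by (simp add: L1_def)
  have fin: "AE z in M. summable (\<lambda>n. norm (u n z))"
  proof -
    have "(\<integral>\<^sup>+z. (\<Sum>n. ennreal (norm (u n z))) \<partial>M) = (\<Sum>n. \<integral>\<^sup>+z. ennreal (norm (u n z)) \<partial>M)"
      using i by (intro nn_integral_suminf) auto
    also have "\<dots> = (\<Sum>n. ennreal (L1_norm M (u n)))"
      using i by (simp add: L1_norm_def nn_integral_eq_integral)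
    also have "\<dots> \<noteq> \<infinity>"
      using s by (simp add: suminf_ennreal2[OF L1_norm_nonneg s])
    finally have "AE z in M. (\<Sum>n. ennreal (norm (u n z))) \<noteq> \<infinity>"
      using i by (intro nn_integral_PInf_AE) auto
    then show ?thesis
      by eventually_elim (auto intro: summable_suminf_not_top)
  qed
  have sn: "summable (\<lambda>n. LINT z|M. norm (u n z))" using s by (simp add: L1_norm_def)
  have v: "integrable M (\<lambda>z. \<Sum>n. u n z)"
    using fin sn by (intro integrable_suminf i) auto
  let ?v = "\<lambda>z. \<Sum>n. u n z"
  have p: "(\<lambda>z. \<Sum>k<n. u k z) \<in> L1 M" for n using i by (simp add: L1_def)
  have vL: "?v \<in> L1 M" using v by (simp add: L1_def)
  have bound: "norm (emb M (\<lambda>z. \<Sum>k<n. u k z) - emb M ?v) \<le> (\<Sum>k. L1_norm M (u (k + n)))" for n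
  proof -
    have sn': "summable (\<lambda>k. LINT z|M. norm (u (k + n) z))"
      using sn by (rule summable_ignore_initial_segment)
    have fin': "AE z in M. summable (\<lambda>k. norm (norm (u (k + n) z)))"
      using fin
    proof eventually_elim
      fix z assume "summable (\<lambda>n. norm (u n z))"
      from summable_ignore_initial_segment[OF this, of n] show "summable (\<lambda>k. norm (norm (u (k + n) z)))"
        by simp
    qed
    have int': "integrable M (\<lambda>z. \<Sum>k. norm (u (k + n) z))"
      using fin' sn' i by (intro integrable_suminf) auto
    have "norm (emb M (\<lambda>z. \<Sum>k<n. u k z) - emb M ?v) = (LINT z|M. \<bar>(\<Sum>k<n. u k z) - ?v z\<bar>)"
      using norm_emb[OF L1_diff[OF p vL]] emb_diff[OF p vL] by (simp add: L1_norm_def)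
    also have "\<dots> \<le> (LINT z|M. (\<Sum>k. norm (u (k + n) z)))"
    proof (rule integral_mono_AE)
      show "integrable M (\<lambda>z. \<bar>(\<Sum>k<n. u k z) - ?v z\<bar>)" using L1_diff[OF p vL] by (simp add: L1_def)
      show "AE z in M. \<bar>(\<Sum>k<n. u k z) - ?v z\<bar> \<le> (\<Sum>k. norm (u (k + n) z))"
        using fin
      proof eventually_elim
        fix z assume z: "summable (\<lambda>n. norm (u n z))"
        have "(\<Sum>k<n. u k z) - ?v z = - (\<Sum>k. u (k + n) z)"
          using suminf_split_initial_segment[OF summable_norm_cancel[OF z], of n] by simp
        then show "\<bar>(\<Sum>k<n. u k z) - ?v z\<bar> \<le> (\<Sum>k. norm (u (k + n) z))"
          using summable_norm[of "\<lambda>k. u (k + n) z"] summable_ignore_initial_segment[OF z, of n] by simp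
      qed
    qed (rule int')
    also have "\<dots> = (\<Sum>k. (LINT z|M. norm (u (k + n) z)))"
      using fin' sn' i by (intro integral_suminf) auto
    finally show ?thesis by (simp add: L1_norm_def)
  qed
  have "(\<lambda>n. emb M (\<lambda>z. \<Sum>k<n. u k z) - emb M ?v) \<longlonglongrightarrow> 0"
    by (rule Lim_null_comparison[OF always_eventually[OF allI[OF bound]] suminf_exist_split2[OF s]])
  from LIM_zero_cancel[OF this] vL show ?thesis by (rule bexI)
qed

text \<open>A point of the closure is approached by elements within 2^(-n); their successive
  differences have summable norms, so \<open>L1_complete\<close> applied to the telescoping series
  produces a function with the given image.\<close>

lemma embX_closed: "closed (embX M)"
proof -
  have *: "x \<in> embX M" if x: "x \<in> closure (embX M)" for x
  proof -
    have "\<exists>u\<in>L1 M. dist (emb M u) x < (1 / 2) ^ n" for n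
      using x closure_approachable[of x "embX M"] by (metis imageE zero_less_power half_gt_zero zero_less_one)
    then obtain u where u: "\<And>n. u n \<in> L1 M" "\<And>n. dist (emb M (u n)) x < (1 / 2) ^ n" by metis
    let ?d = "\<lambda>n z. u (Suc n) z - u n z"
    have d: "?d n \<in> L1 M" for n using L1_diff u(1) by blast
    have le: "L1_norm M (?d n) \<le> 2 * (1 / 2) ^ n" for n
    proof -
      have "L1_norm M (?d n) = dist (emb M (u (Suc n))) (emb M (u n))"
        using norm_emb[OF d] emb_diff[OF u(1) u(1)] by (simp add: dist_norm)
      also have "\<dots> \<le> (1 / 2) ^ Suc n + (1 / 2) ^ n"
        using dist_triangle2[of "emb M (u (Suc n))" "emb M (u n)" x] u(2)[of n] u(2)[of "Suc n"] by linarith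
      also have "\<dots> \<le> 2 * (1 / 2) ^ n" by simp
      finally show ?thesis .
    qed
    have sg: "summable (\<lambda>n. 2 * (1 / 2) ^ n :: real)" by (intro summable_mult summable_geometric) simp
    have "summable (\<lambda>n. L1_norm M (?d n))"
      using summable_comparison_test'[OF sg, of 0 "\<lambda>n. L1_norm M (?d n)"] le L1_norm_nonneg[of M] by simp
    from L1_complete[OF d this] obtain v where v: "v \<in> L1 M"
        "(\<lambda>n. emb M (\<lambda>z. \<Sum>k<n. ?d k z)) \<longlonglongrightarrow> emb M v" by blast
    have "emb M (\<lambda>z. \<Sum>k<n. ?d k z) = emb M (u n) - emb M (u 0)" for n
      using emb_diff[OF u(1) u(1), of n 0] sum_lessThan_telescope[of "\<lambda>k. u k _" n] by simp
    then have "(\<lambda>n. emb M (u n) - emb M (u 0)) \<longlonglongrightarrow> emb M v" using v(2) by simp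
    then have "(\<lambda>n. emb M (u n)) \<longlonglongrightarrow> emb M v + emb M (u 0)"
      using tendsto_add[OF _ tendsto_const[of "emb M (u 0)"]] by fastforce
    moreover have "(\<lambda>n. emb M (u n)) \<longlonglongrightarrow> x"
    proof (rule metric_LIMSEQ_I)
      fix r :: real assume "0 < r"
      then obtain m where m: "(1 / 2) ^ m < r" using real_arch_pow_inv[of r "1 / 2"] by auto
      have "dist (emb M (u n)) x < r" if "n \<ge> m" for n
        using u(2)[of n] m power_decreasing[OF that, of "1 / 2 :: real"] by linarith
      then show "\<exists>no. \<forall>n\<ge>no. dist (emb M (u n)) x < r" by blast
    qed
    ultimately have "x = emb M v + emb M (u 0)" by (rule LIMSEQ_unique[rotated])
    then have "x = emb M (\<lambda>z. v z + u 0 z)" using emb_add[OF v(1) u(1)] by simp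
    moreover have "(\<lambda>z. v z + u 0 z) \<in> L1 M" using v(1) u(1)[of 0] by (simp add: L1_def)
    ultimately show ?thesis by blast
  qed
  have "closure (embX M) \<subseteq> embX M" by (rule subsetI) (rule *)
  then show ?thesis by (simp only: closure_subset_eq)
qed

text \<open>The negative part of u is bounded pointwise by |v - u| for any nonnegative v, so its
  norm is at most the distance from u to the cone, which is 0 in the closure.\<close>

lemma embP_closed: "closed (embP M)"
proof -
  have *: "x \<in> embP M" if x: "x \<in> closure (embP M)" for x
  proof -
    have "x \<in> closure (embX M)" using x closure_mono[of "embP M" "embX M"] by auto
    then obtain u where u: "u \<in> L1 M" "x = emb M u" using embX_closed[of M] by auto
    let ?n = "\<lambda>z. max 0 (- u z)"
    have n: "?n \<in> L1 M" using u(1) by (simp add: L1_def)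
    have le: "L1_norm M ?n \<le> 0 + e" if e: "0 < e" for e
    proof -
      obtain v where v: "v \<in> L1 M" "AE z in M. 0 \<le> v z" "dist (emb M v) x < e"
        using x e closure_approachable[of x "embP M"] by auto
      have "L1_norm M ?n \<le> L1_norm M (\<lambda>z. v z - u z)"
        unfolding L1_norm_def
      proof (rule integral_mono_AE)
        show "AE z in M. \<bar>?n z\<bar> \<le> \<bar>v z - u z\<bar>" using v(2) by eventually_elim auto
      qed (use n L1_diff[OF v(1) u(1)] in \<open>auto simp: L1_def\<close>)
      also have "\<dots> = dist (emb M v) x"
        using norm_emb[OF L1_diff[OF v(1) u(1)]] emb_diff[OF v(1) u(1)] u(2) by (simp add: dist_norm)
      finally show ?thesis using v(3) by simp
    qed
    have "L1_norm M ?n \<le> 0" by (rule field_le_epsilon) (rule le)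
    then have "L1_norm M ?n = 0" using L1_norm_nonneg[of M ?n] by simp
    then have "AE z in M. ?n z = 0" using L1_norm_eq_0[OF n] by blast
    then have "AE z in M. 0 \<le> u z"
      by (rule eventually_mono) (metis max.cobounded2 neg_le_0_iff_le)
    then show ?thesis using emb_nonneg_iff[OF u(1)] u(2) by simp
  qed
  have "closure (embP M) \<subseteq> embP M" by (rule subsetI) (rule *)
  then show ?thesis by (simp only: closure_subset_eq)
qed

lemma al_cone_L1: "al_cone (embX M) (embP M)"
proof
  show "subspace (embX M)"
  proof (rule subspaceI)
    show "0 \<in> embX M" using emb_0[of M] zero_L1 by (metis image_eqI)
    show "x + y \<in> embX M" if "x \<in> embX M" "y \<in> embX M" for x y
    proof -
      obtain u v where "u \<in> L1 M" "v \<in> L1 M" "x = emb M u" "y = emb M v" using \<open>x \<in> _\<close> \<open>y \<in> _\<close> by auto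
      then show ?thesis using emb_add[of u M v] L1_lin[of u M v 1 1] by (simp add: image_iff) metis
    qed
    show "c *\<^sub>R x \<in> embX M" if "x \<in> embX M" for c x
    proof -
      obtain u where u: "u \<in> L1 M" "x = emb M u" using \<open>x \<in> _\<close> by auto
      then have "(\<lambda>z. c * u z) \<in> L1 M" by (simp add: L1_def)
      then show ?thesis using emb_scale[OF u(1), of c] u(2) by (metis image_eqI)
    qed
  qed
  show "closed (embX M)" by (rule embX_closed)
  show "embP M \<subseteq> embX M" by auto
  show "closed (embP M)" by (rule embP_closed)
  show "0 \<in> embP M" using emb_nonneg_iff[OF zero_L1, of M] emb_0[of M] by simp
  show "x + y \<in> embP M" if "x \<in> embP M" "y \<in> embP M" for x y
  proof -
    obtain u v where uv: "u \<in> L1 M" "v \<in> L1 M" "x = emb M u" "y = emb M v"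
        "AE z in M. 0 \<le> u z" "AE z in M. 0 \<le> v z" using \<open>x \<in> _\<close> \<open>y \<in> _\<close> by auto
    have "AE z in M. 0 \<le> u z + v z" using uv(5,6) by eventually_elim simp
    then have "emb M (\<lambda>z. u z + v z) \<in> embP M"
      using emb_nonneg_iff[of "\<lambda>z. u z + v z" M] uv(1,2) L1_lin[of u M v 1 1] by simp
    then show ?thesis by (simp only: uv(3,4) emb_add[OF uv(1,2)])
  qed
  show "c *\<^sub>R x \<in> embP M" if "0 \<le> c" "x \<in> embP M" for c x
  proof -
    obtain u where u: "u \<in> L1 M" "x = emb M u" "AE z in M. 0 \<le> u z" using \<open>x \<in> _\<close> by auto
    have "AE z in M. 0 \<le> c * u z" using u(3) by eventually_elim (use \<open>0 \<le> c\<close> in simp)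
    then have "emb M (\<lambda>z. c * u z) \<in> embP M"
      using emb_nonneg_iff[of "\<lambda>z. c * u z" M] u(1) L1_lin[of u M u c 0] by simp
    then show ?thesis by (simp only: u(2) emb_scale[OF u(1)])
  qed
  show "norm (x + y) = norm x + norm y" if "x \<in> embP M" "y \<in> embP M" for x y
  proof -
    obtain u v where uv: "u \<in> L1 M" "v \<in> L1 M" "x = emb M u" "y = emb M v"
        "AE z in M. 0 \<le> u z" "AE z in M. 0 \<le> v z" using \<open>x \<in> _\<close> \<open>y \<in> _\<close> by auto
    have s: "(\<lambda>z. u z + v z) \<in> L1 M" using uv(1,2) by (simp add: L1_def)
    have "norm (x + y) = (LINT z|M. \<bar>u z + v z\<bar>)"
      using emb_add[OF uv(1,2)] uv(3,4) norm_emb[OF s] by (simp add: L1_norm_def)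
    also have "\<dots> = (LINT z|M. \<bar>u z\<bar> + \<bar>v z\<bar>)"
    proof (rule integral_cong_AE)
      show "AE z in M. \<bar>u z + v z\<bar> = \<bar>u z\<bar> + \<bar>v z\<bar>" using uv(5,6) by eventually_elim simp
    qed (use uv(1,2) in \<open>auto simp: L1_def\<close>)
    also have "\<dots> = norm x + norm y"
      unfolding uv(3,4) norm_emb[OF uv(1)] norm_emb[OF uv(2)] L1_norm_def
      using uv(1,2) by (intro Bochner_Integration.integral_add) (auto simp: L1_def)
    finally show ?thesis .
  qed
  show "\<exists>a\<in>embP M. \<exists>b\<in>embP M. x = a - b \<and> norm x = norm a + norm b" if "x \<in> embX M" for x
  proof -
    obtain u where u: "u \<in> L1 M" "x = emb M u" using \<open>x \<in> _\<close> by auto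
    let ?p = "\<lambda>z. max 0 (u z)" and ?n = "\<lambda>z. max 0 (- u z)"
    have pn: "?p \<in> L1 M" "?n \<in> L1 M" using u(1) by (simp_all add: L1_def)
    have "(\<lambda>z. ?p z - ?n z) = u" by auto
    then have "x = emb M ?p - emb M ?n" using emb_diff[OF pn] u(2) by simp
    moreover have "norm x = norm (emb M ?p) + norm (emb M ?n)"
    proof -
      have "norm x = (LINT z|M. \<bar>?p z\<bar> + \<bar>?n z\<bar>)"
        using norm_emb[OF u(1)] u(2) unfolding L1_norm_def
        by (simp, intro Bochner_Integration.integral_cong) auto
      also have "\<dots> = norm (emb M ?p) + norm (emb M ?n)"
        unfolding norm_emb[OF pn(1)] norm_emb[OF pn(2)] L1_norm_def
        using pn by (intro Bochner_Integration.integral_add) (auto simp: L1_def)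
      finally show ?thesis .
    qed
    moreover have "emb M ?p \<in> embP M" "emb M ?n \<in> embP M" using emb_nonneg_iff pn by auto
    ultimately show ?thesis by blast
  qed
qed

section \<open>Semigroups on L1 and on its embedding\<close>

text \<open>\<open>S\<close> and \<open>G\<close> are related only along the orbit of the one
  function u. The equivalence therefore serves both the lift of a given semigroup and a semigroup on
  functions read off from one on the embedding.\<close>

lemma gen_emb_iff:
  assumes S: "\<And>h. 0 < h \<Longrightarrow> G h u \<in> L1 M \<and> S h (emb M u) = emb M (G h u)"
    and u: "u \<in> L1 M" and v: "v \<in> L1 M"
  shows "(emb M u, emb M v) \<in> al_cone.gen (embX M) S \<longleftrightarrow> right_derivative_at_0 M G u v"
proof -
  interpret al_cone "embX M" "embP M" by (rule al_cone_L1)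
  have eq: "norm ((S h (emb M u) - emb M u) /\<^sub>R h - emb M v) = L1_norm M (\<lambda>z. (G h u z - u z) / h - v z)"
    if h: "0 < h" for h
  proof -
    have G: "G h u \<in> L1 M" and Se: "S h (emb M u) = emb M (G h u)" using S[OF h] by auto
    have d: "(\<lambda>z. G h u z - u z) \<in> L1 M" using L1_diff[OF G u] .
    have d': "(\<lambda>z. inverse h * (G h u z - u z)) \<in> L1 M" using L1_lin[OF d d, of "inverse h" 0] by simp
    have "(S h (emb M u) - emb M u) /\<^sub>R h - emb M v = emb M (\<lambda>z. inverse h * (G h u z - u z) - v z)"
      by (simp only: Se emb_diff[OF d' v] emb_scale[OF d] emb_diff[OF G u])
    also have "norm \<dots> = L1_norm M (\<lambda>z. inverse h * (G h u z - u z) - v z)"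
      by (rule norm_emb[OF L1_diff[OF d' v]])
    finally show ?thesis by (simp add: divide_inverse mult.commute)
  qed
  have "((\<lambda>h. (S h (emb M u) - emb M u) /\<^sub>R h) \<longlongrightarrow> emb M v) (at_right 0) \<longleftrightarrow>
      ((\<lambda>h. norm ((S h (emb M u) - emb M u) /\<^sub>R h - emb M v)) \<longlongrightarrow> 0) (at_right 0)"
    by (simp add: tendsto_norm_zero_iff LIM_zero_iff)
  also have "\<dots> \<longleftrightarrow> ((\<lambda>h. L1_norm M (\<lambda>z. (G h u z - u z) / h - v z)) \<longlongrightarrow> 0) (at_right 0)"
    by (rule tendsto_cong) (rule eventually_mono[OF eventually_at_right_less eq])
  finally show ?thesis
    using u v by (simp add: gen_def right_derivative_at_0_def)
qed

definition lift_sg :: "'a measure \<Rightarrow> (real \<Rightarrow> ('a \<Rightarrow> real) \<Rightarrow> 'a \<Rightarrow> real) \<Rightarrow> real \<Rightarrow>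
    (('a \<Rightarrow> real) discrete \<Rightarrow>\<^sub>C real) \<Rightarrow> (('a \<Rightarrow> real) discrete \<Rightarrow>\<^sub>C real)" where
  "lift_sg M G t x = emb M (G t (rep M x))"

context
  fixes M :: "'a measure" and G :: "real \<Rightarrow> ('a \<Rightarrow> real) \<Rightarrow> 'a \<Rightarrow> real"
  assumes sub: "substochastic M G"
begin

lemma G_L1: "0 \<le> t \<Longrightarrow> u \<in> L1 M \<Longrightarrow> G t u \<in> L1 M"
  using sub by (simp add: substochastic_def positive_semigroup_def C0_semigroup_def)

lemma G_lin:
  assumes t: "0 \<le> t" and u: "u \<in> L1 M" and v: "v \<in> L1 M"
  shows "emb M (G t (\<lambda>y. c * u y + d * v y)) = c *\<^sub>R emb M (G t u) + d *\<^sub>R emb M (G t v)"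
proof -
  have "AE z in M. G t (\<lambda>y. c * u y + d * v y) z = c * G t u z + d * G t v z"
    using sub assms by (simp add: substochastic_def positive_semigroup_def C0_semigroup_def)
  then have "emb M (G t (\<lambda>y. c * u y + d * v y)) = emb M (\<lambda>z. c * G t u z + d * G t v z)"
    using emb_eq_iff[OF G_L1[OF t L1_lin[OF u v]] L1_lin[OF G_L1[OF t u] G_L1[OF t v]]] by simp
  also have "\<dots> = c *\<^sub>R emb M (G t u) + d *\<^sub>R emb M (G t v)"
    by (rule emb_lin[OF G_L1[OF t u] G_L1[OF t v]])
  finally show ?thesis .
qed

lemma G_norm: "0 \<le> t \<Longrightarrow> u \<in> L1 M \<Longrightarrow> norm (emb M (G t u)) \<le> norm (emb M u)"
  using sub by (simp add: norm_emb G_L1 substochastic_def)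

text \<open>Independence of the representative: the chosen one differs from u by an element of norm
  0, and \<open>G t\<close> is linear almost everywhere and contractive, so the images differ by
  norm 0 as well.\<close>

lemma lift_sg_emb:
  assumes t: "0 \<le> t" and u: "u \<in> L1 M"
  shows "lift_sg M G t (emb M u) = emb M (G t u)"
proof -
  let ?v = "rep M (emb M u)"
  have v: "?v \<in> L1 M" "emb M ?v = emb M u" using rep[of "emb M u" M] u by auto
  have "norm (emb M (G t ?v) - emb M (G t u)) \<le> norm (emb M (\<lambda>y. 1 * ?v y + (- 1) * u y))"
    using G_norm[OF t L1_lin[OF v(1) u], of 1 "- 1"] G_lin[OF t v(1) u, of 1 "- 1"] by simp
  also have "emb M (\<lambda>y. 1 * ?v y + (- 1) * u y) = 0"
    unfolding emb_lin[OF v(1) u] using v(2) by simp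
  finally show ?thesis by (simp add: lift_sg_def)
qed

lemma lift_sg_semigroup: "al_cone.pc_semigroup (embX M) (embP M) (lift_sg M G)"
proof -
  interpret al_cone "embX M" "embP M" by (rule al_cone_L1)
  note le = lift_sg_emb
  show ?thesis
    unfolding pc_semigroup_def
  proof (intro conjI allI ballI impI)
    fix t :: real assume t: "0 \<le> t"
    show "pcontr (lift_sg M G t)"
      unfolding pcontr_def lin_op_def
    proof (intro conjI ballI allI)
      fix x assume "x \<in> embX M"
      then obtain u where u: "u \<in> L1 M" "x = emb M u" by auto
      show "lift_sg M G t x \<in> embX M" using le[OF t u(1)] u G_L1[OF t u(1)] by simp
      show "norm (lift_sg M G t x) \<le> norm x" using le[OF t u(1)] G_norm[OF t u(1)] u(2) by simp
      show "lift_sg M G t (c *\<^sub>R x) = c *\<^sub>R lift_sg M G t x" for c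
        using le[OF t L1_lin[OF u(1) u(1), of c 0]] le[OF t u(1)] G_lin[OF t u(1) u(1), of c 0]
          emb_scale[OF u(1), of c] u(2) by simp
      fix y assume "y \<in> embX M"
      then obtain v where v: "v \<in> L1 M" "y = emb M v" by auto
      show "lift_sg M G t (x + y) = lift_sg M G t x + lift_sg M G t y"
        using le[OF t L1_lin[OF u(1) v(1), of 1 1]] le[OF t u(1)] le[OF t v(1)]
          G_lin[OF t u(1) v(1), of 1 1] emb_add[OF u(1) v(1)] u(2) v(2) by simp
    next
      fix x assume "x \<in> embP M"
      then obtain u where u: "u \<in> L1 M" "x = emb M u" "AE z in M. 0 \<le> u z" by auto
      have "AE z in M. 0 \<le> G t u z"
        using sub t u by (simp add: substochastic_def positive_semigroup_def)
      then show "lift_sg M G t x \<in> embP M"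
        using le[OF t u(1)] u(2) emb_nonneg_iff[OF G_L1[OF t u(1)]] by simp
    qed
  next
    fix x assume "x \<in> embX M"
    then obtain u where u: "u \<in> L1 M" "x = emb M u" by auto
    have "AE z in M. G 0 u z = u z"
      using sub u(1) by (simp add: substochastic_def positive_semigroup_def C0_semigroup_def)
    then show "lift_sg M G 0 x = x"
      using le[OF order_refl u(1)] emb_eq_iff[OF G_L1[OF order_refl u(1)] u(1)] u(2) by simp
  next
    fix s t :: real and x assume s: "0 \<le> s" and t: "0 \<le> t" and "x \<in> embX M"
    then obtain u where u: "u \<in> L1 M" "x = emb M u" by auto
    have Gt: "G t u \<in> L1 M" using G_L1[OF t u(1)] .
    have st: "0 \<le> s + t" using s t by simp
    have "AE z in M. G (s + t) u z = G s (G t u) z"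
      using sub u(1) s t by (simp add: substochastic_def positive_semigroup_def C0_semigroup_def)
    then have "emb M (G (s + t) u) = emb M (G s (G t u))"
      using emb_eq_iff[OF G_L1[OF st u(1)] G_L1[OF s Gt]] by simp
    then show "lift_sg M G (s + t) x = lift_sg M G s (lift_sg M G t x)"
      using le[OF st u(1)] le[OF t u(1)] le[OF s Gt] u(2) by simp
  next
    fix x assume "x \<in> embX M"
    then obtain u where u: "u \<in> L1 M" "x = emb M u" by auto
    have "((\<lambda>t. L1_norm M (\<lambda>z. G t u z - u z)) \<longlongrightarrow> 0) (at_right 0)"
      using sub u(1) by (simp add: substochastic_def positive_semigroup_def C0_semigroup_def)
    then have "((\<lambda>t. norm (lift_sg M G t x - x)) \<longlongrightarrow> 0) (at_right 0)"
    proof (rule Lim_transform_eventually, intro eventually_mono[OF eventually_at_right_less])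
      fix t :: real assume t: "0 < t"
      then have Gt: "G t u \<in> L1 M" using G_L1 u(1) by simp
      show "L1_norm M (\<lambda>z. G t u z - u z) = norm (lift_sg M G t x - x)"
        using le[OF _ u(1), of t] t u(2) emb_diff[OF Gt u(1)] norm_emb[OF L1_diff[OF Gt u(1)]] by simp
    qed
    then show "((\<lambda>t. lift_sg M G t x) \<longlongrightarrow> x) (at_right 0)"
      by (simp add: tendsto_norm_zero_iff LIM_zero_iff)
  qed
qed

lemma lift_sg_gen:
  assumes "u \<in> L1 M" "v \<in> L1 M"
  shows "(emb M u, emb M v) \<in> al_cone.gen (embX M) (lift_sg M G) \<longleftrightarrow> right_derivative_at_0 M G u v"
  using assms lift_sg_emb G_L1 by (intro gen_emb_iff) auto

end

text \<open>The contraction class is left here: the semigroup on functions picks representatives of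
  the rescaled orbits and has bound exp(c t). The hypothesis on D is an equality, since a generator
  in the required sense has the whole set of right-differentiable points as its domain; K only has
  to select a representative of the derivative.\<close>

lemma generates_positive_semigroupI:
  assumes S: "al_cone.pc_semigroup (embX M) (embP M) S"
    and D: "D = {u \<in> L1 M. \<exists>y. (emb M u, y) \<in> al_cone.gen (embX M) (al_cone.rescale c S)}"
    and K: "\<And>u. u \<in> D \<Longrightarrow> K u \<in> L1 M \<and> (emb M u, emb M (K u)) \<in> al_cone.gen (embX M) (al_cone.rescale c S)"
  shows "generates_positive_semigroup M K D"
proof -
  interpret al_cone "embX M" "embP M" by (rule al_cone_L1)
  let ?R = "rescale c S"
  define G where "G t u = rep M (?R t (emb M u))" for t u
  note Sp = pc_semigroupD(1)[OF S]
  have RX: "?R t (emb M u) \<in> embX M" if "0 \<le> t" "u \<in> L1 M" for t u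
    unfolding rescale_def by (rule X_scale[OF pcontr_X[OF Sp[OF that(1)]]]) (use that in blast)
  have G: "G t u \<in> L1 M" "emb M (G t u) = ?R t (emb M u)" if "0 \<le> t" "u \<in> L1 M" for t u
    using rep[OF RX[OF that]] by (simp_all add: G_def)
  have R_tendsto: "((\<lambda>t. ?R t x) \<longlongrightarrow> x) (at_right 0)" if "x \<in> embX M" for x
    by (rule rescale_tendsto) (rule pc_semigroupD(4)[OF S that])
  have "C0_semigroup M G"
    unfolding C0_semigroup_def
  proof (intro conjI allI ballI impI)
    fix t :: real and u assume t: "0 \<le> t" and u: "u \<in> L1 M"
    show "G t u \<in> L1 M" using G(1)[OF t u] .
    fix v c' d assume v: "v \<in> L1 M"
    note L = pcontrD(1)[OF Sp[OF t]]
    have X: "emb M u \<in> embX M" "emb M v \<in> embX M" using u v by auto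
    have "emb M (G t (\<lambda>y. c' * u y + d * v y)) = ?R t (c' *\<^sub>R emb M u + d *\<^sub>R emb M v)"
      unfolding G(2)[OF t L1_lin[OF u v]] emb_lin[OF u v] by simp
    also have "\<dots> = c' *\<^sub>R ?R t (emb M u) + d *\<^sub>R ?R t (emb M v)"
      unfolding rescale_def using lin_opD(2)[OF L X_scale[OF X(1)] X_scale[OF X(2)]]
        lin_opD(3)[OF L X(1)] lin_opD(3)[OF L X(2)] by (simp add: scaleR_add_right mult.commute)
    also have "\<dots> = emb M (\<lambda>z. c' * G t u z + d * G t v z)"
      using emb_lin[OF G(1)[OF t u] G(1)[OF t v]] G(2)[OF t u] G(2)[OF t v] by simp
    finally show "AE z in M. G t (\<lambda>y. c' * u y + d * v y) z = c' * G t u z + d * G t v z"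
      using emb_eq_iff[OF G(1)[OF t L1_lin[OF u v]] L1_lin[OF G(1)[OF t u] G(1)[OF t v]]] by blast
  next
    fix t :: real assume t: "0 \<le> t"
    have "L1_norm M (G t u) \<le> exp (c * t) * L1_norm M u" if u: "u \<in> L1 M" for u
    proof -
      have "emb M u \<in> embX M" using u by blast
      from pcontrD(3)[OF Sp[OF t] this] have "norm (?R t (emb M u)) \<le> exp (c * t) * norm (emb M u)"
        by (simp add: rescale_def)
      then show ?thesis using norm_emb[OF u] norm_emb[OF G(1)[OF t u]] G(2)[OF t u] by simp
    qed
    then show "\<exists>C. \<forall>u\<in>L1 M. L1_norm M (G t u) \<le> C * L1_norm M u" by blast
  next
    fix u assume u: "u \<in> L1 M"
    have X: "emb M u \<in> embX M" using u by blast
    have "emb M (G 0 u) = emb M u"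
      using G(2)[OF order_refl u] pc_semigroupD(2)[OF S X] by (simp add: rescale_def)
    then show "AE z in M. G 0 u z = u z" using emb_eq_iff[OF G(1)[OF order_refl u] u] by blast
    show "((\<lambda>t. L1_norm M (\<lambda>z. G t u z - u z)) \<longlongrightarrow> 0) (at_right 0)"
    proof (rule Lim_transform_eventually)
      show "((\<lambda>t. norm (?R t (emb M u) - emb M u)) \<longlongrightarrow> 0) (at_right 0)"
        using R_tendsto[OF X] by (simp add: LIM_zero tendsto_norm_zero)
      show "\<forall>\<^sub>F t in at_right 0. norm (?R t (emb M u) - emb M u) = L1_norm M (\<lambda>z. G t u z - u z)"
      proof (rule eventually_mono[OF eventually_at_right_less])
        fix t :: real assume "0 < t"
        then have t: "0 \<le> t" by simp
        show "norm (?R t (emb M u) - emb M u) = L1_norm M (\<lambda>z. G t u z - u z)"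
          using norm_emb[OF L1_diff[OF G(1)[OF t u] u]] emb_diff[OF G(1)[OF t u] u] G(2)[OF t u] by simp
      qed
    qed
  next
    fix s t :: real and u assume s: "0 \<le> s" and t: "0 \<le> t" and u: "u \<in> L1 M"
    have X: "emb M u \<in> embX M" using u by blast
    have st: "0 \<le> s + t" using s t by simp
    have "emb M (G s (G t u)) = ?R s (?R t (emb M u))"
      using G(2)[OF s G(1)[OF t u]] G(2)[OF t u] by simp
    also have "\<dots> = ?R (s + t) (emb M u)"
      using pc_semigroupD(3)[OF S s t X] lin_opD(3)[OF pcontrD(1)[OF Sp[OF s]] pcontr_X[OF Sp[OF t] X]]
      by (simp add: rescale_def distrib_left exp_add)
    finally show "AE z in M. G (s + t) u z = G s (G t u) z"
      using emb_eq_iff[OF G(1)[OF st u] G(1)[OF s G(1)[OF t u]]] G(2)[OF st u] by simp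
  qed
  moreover have "AE z in M. 0 \<le> G t u z" if t: "0 \<le> t" and u: "u \<in> L1 M" "AE z in M. 0 \<le> u z" for t u
  proof -
    have "emb M u \<in> embP M" using emb_nonneg_iff[OF u(1)] u(2) by blast
    then have "?R t (emb M u) \<in> embP M"
      unfolding rescale_def by (intro P_scale pcontrD(2)[OF Sp[OF t]]) simp_all
    then show ?thesis using emb_nonneg_iff[OF G(1)[OF t u(1)]] G(2)[OF t u(1)] by simp
  qed
  ultimately have pos: "positive_semigroup M G" by (simp add: positive_semigroup_def)
  have iff: "(emb M u, emb M v) \<in> gen ?R \<longleftrightarrow> right_derivative_at_0 M G u v"
    if "u \<in> L1 M" "v \<in> L1 M" for u v
    using G that by (intro gen_emb_iff) auto
  have ex: "(\<exists>y. (emb M u, y) \<in> gen ?R) \<longleftrightarrow> (\<exists>v. right_derivative_at_0 M G u v)" if u: "u \<in> L1 M" for u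
  proof
    assume "\<exists>y. (emb M u, y) \<in> gen ?R"
    then obtain y where y: "(emb M u, y) \<in> gen ?R" by blast
    then obtain v where "v \<in> L1 M" "y = emb M v" using genD(2) by blast
    then show "\<exists>v. right_derivative_at_0 M G u v" using iff[OF u] y by blast
  next
    assume "\<exists>v. right_derivative_at_0 M G u v"
    then obtain v where v: "right_derivative_at_0 M G u v" by blast
    then have "v \<in> L1 M" by (simp add: right_derivative_at_0_def)
    then show "\<exists>y. (emb M u, y) \<in> gen ?R" using iff[OF u] v by blast
  qed
  have "is_generator M G K D"
    unfolding is_generator_def
  proof (intro conjI ballI)
    show "D = {u \<in> L1 M. \<exists>v. right_derivative_at_0 M G u v}" unfolding D using ex by blast
    fix u assume u: "u \<in> D"
    then have "u \<in> L1 M" unfolding D by blast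
    then show "right_derivative_at_0 M G u (K u)" using iff K[OF u] by blast
  qed
  with pos show ?thesis unfolding generates_positive_semigroup_def by blast
qed

section \<open>Absorption and perturbation on L1\<close>

text \<open>The multiplication by q is not assumed to commute with \<open>G\<close>; only the
  indicators of the sets \<open>E n\<close> are, and q is bounded on each of them. \<open>B\<close>
  is given on representatives, so its linearity is an almost everywhere statement.\<close>

locale L1_perturbation =
  fixes M :: "'a measure" and G :: "real \<Rightarrow> ('a \<Rightarrow> real) \<Rightarrow> 'a \<Rightarrow> real"
    and T :: "('a \<Rightarrow> real) \<Rightarrow> 'a \<Rightarrow> real" and D :: "('a \<Rightarrow> real) set"
    and q :: "'a \<Rightarrow> real" and E :: "nat \<Rightarrow> 'a set" and N :: "nat \<Rightarrow> real"
    and B :: "('a \<Rightarrow> real) \<Rightarrow> 'a \<Rightarrow> real" and C :: real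
  assumes G: "substochastic M G" and T: "is_generator M G T D"
    and q_meas: "q \<in> borel_measurable M" and q_nonneg: "AE z in M. 0 \<le> q z"
    and E_sets: "E n \<in> sets M" and E_disj: "disjoint_family E"
    and E_cover: "space M \<subseteq> (\<Union>n. E n)"
    and q_bound: "AE z in M. z \<in> E n \<longrightarrow> q z \<le> N n"
    and G_E: "0 \<le> t \<Longrightarrow> u \<in> L1 M \<Longrightarrow>
      AE z in M. G t (\<lambda>y. indicator (E n) y * u y) z = indicator (E n) z * G t u z"
    and B_L1: "u \<in> L1 M \<Longrightarrow> (\<lambda>z. q z * u z) \<in> L1 M \<Longrightarrow> B u \<in> L1 M"
    and B_lin: "u \<in> L1 M \<Longrightarrow> (\<lambda>z. q z * u z) \<in> L1 M \<Longrightarrow> v \<in> L1 M \<Longrightarrow> (\<lambda>z. q z * v z) \<in> L1 M \<Longrightarrow>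
      AE z in M. B (\<lambda>y. c * u y + d * v y) z = c * B u z + d * B v z"
    and B_nonneg: "u \<in> L1 M \<Longrightarrow> (\<lambda>z. q z * u z) \<in> L1 M \<Longrightarrow> (AE z in M. 0 \<le> u z) \<Longrightarrow>
      AE z in M. 0 \<le> B u z"
    and C: "0 \<le> C"
    and B_norm: "u \<in> L1 M \<Longrightarrow> (\<lambda>z. q z * u z) \<in> L1 M \<Longrightarrow>
      L1_norm M (B u) \<le> 1 / 2 * L1_norm M (\<lambda>z. q z * u z) + C * L1_norm M u"
begin

text \<open>The shift of the absorption rate by \<open>2 * C\<close> makes the bound on \<open>B\<close> homogeneous; it is undone
  by rescaling the semigroup.\<close>

definition q' :: "'a \<Rightarrow> real" where
  "q' z = q z + 2 * C"

abbreviation Dq :: "('a \<Rightarrow> real) set" where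
  "Dq \<equiv> {u \<in> L1 M. (\<lambda>z. q z * u z) \<in> L1 M}"

abbreviation slice :: "nat \<Rightarrow> ('a \<Rightarrow> real) \<Rightarrow> 'a \<Rightarrow> real" where
  "slice n u \<equiv> (\<lambda>z. indicator (E n) z * u z)"

abbreviation "mult_q u \<equiv> (\<lambda>z. q' z * u z)"

section \<open>The multiplication operator and its slices on classes of functions\<close>

lemma Dq_mult: "u \<in> Dq \<Longrightarrow> mult_q u \<in> L1 M"
  using L1_lin[of "\<lambda>z. q z * u z" M u 1 "2 * C"] by (simp add: q'_def algebra_simps)

lemma Dq_iff:
  assumes u: "u \<in> L1 M"
  shows "u \<in> Dq \<longleftrightarrow> mult_q u \<in> L1 M"
proof
  assume "mult_q u \<in> L1 M"
  from L1_lin[OF this u, of 1 "- 2 * C"] have "(\<lambda>z. q z * u z) \<in> L1 M"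
    by (simp add: q'_def algebra_simps)
  with u show "u \<in> Dq" by simp
qed (rule Dq_mult)

lemma Dq_lin: "u \<in> Dq \<Longrightarrow> v \<in> Dq \<Longrightarrow> (\<lambda>z. c * u z + d * v z) \<in> Dq"
  using L1_lin[of "\<lambda>z. q z * u z" M "\<lambda>z. q z * v z" c d] L1_lin[of u M v c d]
  by (simp add: algebra_simps)

lemma q'_nonneg: "AE z in M. 0 \<le> q' z"
  using q_nonneg by eventually_elim (use C in \<open>simp add: q'_def\<close>)

lemma q'_meas: "q' \<in> borel_measurable M"
  unfolding q'_def[abs_def] using q_meas by measurable

lemma slice_L1: "u \<in> L1 M \<Longrightarrow> slice n u \<in> L1 M"
  using integrable_real_mult_indicator[OF E_sets, of u n] by (simp add: L1_def mult.commute)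

text \<open>The absolute value secures nonnegativity, because on a null set \<open>E n\<close> the
  bound \<open>N n\<close> could be any number; 2 * C accounts for the shift from q to
  \<open>q'\<close>.\<close>

definition N' :: "nat \<Rightarrow> real" where
  "N' n = \<bar>N n\<bar> + 2 * C"

lemma N'_nonneg: "0 \<le> N' n"
  using C by (simp add: N'_def)

lemma slice_q_bound: "AE z in M. 0 \<le> indicator (E n) z * q' z \<and> indicator (E n) z * q' z \<le> N' n * indicator (E n) z"
  using q'_nonneg q_bound[of n]
  by eventually_elim (auto simp: indicator_def N'_def q'_def)

lemma slice_q_L1:
  assumes u: "u \<in> L1 M"
  shows "slice n (mult_q u) \<in> L1 M"
proof -
  have "integrable M (slice n (mult_q u))"
  proof (rule Bochner_Integration.integrable_bound)
    show "integrable M (\<lambda>z. N' n * u z)" using u by (simp add: L1_def)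
    show "slice n (mult_q u) \<in> borel_measurable M"
      using q'_meas E_sets u by (auto simp: L1_def)
    show "AE z in M. norm (slice n (mult_q u) z) \<le> norm (N' n * u z)"
      using slice_q_bound[of n]
    proof eventually_elim
      fix z assume z: "0 \<le> indicator (E n) z * q' z \<and> indicator (E n) z * q' z \<le> N' n * indicator (E n) z"
      have "norm (slice n (mult_q u) z) = (indicator (E n) z * q' z) * \<bar>u z\<bar>"
        using z by (simp only: real_norm_def mult.assoc[symmetric] abs_mult[of _ "u z"] abs_of_nonneg)
      also have "\<dots> \<le> N' n * \<bar>u z\<bar>"
        using z N'_nonneg[of n] by (intro mult_right_mono) (auto simp: indicator_def split: if_splits)
      finally show "norm (slice n (mult_q u) z) \<le> norm (N' n * u z)"
        using N'_nonneg[of n] by (simp add: abs_mult)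
    qed
  qed
  then show ?thesis by (simp add: L1_def)
qed

lemma emb_cong:
  "u \<in> L1 M \<Longrightarrow> v \<in> L1 M \<Longrightarrow> AE z in M. u z = v z \<Longrightarrow> emb M u = emb M v"
  using emb_eq_iff by blast

abbreviation "pr n x \<equiv> emb M (slice n (rep M x))"
abbreviation "Wr n x \<equiv> emb M (slice n (mult_q (rep M x)))"
abbreviation "Br x \<equiv> emb M (B (rep M x))"
abbreviation "Qr \<equiv> {(emb M u, emb M (mult_q u)) | u. u \<in> L1 M \<and> mult_q u \<in> L1 M}"

lemma pr_emb:
  assumes "u \<in> L1 M" shows "pr n (emb M u) = emb M (slice n u)"
  using rep_emb[OF assms]
  by (intro emb_cong slice_L1 assms) (auto elim: eventually_mono)

lemma Wr_emb:
  assumes "u \<in> L1 M" shows "Wr n (emb M u) = emb M (slice n (mult_q u))"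
  using rep_emb[OF assms]
  by (intro emb_cong slice_q_L1 assms) (auto elim: eventually_mono)

lemma B_bound':
  assumes u: "u \<in> Dq"
  shows "norm (emb M (B u)) \<le> 1 / 2 * norm (emb M (mult_q u))"
proof -
  have uL: "u \<in> L1 M" and qu: "(\<lambda>z. q z * u z) \<in> L1 M" using u by auto
  have "norm (emb M (mult_q u)) = (LINT z|M. \<bar>q' z * u z\<bar>)"
    using norm_emb[OF Dq_mult[OF u]] by (simp add: L1_norm_def)
  also have "\<dots> = (LINT z|M. \<bar>q z * u z\<bar> + 2 * C * \<bar>u z\<bar>)"
  proof (rule integral_cong_AE)
    show "AE z in M. \<bar>q' z * u z\<bar> = \<bar>q z * u z\<bar> + 2 * C * \<bar>u z\<bar>"
      using q_nonneg
    proof eventually_elim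
      fix z assume z: "0 \<le> q z"
      have "\<bar>q' z * u z\<bar> = q' z * \<bar>u z\<bar>" using z C by (simp add: q'_def abs_mult)
      also have "\<dots> = \<bar>q z * u z\<bar> + 2 * C * \<bar>u z\<bar>"
        using z by (simp add: q'_def abs_mult algebra_simps)
      finally show "\<bar>q' z * u z\<bar> = \<bar>q z * u z\<bar> + 2 * C * \<bar>u z\<bar>" .
    qed
  qed (use uL qu q'_meas in \<open>auto simp: L1_def\<close>)
  also have "\<dots> = L1_norm M (\<lambda>z. q z * u z) + 2 * C * L1_norm M u"
    unfolding L1_norm_def using uL qu
    by (subst Bochner_Integration.integral_add) (auto simp: L1_def)
  finally show ?thesis using B_norm[OF uL qu] norm_emb[OF B_L1[OF uL qu]] by simp
qed

lemma emb_B_lin: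
  assumes u: "u \<in> Dq" and v: "v \<in> Dq"
  shows "emb M (B (\<lambda>z. c * u z + d * v z)) = c *\<^sub>R emb M (B u) + d *\<^sub>R emb M (B v)"
proof -
  have L: "B u \<in> L1 M" "B v \<in> L1 M" "B (\<lambda>z. c * u z + d * v z) \<in> L1 M"
    using B_L1 u v Dq_lin[OF u v, of c d] by auto
  have "emb M (B (\<lambda>z. c * u z + d * v z)) = emb M (\<lambda>z. c * B u z + d * B v z)"
    using u v by (intro emb_cong L(3) L1_lin L(1,2) B_lin) auto
  then show ?thesis using emb_lin[OF L(1,2)] by simp
qed

text \<open>Invariance of \<open>B\<close> under almost everywhere equality is derived, not assumed:
  the difference of two representatives is again in the domain, its product with \<open>q'\<close>
  has norm 0, and the relative bound then annihilates its image.\<close>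

lemma Br_emb:
  assumes u: "u \<in> Dq"
  shows "Br (emb M u) = emb M (B u)"
proof -
  have uL: "u \<in> L1 M" using u by auto
  let ?v = "rep M (emb M u)"
  have v: "?v \<in> L1 M" "AE z in M. ?v z = u z" using rep_emb[OF uL] by auto
  have "(\<lambda>z. q z * ?v z) \<in> L1 M"
  proof -
    have m: "(\<lambda>z. q z * ?v z) \<in> borel_measurable M" "(\<lambda>z. q z * u z) \<in> borel_measurable M"
      using q_meas v(1) u by (auto simp: L1_def)
    have "AE z in M. q z * ?v z = q z * u z" using v(2) by eventually_elim simp
    then show ?thesis using u integrable_cong_AE[OF m] by (simp add: L1_def)
  qed
  with v(1) have vD: "?v \<in> Dq" by simp
  have "emb M (B ?v) - emb M (B u) = emb M (B (\<lambda>z. 1 * ?v z + (- 1) * u z))"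
    unfolding emb_B_lin[OF vD u] by simp
  also have "norm \<dots> \<le> 1 / 2 * norm (emb M (mult_q (\<lambda>z. 1 * ?v z + (- 1) * u z)))"
    by (rule B_bound'[OF Dq_lin[OF vD u]])
  also have "emb M (mult_q (\<lambda>z. 1 * ?v z + (- 1) * u z)) = emb M (\<lambda>z. 0)"
    by (intro emb_cong Dq_mult Dq_lin vD u zero_L1) (use v(2) in \<open>auto elim: eventually_mono\<close>)
  finally show ?thesis by (simp add: emb_0)
qed

lemma sum_slice:
  shows "\<bar>(\<Sum>k<n. slice k u z)\<bar> \<le> \<bar>u z\<bar>" "(\<Sum>k<n. \<bar>slice k u z\<bar>) \<le> \<bar>u z\<bar>"
proof -
  have ind: "(\<Sum>k<n. indicator (E k) z) = (indicator (\<Union>k<n. E k) z :: real)"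
    using disjoint_family_on_mono[OF subset_UNIV E_disj, of "{..<n}"]
    by (intro indicator_UN_disjoint[symmetric]) auto
  have "(\<Sum>k<n. \<bar>slice k u z\<bar>) = (\<Sum>k<n. indicator (E k) z) * \<bar>u z\<bar>"
    by (simp add: abs_mult sum_distrib_right)
  also have "\<dots> = indicator (\<Union>k<n. E k) z * \<bar>u z\<bar>" by (simp only: ind)
  also have "\<dots> \<le> \<bar>u z\<bar>" by (cases "z \<in> (\<Union>k<n. E k)") auto
  finally show 2: "(\<Sum>k<n. \<bar>slice k u z\<bar>) \<le> \<bar>u z\<bar>" .
  show "\<bar>(\<Sum>k<n. slice k u z)\<bar> \<le> \<bar>u z\<bar>"
    using sum_abs[of "\<lambda>k. slice k u z" "{..<n}"] 2 by linarith
qed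

lemma slice_sums:
  assumes z: "z \<in> space M"
  shows "(\<lambda>n. slice n u z) sums u z"
proof -
  obtain m where m: "z \<in> E m" using E_cover z by auto
  have "slice n u z = (if n = m then u z else 0)" for n
    using m E_disj by (auto simp: disjoint_family_on_def indicator_def)
  then show ?thesis using sums_single[of m "\<lambda>_. u z"] by simp
qed

lemma emb_sum:
  fixes n :: nat
  assumes "\<And>k. f k \<in> L1 M"
  shows "emb M (\<lambda>z. \<Sum>k<n. f k z) = (\<Sum>k<n. emb M (f k))" "(\<lambda>z. \<Sum>k<n. f k z) \<in> L1 M"
proof -
  show s: "(\<lambda>z. \<Sum>k<n. f k z) \<in> L1 M" for n using assms by (simp add: L1_def)
  show "emb M (\<lambda>z. \<Sum>k<n. f k z) = (\<Sum>k<n. emb M (f k))"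
  proof (induct n)
    case (Suc n)
    then show ?case using emb_add[OF s assms, of n n] by simp
  qed (simp add: emb_0)
qed

text \<open>At each point only one slice is nonzero, so the partial sums converge pointwise to u and
  differ from it by at most 2|u|; dominated convergence yields convergence in norm.\<close>

lemma pr_sums:
  assumes u: "u \<in> L1 M"
  shows "(\<lambda>n. emb M (slice n u)) sums emb M u"
proof -
  have sL: "slice k u \<in> L1 M" for k using slice_L1[OF u] .
  have ui: "integrable M u" using u by (simp add: L1_def)
  have si: "integrable M (\<lambda>z. \<Sum>k<n. slice k u z)" for n
    using emb_sum(2)[of "\<lambda>k. slice k u" n] sL by (simp add: L1_def)
  have "(\<lambda>n. LINT z|M. \<bar>(\<Sum>k<n. slice k u z) - u z\<bar>) \<longlonglongrightarrow> (LINT z|M. 0)"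
  proof (rule integral_dominated_convergence[where w = "\<lambda>z. 2 * \<bar>u z\<bar>"])
    show "integrable M (\<lambda>z. 2 * \<bar>u z\<bar>)" using ui by simp
    show "(\<lambda>z. \<bar>(\<Sum>k<n. slice k u z) - u z\<bar>) \<in> borel_measurable M" for n
      using si[of n] ui by (intro borel_measurable_abs borel_measurable_diff) auto
    show "AE z in M. (\<lambda>n. \<bar>(\<Sum>k<n. slice k u z) - u z\<bar>) \<longlonglongrightarrow> 0"
    proof (rule AE_I2)
      fix z assume "z \<in> space M"
      from slice_sums[OF this, of u] show "(\<lambda>n. \<bar>(\<Sum>k<n. slice k u z) - u z\<bar>) \<longlonglongrightarrow> 0"
        unfolding sums_def by (intro tendsto_rabs_zero LIM_zero)
    qed
    show "AE z in M. norm \<bar>(\<Sum>k<n. slice k u z) - u z\<bar> \<le> 2 * \<bar>u z\<bar>" for n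
    proof (rule AE_I2)
      fix z
      show "norm \<bar>(\<Sum>k<n. slice k u z) - u z\<bar> \<le> 2 * \<bar>u z\<bar>"
        using sum_slice(1)[where u = u and z = z and n = n] abs_triangle_ineq4[of "\<Sum>k<n. slice k u z" "u z"] by simp
    qed
  qed simp_all
  then have "(\<lambda>n. norm ((\<Sum>k<n. emb M (slice k u)) - emb M u)) \<longlonglongrightarrow> 0"
    using norm_emb[OF L1_diff[OF emb_sum(2)[of "\<lambda>k. slice k u", OF sL] u]]
      emb_diff[OF emb_sum(2)[of "\<lambda>k. slice k u", OF sL] u] emb_sum(1)[of "\<lambda>k. slice k u", OF sL]
    by (simp add: L1_norm_def)
  then show ?thesis
    unfolding sums_def by (simp add: tendsto_norm_zero_iff LIM_zero_iff)
qed

lemma pr_summable: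
  assumes u: "u \<in> L1 M"
  shows "summable (\<lambda>n. norm (emb M (slice n u)))"
proof (rule summableI_nonneg_bounded[where x = "L1_norm M u"])
  fix n
  have sL: "slice k u \<in> L1 M" for k using slice_L1[OF u] .
  have ui: "integrable M u" using u by (simp add: L1_def)
  have si: "integrable M (slice k u)" for k using sL[of k] by (simp add: L1_def)
  have "(\<Sum>k<n. norm (emb M (slice k u))) = (\<Sum>k<n. LINT z|M. \<bar>slice k u z\<bar>)"
    using norm_emb[OF sL] by (simp add: L1_norm_def)
  also have "\<dots> = (LINT z|M. (\<Sum>k<n. \<bar>slice k u z\<bar>))"
    using si by (intro Bochner_Integration.integral_sum[symmetric] integrable_abs)
  also have "\<dots> \<le> L1_norm M u"
    unfolding L1_norm_def using si ui
    by (intro integral_mono Bochner_Integration.integrable_sum integrable_abs sum_slice(2))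
  finally show "(\<Sum>k<n. norm (emb M (slice k u))) \<le> L1_norm M u" .
qed simp

text \<open>On slice k multiplication by \<open>q'\<close> is bounded, so the slices of
  \<open>q'\<close> u_n converge both to the slice of the limit w and to the slice of
  \<open>q'\<close> v. Hence w = \<open>q'\<close> v almost everywhere on each of countably many
  slices, which cover the space; integrability of \<open>q'\<close> v is inherited from w.\<close>

lemma Qr_closed: "closed Qr"
  unfolding closed_sequential_limits
proof (intro allI impI, elim conjE)
  fix x l assume x: "\<forall>n. x n \<in> Qr" and l: "x \<longlonglongrightarrow> l"
  obtain u where u: "\<And>n. u n \<in> L1 M" "\<And>n. mult_q (u n) \<in> L1 M"
      "\<And>n. x n = (emb M (u n), emb M (mult_q (u n)))"
  proof -
    have "\<forall>n. \<exists>u. u \<in> L1 M \<and> mult_q u \<in> L1 M \<and> x n = (emb M u, emb M (mult_q u))" using x by blast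
    then show ?thesis using that by metis
  qed
  have l1: "(\<lambda>n. emb M (u n)) \<longlonglongrightarrow> fst l" and l2: "(\<lambda>n. emb M (mult_q (u n))) \<longlonglongrightarrow> snd l"
    using tendsto_fst[OF l] tendsto_snd[OF l] by (simp_all add: u(3))
  obtain v where v: "v \<in> L1 M" "fst l = emb M v"
    using closed_sequentially[OF embX_closed _ l1] u(1) by auto
  obtain w where w: "w \<in> L1 M" "snd l = emb M w"
    using closed_sequentially[OF embX_closed _ l2] u(2) by auto
  have "AE z in M. slice k w z = slice k (mult_q v) z" for k
  proof -
    have a: "(\<lambda>n. emb M (slice k (mult_q (u n)))) \<longlonglongrightarrow> emb M (slice k w)"
    proof (rule LIM_zero_cancel, rule Lim_null_comparison[OF always_eventually[OF allI]])
      show "(\<lambda>n. norm (emb M (mult_q (u n)) - emb M w)) \<longlonglongrightarrow> 0"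
        using l2 by (simp add: w(2) LIM_zero tendsto_norm_zero)
      fix n
      let ?d = "\<lambda>z. mult_q (u n) z - w z"
      have d: "?d \<in> L1 M" using L1_diff u(2) w(1) by blast
      have "emb M (slice k (mult_q (u n))) - emb M (slice k w) = emb M (slice k ?d)"
        using emb_diff[OF slice_L1[OF u(2)] slice_L1[OF w(1)], of k n k] by (simp add: right_diff_distrib)
      moreover have "norm (emb M (slice k ?d)) \<le> norm (emb M ?d)"
        unfolding norm_emb[OF slice_L1[OF d]] norm_emb[OF d] L1_norm_def
        using d slice_L1[OF d, of k]
        by (intro integral_mono) (auto simp: L1_def indicator_def intro: integrable_abs)
      ultimately show "norm (emb M (slice k (mult_q (u n))) - emb M (slice k w)) \<le>
          norm (emb M (mult_q (u n)) - emb M w)"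
        using emb_diff[OF u(2) w(1)] by simp
    qed
    have b: "(\<lambda>n. emb M (slice k (mult_q (u n)))) \<longlonglongrightarrow> emb M (slice k (mult_q v))"
    proof (rule LIM_zero_cancel, rule Lim_null_comparison[OF always_eventually[OF allI]])
      show "(\<lambda>n. N' k * norm (emb M (u n) - emb M v)) \<longlonglongrightarrow> 0"
        using tendsto_mult_right_zero[OF tendsto_norm_zero[OF LIM_zero[OF l1]]] by (simp add: v(2))
      fix n
      let ?d = "\<lambda>z. u n z - v z"
      have d: "?d \<in> L1 M" using L1_diff u(1) v(1) by blast
      have "emb M (slice k (mult_q (u n))) - emb M (slice k (mult_q v)) = emb M (slice k (mult_q ?d))"
        using emb_diff[OF slice_q_L1[OF u(1)] slice_q_L1[OF v(1)], of k n k] by (simp add: right_diff_distrib)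
      moreover have "norm (emb M (slice k (mult_q ?d))) \<le> N' k * norm (emb M ?d)"
      proof -
        have "norm (emb M (slice k (mult_q ?d))) \<le> (LINT z|M. N' k * \<bar>?d z\<bar>)"
          unfolding norm_emb[OF slice_q_L1[OF d]] L1_norm_def
        proof (rule integral_mono_AE)
          show "AE z in M. \<bar>slice k (mult_q ?d) z\<bar> \<le> N' k * \<bar>?d z\<bar>"
            using slice_q_bound[of k]
          proof eventually_elim
            fix z assume z: "0 \<le> indicator (E k) z * q' z \<and> indicator (E k) z * q' z \<le> N' k * indicator (E k) z"
            have "\<bar>slice k (mult_q ?d) z\<bar> = (indicator (E k) z * q' z) * \<bar>?d z\<bar>"
              using z by (simp only: mult.assoc[symmetric] abs_mult[of _ "?d z"] abs_of_nonneg)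
            also have "\<dots> \<le> N' k * \<bar>?d z\<bar>"
              using z N'_nonneg[of k] by (intro mult_right_mono) (auto simp: indicator_def split: if_splits)
            finally show "\<bar>slice k (mult_q ?d) z\<bar> \<le> N' k * \<bar>?d z\<bar>" .
          qed
        qed (use d slice_q_L1[OF d, of k] in \<open>auto simp: L1_def intro: integrable_abs\<close>)
        also have "\<dots> = N' k * norm (emb M ?d)"
          unfolding norm_emb[OF d] L1_norm_def by simp
        finally show ?thesis .
      qed
      ultimately show "norm (emb M (slice k (mult_q (u n))) - emb M (slice k (mult_q v))) \<le>
          N' k * norm (emb M (u n) - emb M v)"
        using emb_diff[OF u(1) v(1)] by simp
    qed
    have "emb M (slice k w) = emb M (slice k (mult_q v))" using LIMSEQ_unique[OF a b] .
    then show ?thesis using emb_eq_iff[OF slice_L1[OF w(1)] slice_q_L1[OF v(1)]] by blast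
  qed
  then have "AE z in M. \<forall>k. slice k w z = slice k (mult_q v) z" by (rule AE_all_countable[THEN iffD2, OF allI])
  then have eq: "AE z in M. w z = mult_q v z"
  proof (rule AE_mp, intro AE_I2 impI)
    fix z assume z: "z \<in> space M" "\<forall>k. slice k w z = slice k (mult_q v) z"
    obtain m where "z \<in> E m" using E_cover z(1) by auto
    with z(2)[rule_format, of m] show "w z = mult_q v z" by simp
  qed
  have m: "mult_q v \<in> borel_measurable M" using q'_meas v(1) by (auto simp: L1_def)
  have "mult_q v \<in> L1 M"
    using integrable_cong_AE[OF _ m eq] w(1) by (auto simp: L1_def)
  then have "emb M w = emb M (mult_q v)" using emb_cong[OF w(1) _ eq] by blast
  then have "l = (emb M v, emb M (mult_q v))" using v(2) w(2) by (simp add: prod_eq_iff)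
  then show "l \<in> Qr" using v(1) \<open>mult_q v \<in> L1 M\<close> by blast
qed

lemma Dq_abs:
  assumes "u \<in> L1 M"
  shows "u \<in> Dq \<longleftrightarrow> (\<exists>y. (emb M u, y) \<in> Qr)"
proof
  assume "u \<in> Dq"
  then show "\<exists>y. (emb M u, y) \<in> Qr" using Dq_mult[of u] by blast
next
  assume "\<exists>y. (emb M u, y) \<in> Qr"
  then obtain v where v: "v \<in> L1 M" "mult_q v \<in> L1 M" "emb M u = emb M v" by blast
  have eq: "AE z in M. mult_q v z = mult_q u z"
    using emb_eq_iff[OF assms v(1)] v(3) by (auto elim: eventually_mono)
  have "mult_q u \<in> borel_measurable M" using q'_meas assms by (auto simp: L1_def)
  then have "mult_q u \<in> L1 M"
    using integrable_cong_AE[OF _ _ eq] v(2) by (auto simp: L1_def)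
  then show "u \<in> Dq" using Dq_iff[OF assms] by blast
qed

lemma Qr_eq:
  assumes "(emb M u, y) \<in> Qr" "u \<in> L1 M"
  shows "y = emb M (mult_q u)"
proof -
  obtain v where v: "v \<in> L1 M" "mult_q v \<in> L1 M" "emb M u = emb M v" "y = emb M (mult_q v)"
    using assms(1) by blast
  have "mult_q u \<in> L1 M" using Dq_abs[OF assms(2)] Dq_iff[OF assms(2)] assms(1) by blast
  moreover have "AE z in M. mult_q v z = mult_q u z"
    using emb_eq_iff[OF assms(2) v(1)] v(3) by (auto elim: eventually_mono)
  ultimately show ?thesis using emb_cong[OF v(2)] v(4) by simp
qed

sublocale sliced_perturbation "embX M" "embP M" "lift_sg M G" pr Wr N' Qr Br
proof -
  interpret al_cone "embX M" "embP M" by (rule al_cone_L1)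
  have X: "\<exists>u. u \<in> L1 M \<and> x = emb M u" if "x \<in> embX M" for x using that by blast
  have Qex: "\<exists>u. u \<in> Dq \<and> x = emb M u \<and> y = emb M (mult_q u)" if "(x, y) \<in> Qr" for x y
    using that Dq_iff by blast
  have Qex2: "\<exists>u. u \<in> Dq \<and> a = (emb M u, emb M (mult_q u))" if "a \<in> Qr" for a
    using that Dq_iff by blast
  have Qin: "(emb M u, emb M (mult_q u)) \<in> Qr" if "u \<in> Dq" for u
    using that Dq_mult[OF that] by blast
  show "sliced_perturbation (embX M) (embP M) (lift_sg M G) pr Wr N' Qr Br"
  proof
    show "pc_semigroup (lift_sg M G)" by (rule lift_sg_semigroup[OF G])
    show "pcontr (pr n)" for n
      unfolding pcontr_def lin_op_def
    proof (intro conjI ballI allI)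
      fix x assume "x \<in> embX M"
      then obtain u where u: "u \<in> L1 M" "x = emb M u" by blast
      show "pr n x \<in> embX M" using pr_emb[OF u(1)] slice_L1[OF u(1)] u(2) by simp
      show "pr n (c *\<^sub>R x) = c *\<^sub>R pr n x" for c
        using pr_emb[OF L1_lin[OF u(1) u(1), of c 0]] pr_emb[OF u(1)] emb_scale[OF u(1), of c] u(2)
          emb_scale[OF slice_L1[OF u(1)], of c n] by (simp add: mult.left_commute)
      show "norm (pr n x) \<le> norm x"
        unfolding u(2) pr_emb[OF u(1)] norm_emb[OF u(1)] norm_emb[OF slice_L1[OF u(1)]] L1_norm_def
        using u(1) slice_L1[OF u(1), of n]
        by (intro integral_mono) (auto simp: L1_def indicator_def intro: integrable_abs)
      fix y assume "y \<in> embX M"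
      then obtain v where v: "v \<in> L1 M" "y = emb M v" by blast
      show "pr n (x + y) = pr n x + pr n y"
        using pr_emb[OF L1_lin[OF u(1) v(1), of 1 1]] pr_emb[OF u(1)] pr_emb[OF v(1)]
          emb_add[OF u(1) v(1)] u(2) v(2) emb_add[OF slice_L1[OF u(1)] slice_L1[OF v(1)], of n n]
        by (simp add: distrib_left)
    next
      fix x assume "x \<in> embP M"
      then obtain u where u: "u \<in> L1 M" "x = emb M u" "AE z in M. 0 \<le> u z" by blast
      have "AE z in M. 0 \<le> slice n u z" using u(3) by eventually_elim simp
      then show "pr n x \<in> embP M" using pr_emb[OF u(1)] emb_nonneg_iff[OF slice_L1[OF u(1)]] u(2) by simp
    qed
    show "pr n (lift_sg M G t x) = lift_sg M G t (pr n x)" if "0 \<le> t" "x \<in> embX M" for n t x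
    proof -
      obtain u where u: "u \<in> L1 M" "x = emb M u" using \<open>x \<in> embX M\<close> by blast
      note le = lift_sg_emb[OF G that(1)] and GL = G_L1[OF G that(1)]
      have "emb M (G t (slice n u)) = emb M (slice n (G t u))"
        by (rule emb_cong[OF GL[OF slice_L1[OF u(1)]] slice_L1[OF GL[OF u(1)]] G_E[OF that(1) u(1)]])
      then show ?thesis
        unfolding u(2) le[OF u(1)] pr_emb[OF u(1)] pr_emb[OF GL[OF u(1)]] le[OF slice_L1[OF u(1)]] by simp
    qed
    show "pr n (pr n x) = pr n x" if "x \<in> embX M" for n x
    proof -
      obtain u where u: "u \<in> L1 M" "x = emb M u" using \<open>x \<in> embX M\<close> by blast
      have "slice n (slice n u) = slice n u" by (auto simp: indicator_def)
      then show ?thesis unfolding u(2) pr_emb[OF u(1)] pr_emb[OF slice_L1[OF u(1)]] by simp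
    qed
    show "(\<lambda>n. pr n x) sums x" if "x \<in> embX M" for x
      using X[OF that] pr_emb pr_sums by auto
    show "summable (\<lambda>n. norm (pr n x))" if "x \<in> embX M" for x
      using X[OF that] pr_emb pr_summable by auto
    show "x \<in> embX M \<and> y \<in> embX M" if "(x, y) \<in> Qr" for x y
      using that by blast
    show "subspace Qr"
    proof (rule subspaceI)
      have "(\<lambda>z. 0) \<in> Dq" by (simp add: zero_L1)
      from Qin[OF this] show "0 \<in> Qr" by (simp add: emb_0 zero_prod_def)
    next
      fix a b assume "a \<in> Qr" "b \<in> Qr"
      from Qex2[OF this(1)] Qex2[OF this(2)]
      obtain u v where u: "u \<in> Dq" "a = (emb M u, emb M (mult_q u))"
          and v: "v \<in> Dq" "b = (emb M v, emb M (mult_q v))"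
        by blast
      have uv: "u \<in> L1 M" "v \<in> L1 M" using u v by auto
      have "mult_q (\<lambda>z. 1 * u z + 1 * v z) = (\<lambda>z. mult_q u z + mult_q v z)"
        by (auto simp: distrib_left)
      with Qin[OF Dq_lin[OF u(1) v(1), of 1 1]] show "a + b \<in> Qr"
        unfolding u(2) v(2) using emb_add[OF uv] emb_add[OF Dq_mult[OF u(1)] Dq_mult[OF v(1)]] by simp
    next
      fix c a assume "a \<in> Qr"
      from Qex2[OF this] obtain u where u: "u \<in> Dq" "a = (emb M u, emb M (mult_q u))" by blast
      have uL: "u \<in> L1 M" using u by auto
      have "mult_q (\<lambda>z. c * u z + 0 * u z) = (\<lambda>z. c * mult_q u z)" by auto
      with Qin[OF Dq_lin[OF u(1) u(1), of c 0]] show "c *\<^sub>R a \<in> Qr"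
        unfolding u(2) using emb_scale[OF uL, of c] emb_scale[OF Dq_mult[OF u(1)], of c] by simp
    qed
    show "closed Qr" by (rule Qr_closed)
    show "y = y'" if m: "(x, y) \<in> Qr" "(x, y') \<in> Qr" for x y y'
    proof -
      obtain u where u: "u \<in> Dq" "x = emb M u" "y = emb M (mult_q u)" using Qex[OF m(1)] by blast
      then have "u \<in> L1 M" by simp
      from Qr_eq[OF m(2)[unfolded u(2)] this] show ?thesis using u(3) by simp
    qed
    show "y \<in> embP M" if m: "(x, y) \<in> Qr" "x \<in> embP M" for x y
    proof -
      obtain u where u: "u \<in> Dq" "x = emb M u" "y = emb M (mult_q u)" using Qex[OF m(1)] by blast
      then have "u \<in> L1 M" by simp
      from emb_nonneg_iff[OF this] have "AE z in M. 0 \<le> u z" using m(2) u(2) by (simp only:)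
      then have "AE z in M. 0 \<le> mult_q u z" using q'_nonneg by eventually_elim simp
      then show ?thesis using emb_nonneg_iff[OF Dq_mult[OF u(1)]] u(3) by simp
    qed
    show "(pr n x, Wr n x) \<in> Qr" if m: "x \<in> embX M" for n x
    proof -
      obtain u where u: "u \<in> L1 M" "x = emb M u" using \<open>x \<in> embX M\<close> by blast
      have e: "mult_q (slice n u) = slice n (mult_q u)" by auto
      have "mult_q (slice n u) \<in> L1 M" unfolding e by (rule slice_q_L1[OF u(1)])
      then have "slice n u \<in> Dq" by (rule Dq_iff[OF slice_L1[OF u(1)], THEN iffD2])
      from Qin[OF this] show ?thesis unfolding u(2) pr_emb[OF u(1)] Wr_emb[OF u(1)] e .
    qed
    show "pr n y = Wr n x" if m: "(x, y) \<in> Qr" for n x y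
    proof -
      obtain u where u: "u \<in> Dq" "x = emb M u" "y = emb M (mult_q u)" using Qex[OF m] by blast
      then have uL: "u \<in> L1 M" by auto
      show ?thesis unfolding u(2,3) Wr_emb[OF uL] pr_emb[OF Dq_mult[OF u(1)]] ..
    qed
    show "0 \<le> N' n" for n by (rule N'_nonneg)
    show "N' n *\<^sub>R pr n x - Wr n x \<in> embP M" if "x \<in> embP M" for n x
    proof -
      obtain u where u: "u \<in> L1 M" "x = emb M u" "AE z in M. 0 \<le> u z" using \<open>x \<in> embP M\<close> by blast
      let ?w = "\<lambda>z. N' n * slice n u z - slice n (mult_q u) z"
      have sc: "(\<lambda>z. N' n * slice n u z) \<in> L1 M"
        using L1_lin[OF slice_L1[OF u(1)] slice_L1[OF u(1)], of "N' n" n 0 n] by simp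
      have w: "?w \<in> L1 M" using L1_diff[OF sc slice_q_L1[OF u(1)]] .
      have "N' n *\<^sub>R pr n x - Wr n x = emb M ?w"
        unfolding u(2) pr_emb[OF u(1)] Wr_emb[OF u(1)]
        using emb_diff[OF sc slice_q_L1[OF u(1)]] emb_scale[OF slice_L1[OF u(1)]] by simp
      moreover have "AE z in M. 0 \<le> ?w z"
        using u(3) slice_q_bound[of n]
      proof eventually_elim
        fix z assume a: "0 \<le> u z"
          and b: "0 \<le> indicator (E n) z * q' z \<and> indicator (E n) z * q' z \<le> N' n * indicator (E n) z"
        have "(indicator (E n) z * q' z) * u z \<le> (N' n * indicator (E n) z) * u z"
          using a b by (intro mult_right_mono) auto
        then show "0 \<le> ?w z" by (simp add: mult.assoc)
      qed
      ultimately show ?thesis using emb_nonneg_iff[OF w] by simp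
    qed
    show "Br x \<in> embP M" if m: "(x, y) \<in> Qr" "x \<in> embP M" for x y
    proof -
      obtain u where u: "u \<in> Dq" "x = emb M u" "y = emb M (mult_q u)" using Qex[OF m(1)] by blast
      then have uD: "u \<in> L1 M" "(\<lambda>z. q z * u z) \<in> L1 M" by auto
      have "AE z in M. 0 \<le> u z" using m(2) emb_nonneg_iff[OF uD(1)] u(2) by (simp only:)
      from B_nonneg[OF uD this] have "emb M (B u) \<in> embP M" using emb_nonneg_iff[OF B_L1[OF uD]] by (simp only:)
      then show ?thesis unfolding u(2) Br_emb[OF u(1)] .
    qed
    show "Br (x + x') = Br x + Br x'" if m: "(x, y) \<in> Qr" "(x', y') \<in> Qr" for x y x' y'
    proof -
      obtain u where u: "u \<in> Dq" "x = emb M u" using Qex[OF m(1)] by blast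
      obtain v where v: "v \<in> Dq" "x' = emb M v" using Qex[OF m(2)] by blast
      have uv: "u \<in> L1 M" "v \<in> L1 M" using u v by auto
      have "x + x' = emb M (\<lambda>z. 1 * u z + 1 * v z)" using emb_add[OF uv] u(2) v(2) by simp
      then show ?thesis
        unfolding u(2) v(2) using Br_emb[OF Dq_lin[OF u(1) v(1), of 1 1]] emb_B_lin[OF u(1) v(1), of 1 1]
          Br_emb[OF u(1)] Br_emb[OF v(1)] by simp
    qed
    show "Br (c *\<^sub>R x) = c *\<^sub>R Br x" if m: "(x, y) \<in> Qr" for x y c
    proof -
      obtain u where u: "u \<in> Dq" "x = emb M u" using Qex[OF m(1)] by blast
      have uL: "u \<in> L1 M" using u by auto
      have "c *\<^sub>R x = emb M (\<lambda>z. c * u z + 0 * u z)" using emb_scale[OF uL, of c] u(2) by simp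
      then show ?thesis
        unfolding u(2) using Br_emb[OF Dq_lin[OF u(1) u(1), of c 0]] emb_B_lin[OF u(1) u(1), of c 0]
          Br_emb[OF u(1)] by simp
    qed
    show "Br x \<in> embX M \<and> norm (Br x) \<le> 1 / 2 * norm y" if m: "(x, y) \<in> Qr" for x y
    proof -
      obtain u where u: "u \<in> Dq" "x = emb M u" "y = emb M (mult_q u)" using Qex[OF m(1)] by blast
      then have uD: "u \<in> L1 M" "(\<lambda>z. q z * u z) \<in> L1 M" by auto
      show ?thesis unfolding u(2,3) Br_emb[OF u(1)] by (intro conjI imageI B_bound'[OF u(1)] B_L1[OF uD])
    qed
  qed
qed

theorem generates:
  "generates_positive_semigroup M (\<lambda>u z. T u z - q z * u z + B u z) (D \<inter> Dq)"
proof -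
  obtain S' where S': "pc_semigroup S'" "gen S' = K" using perturbed_generation by blast
  have D: "D = {u \<in> L1 M. \<exists>v. right_derivative_at_0 M G u v}"
    and TD: "\<And>u. u \<in> D \<Longrightarrow> right_derivative_at_0 M G u (T u)"
    using T by (auto simp: is_generator_def)
  have T_gen: "T u \<in> L1 M \<and> (emb M u, emb M (T u)) \<in> gen (lift_sg M G)" if "u \<in> D" for u
  proof -
    have "u \<in> L1 M" using that D by blast
    moreover have "T u \<in> L1 M" using TD[OF that] by (simp add: right_derivative_at_0_def)
    ultimately show ?thesis using lift_sg_gen[OF G] TD[OF that] by blast
  qed
  have gen_iff: "(emb M u, y) \<in> gen (rescale (2 * C) S') \<longleftrightarrow> (emb M u, y - (2 * C) *\<^sub>R emb M u) \<in> K" for u y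
    using gen_rescale[of S' "emb M u" y "2 * C"] pc_semigroupD(4)[OF S'(1)] S'(2) by blast
  have Qin: "(emb M u, emb M (mult_q u)) \<in> Qr" if "u \<in> Dq" for u
    using that Dq_mult[OF that] by blast
  show ?thesis
  proof (rule generates_positive_semigroupI[OF S'(1), where c = "2 * C"])
    show "D \<inter> Dq = {u \<in> L1 M. \<exists>y. (emb M u, y) \<in> gen (rescale (2 * C) S')}"
    proof (intro set_eqI iffI)
      fix u assume u: "u \<in> D \<inter> Dq"
      then have uD: "u \<in> D" and uq: "u \<in> Dq" and uL: "u \<in> L1 M" by auto
      have "(emb M u, emb M (T u) - emb M (mult_q u) + Br (emb M u)) \<in> K"
        by (rule K_I[OF conjunct2[OF T_gen[OF uD]] Qin[OF uq]])
      then have "(emb M u, emb M (T u) - emb M (mult_q u) + Br (emb M u) + (2 * C) *\<^sub>R emb M u)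
          \<in> gen (rescale (2 * C) S')"
        unfolding gen_iff by simp
      then show "u \<in> {u \<in> L1 M. \<exists>y. (emb M u, y) \<in> gen (rescale (2 * C) S')}"
        using uL by (intro CollectI conjI exI)
    next
      fix u assume "u \<in> {u \<in> L1 M. \<exists>y. (emb M u, y) \<in> gen (rescale (2 * C) S')}"
      then obtain y where u: "u \<in> L1 M" "(emb M u, y - (2 * C) *\<^sub>R emb M u) \<in> K"
        using gen_iff by blast
      then obtain v w where vw: "(emb M u, v) \<in> gen (lift_sg M G)" "(emb M u, w) \<in> Qr"
        unfolding K_def by blast
      obtain v' where v': "v' \<in> L1 M" "v = emb M v'" using genD(2)[OF vw(1)] by blast
      have "right_derivative_at_0 M G u v'" using lift_sg_gen[OF G u(1) v'(1)] vw(1) v'(2) by blast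
      then have "u \<in> D" using D u(1) by blast
      moreover have "u \<in> Dq" using Dq_abs[OF u(1)] vw(2) by blast
      ultimately show "u \<in> D \<inter> Dq" by blast
    qed
    fix u assume u: "u \<in> D \<inter> Dq"
    then have uD: "u \<in> D" and uq: "u \<in> Dq" and uL: "u \<in> L1 M" and qu: "(\<lambda>z. q z * u z) \<in> L1 M" by auto
    note Tu = T_gen[OF uD]
    let ?K = "\<lambda>z. T u z - q z * u z + B u z"
    have TL: "T u \<in> L1 M" and BL: "B u \<in> L1 M" using Tu B_L1[OF uL qu] by auto
    have KL: "?K \<in> L1 M" using TL BL qu by (simp add: L1_def)
    have e1: "emb M ?K = emb M (T u) - emb M (\<lambda>z. q z * u z) + emb M (B u)"
      using emb_add[OF L1_diff[OF TL qu] BL] emb_diff[OF TL qu] by simp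
    have "mult_q u = (\<lambda>z. 1 * (q z * u z) + (2 * C) * u z)" by (auto simp: q'_def distrib_right)
    then have e2: "emb M (mult_q u) = emb M (\<lambda>z. q z * u z) + (2 * C) *\<^sub>R emb M u"
      using emb_lin[OF qu uL, of 1 "2 * C"] by simp
    have "(emb M u, emb M (T u) - emb M (mult_q u) + Br (emb M u)) \<in> K"
      by (rule K_I[OF conjunct2[OF Tu] Qin[OF uq]])
    \<comment> \<open>The graph \<open>K\<close> contains absorption at the rate q + 2C; the summand
      -2C u is split off here, and the rescaling by exp(2C t) cancels it.\<close>
    moreover have "emb M (T u) - emb M (mult_q u) + Br (emb M u) = emb M ?K - (2 * C) *\<^sub>R emb M u"
      unfolding e1 e2 Br_emb[OF uq] by simp
    ultimately have "(emb M u, emb M ?K) \<in> gen (rescale (2 * C) S')" unfolding gen_iff by simp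
    with KL show "?K \<in> L1 M \<and> (emb M u, emb M ?K) \<in> gen (rescale (2 * C) S')" by blast
  qed
qed

end

section \<open>Kernels on the Lebesgue measure of a product\<close>

lemma nn_integral_lborel_pair:
  fixes g :: "'a::euclidean_space \<times> 'b::euclidean_space \<Rightarrow> ennreal"
  assumes "g \<in> borel_measurable borel"
  shows "(\<integral>\<^sup>+z. g z \<partial>lborel) = (\<integral>\<^sup>+x. \<integral>\<^sup>+y. g (x, y) \<partial>lborel \<partial>lborel)"
proof -
  have "g \<in> borel_measurable (lborel \<Otimes>\<^sub>M lborel)" using assms by (simp add: lborel_prod)
  from lborel.nn_integral_fst[OF this] show ?thesis by (simp add: lborel_prod)
qed

lemma borel_measurable_comp_continuous:
  fixes h :: "'a::topological_space \<Rightarrow> 'b::topological_space"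
  assumes "g \<in> borel_measurable borel" "continuous_on UNIV h"
  shows "(\<lambda>z. g (h z)) \<in> borel_measurable borel"
  using measurable_compose[OF borel_measurable_continuous_onI[OF assms(2)] assms(1)] .

lemma borel_measurable_sections:
  fixes g :: "'a::euclidean_space \<times> 'b::euclidean_space \<Rightarrow> 'c::topological_space"
  assumes "g \<in> borel_measurable borel"
  shows "(\<lambda>y. g (x, y)) \<in> borel_measurable borel" "(\<lambda>x. g (x, y)) \<in> borel_measurable borel"
  by (rule borel_measurable_comp_continuous[OF assms], intro continuous_intros)+

lemma borel_measurable_shuffle:
  fixes g :: "'a::euclidean_space \<times> 'b::euclidean_space \<times> 'c::euclidean_space \<Rightarrow> 'd::topological_space"
  assumes "g \<in> borel_measurable borel"
  shows "(\<lambda>z. g (fst (fst z), snd (fst z), snd z)) \<in> borel_measurable borel"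
    "(\<lambda>z. g (fst (fst z), snd z, snd (fst z))) \<in> borel_measurable borel"
  by (rule borel_measurable_comp_continuous[OF assms], intro continuous_intros)+

text \<open>Two orders of integration over (x, m, s): target mass outside and source mass inside is
  how the kernel acts, while source mass outside and target mass inside is how its weighted mass is
  estimated. Triples are nested to the right, hence the projections.\<close>

lemma nn_integral_lborel_triple:
  fixes g :: "'a::euclidean_space \<times> 'b::euclidean_space \<times> 'c::euclidean_space \<Rightarrow> ennreal"
  assumes g: "g \<in> borel_measurable borel"
  shows "(\<integral>\<^sup>+z. g z \<partial>lborel) = (\<integral>\<^sup>+y. \<integral>\<^sup>+s. g (fst y, snd y, s) \<partial>lborel \<partial>lborel)"
    "(\<integral>\<^sup>+z. g z \<partial>lborel) = (\<integral>\<^sup>+y. \<integral>\<^sup>+m. g (fst y, m, snd y) \<partial>lborel \<partial>lborel)"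
proof -
  have 0: "(\<integral>\<^sup>+z. g z \<partial>lborel) = (\<integral>\<^sup>+x. \<integral>\<^sup>+m. \<integral>\<^sup>+s. g (x, m, s) \<partial>lborel \<partial>lborel \<partial>lborel)"
    using nn_integral_lborel_pair[OF borel_measurable_sections(1)[OF g]]
    by (simp add: nn_integral_lborel_pair[OF g])
  have m1: "(\<lambda>y. \<integral>\<^sup>+s. g (fst y, snd y, s) \<partial>lborel) \<in> borel_measurable borel"
    using lborel.borel_measurable_nn_integral_fst[of "\<lambda>z. g (fst (fst z), snd (fst z), snd z)" lborel]
      borel_measurable_shuffle(1)[OF g] by (simp add: lborel_prod)
  show "(\<integral>\<^sup>+z. g z \<partial>lborel) = (\<integral>\<^sup>+y. \<integral>\<^sup>+s. g (fst y, snd y, s) \<partial>lborel \<partial>lborel)"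
    by (simp add: 0 nn_integral_lborel_pair[OF m1])
  have m2: "(\<lambda>y. \<integral>\<^sup>+s. g (fst y, s, snd y) \<partial>lborel) \<in> borel_measurable borel"
    using lborel.borel_measurable_nn_integral_fst[of "\<lambda>z. g (fst (fst z), snd z, snd (fst z))" lborel]
      borel_measurable_shuffle(2)[OF g] by (simp add: lborel_prod)
  have "(\<integral>\<^sup>+m. \<integral>\<^sup>+s. g (x, m, s) \<partial>lborel \<partial>lborel) = (\<integral>\<^sup>+s. \<integral>\<^sup>+m. g (x, m, s) \<partial>lborel \<partial>lborel)" for x
    using lborel_pair.Fubini[of "\<lambda>w. g (x, w)"] borel_measurable_sections(1)[OF g, of x]
    by (simp add: lborel_prod)
  then show "(\<integral>\<^sup>+z. g z \<partial>lborel) = (\<integral>\<^sup>+y. \<integral>\<^sup>+m. g (fst y, m, snd y) \<partial>lborel \<partial>lborel)"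
    by (simp add: 0 nn_integral_lborel_pair[OF m2])
qed

text \<open>Iterated integration is carried out for Borel functions. Lebesgue null sets are
  therefore enlarged to Borel null sets before their sections are taken, since a section of a
  Lebesgue measurable set is measurable only for almost every parameter.\<close>

lemma lebesgue_null_borel:
  fixes P :: "'a::euclidean_space \<Rightarrow> bool"
  assumes "AE z in lebesgue. P z"
  shows "\<exists>N\<in>sets borel. (\<integral>\<^sup>+z. indicator N z \<partial>lborel) = 0 \<and> (\<forall>z. z \<notin> N \<longrightarrow> P z)"
proof -
  have "AE z in lborel. P z" using assms by (simp add: AE_completion_iff)
  then obtain N where "{z \<in> space lborel. \<not> P z} \<subseteq> N" "emeasure lborel N = 0" "N \<in> sets lborel"
    by (rule AE_E)
  then show ?thesis by (intro bexI[of _ N]) auto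
qed

lemma AE_lebesgue_triple:
  fixes P :: "'a::euclidean_space \<times> 'b::euclidean_space \<times> 'c::euclidean_space \<Rightarrow> bool"
  assumes "AE z in lebesgue. P z"
  shows "AE y in lebesgue. AE s in lebesgue. P (fst y, snd y, s)"
    "AE y in lebesgue. AE m in lebesgue. P (fst y, m, snd y)"
proof -
  obtain N where N: "N \<in> sets borel" "(\<integral>\<^sup>+z. indicator N z \<partial>lborel) = (0::ennreal)" "\<And>z. z \<notin> N \<Longrightarrow> P z"
    using lebesgue_null_borel[OF assms] by blast
  let ?g = "indicator N :: 'a \<times> 'b \<times> 'c \<Rightarrow> ennreal"
  have g: "?g \<in> borel_measurable borel" using N(1) by simp
  note sh = borel_measurable_shuffle[OF g]
  have ms: "(\<lambda>s. ?g (x, m, s)) \<in> borel_measurable borel" "(\<lambda>m. ?g (x, m, s)) \<in> borel_measurable borel" for x m s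
    using borel_measurable_sections(1)[OF borel_measurable_sections(1)[OF g]]
      borel_measurable_sections(2)[OF borel_measurable_sections(1)[OF g]] by auto
  have m1: "(\<lambda>y. \<integral>\<^sup>+s. ?g (fst y, snd y, s) \<partial>lborel) \<in> borel_measurable lborel"
    using lborel.borel_measurable_nn_integral_fst[of "\<lambda>z. ?g (fst (fst z), snd (fst z), snd z)" lborel] sh(1)
    by (simp add: lborel_prod)
  have m2: "(\<lambda>y. \<integral>\<^sup>+s. ?g (fst y, s, snd y) \<partial>lborel) \<in> borel_measurable lborel"
    using lborel.borel_measurable_nn_integral_fst[of "\<lambda>z. ?g (fst (fst z), snd z, snd (fst z))" lborel] sh(2)
    by (simp add: lborel_prod)
  have "AE y in lborel. (\<integral>\<^sup>+s. ?g (fst y, snd y, s) \<partial>lborel) = 0"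
    using nn_integral_0_iff_AE[OF m1] nn_integral_lborel_triple(1)[OF g] N(2) by simp
  then have "AE y in lborel. AE s in lborel. P (fst y, snd y, s)"
  proof eventually_elim
    fix y :: "'a \<times> 'b" assume "(\<integral>\<^sup>+s. ?g (fst y, snd y, s) \<partial>lborel) = 0"
    then have "AE s in lborel. ?g (fst y, snd y, s) = 0"
      using nn_integral_0_iff_AE[of "\<lambda>s. ?g (fst y, snd y, s)" lborel] ms by simp
    then show "AE s in lborel. P (fst y, snd y, s)"
      by eventually_elim (use N(3) in \<open>auto simp: indicator_def split: if_splits\<close>)
  qed
  then show "AE y in lebesgue. AE s in lebesgue. P (fst y, snd y, s)" by (simp add: AE_completion_iff)
  have "AE y in lborel. (\<integral>\<^sup>+m. ?g (fst y, m, snd y) \<partial>lborel) = 0"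
    using nn_integral_0_iff_AE[OF m2] nn_integral_lborel_triple(2)[OF g] N(2) by simp
  then have "AE y in lborel. AE m in lborel. P (fst y, m, snd y)"
  proof eventually_elim
    fix y :: "'a \<times> 'c" assume "(\<integral>\<^sup>+m. ?g (fst y, m, snd y) \<partial>lborel) = 0"
    then have "AE m in lborel. ?g (fst y, m, snd y) = 0"
      using nn_integral_0_iff_AE[of "\<lambda>m. ?g (fst y, m, snd y)" lborel] ms by simp
    then show "AE m in lborel. P (fst y, m, snd y)"
      by eventually_elim (use N(3) in \<open>auto simp: indicator_def split: if_splits\<close>)
  qed
  then show "AE y in lebesgue. AE m in lebesgue. P (fst y, m, snd y)" by (simp add: AE_completion_iff)
qed

lemma AE_lebesgue_snd:
  fixes P :: "'b::euclidean_space \<Rightarrow> bool"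
  assumes "AE y in lebesgue. P y"
  shows "AE z in (lebesgue :: ('a::euclidean_space \<times> 'b) measure). P (snd z)"
proof -
  obtain N where N: "N \<in> sets borel" "(\<integral>\<^sup>+z. indicator N z \<partial>lborel) = (0::ennreal)" "\<And>z. z \<notin> N \<Longrightarrow> P z"
    using lebesgue_null_borel[OF assms] by blast
  let ?g = "\<lambda>z :: 'a \<times> 'b. indicator N (snd z) :: ennreal"
  have g: "?g \<in> borel_measurable borel"
    by (rule borel_measurable_comp_continuous[where g = "indicator N"])
      (use N(1) in \<open>auto intro!: continuous_intros\<close>)
  have "(\<integral>\<^sup>+z. ?g z \<partial>lborel) = 0" by (simp add: nn_integral_lborel_pair[OF g] N(2)[unfolded nn_integral_indicator])
  then have "AE z in lborel. ?g z = 0" using nn_integral_0_iff_AE[of ?g lborel] g by simp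
  then have "AE z in (lborel :: ('a \<times> 'b) measure). P (snd z)"
    by eventually_elim (use N(3) in \<open>auto simp: indicator_def split: if_splits\<close>)
  then show ?thesis by (simp add: AE_completion_iff)
qed

lemma AE_lebesgue_outer:
  fixes P :: "'a::euclidean_space \<times> 'c::euclidean_space \<Rightarrow> bool"
  assumes "AE y in lebesgue. P y"
  shows "AE z in (lebesgue :: ('a \<times> 'b::euclidean_space \<times> 'c) measure). P (fst z, snd (snd z))"
proof -
  obtain N where N: "N \<in> sets borel" "(\<integral>\<^sup>+z. indicator N z \<partial>lborel) = (0::ennreal)" "\<And>z. z \<notin> N \<Longrightarrow> P z"
    using lebesgue_null_borel[OF assms] by blast
  let ?g = "\<lambda>z :: 'a \<times> 'b \<times> 'c. indicator N (fst z, snd (snd z)) :: ennreal"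
  have g: "?g \<in> borel_measurable borel"
    by (rule borel_measurable_comp_continuous[where g = "indicator N"])
      (use N(1) in \<open>auto intro!: continuous_intros\<close>)
  have "AE y in lborel. indicator N y = (0::ennreal)"
    using N(1,2) nn_integral_0_iff_AE[of "indicator N :: _ \<Rightarrow> ennreal" lborel] by simp
  then have "(\<integral>\<^sup>+y. \<integral>\<^sup>+m. ?g (fst y, m :: 'b, snd y) \<partial>lborel \<partial>lborel) = (\<integral>\<^sup>+y. 0 \<partial>(lborel :: ('a \<times> 'c) measure))"
    by (intro nn_integral_cong_AE) (rule eventually_mono, simp_all)
  then have "(\<integral>\<^sup>+z. ?g z \<partial>lborel) = 0" by (simp add: nn_integral_lborel_triple(2)[OF g])
  then have "AE z in lborel. ?g z = 0" using nn_integral_0_iff_AE[of ?g lborel] g by simp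
  then have "AE z in (lborel :: ('a \<times> 'b \<times> 'c) measure). P (fst z, snd (snd z))"
    by eventually_elim (use N(3) in \<open>auto simp: indicator_def split: if_splits\<close>)
  then show ?thesis by (simp add: AE_completion_iff)
qed

lemma borel_measurable_lebesgue_snd:
  fixes f :: "'b::euclidean_space \<Rightarrow> real"
  assumes "f \<in> borel_measurable lebesgue"
  shows "(\<lambda>z :: 'a::euclidean_space \<times> 'b. f (snd z)) \<in> borel_measurable lebesgue"
proof -
  obtain g where g: "g \<in> borel_measurable lborel" "AE z in lborel. f z = g z"
    using completion_ex_borel_measurable_real[OF assms] by blast
  have "(\<lambda>z :: 'a \<times> 'b. g (snd z)) \<in> borel_measurable borel"
    by (rule borel_measurable_comp_continuous[where g = g])
      (use g(1) in \<open>auto intro!: continuous_intros\<close>)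
  then have "(\<lambda>z :: 'a \<times> 'b. g (snd z)) \<in> borel_measurable lebesgue" by (intro measurable_completion) simp
  moreover have "AE z in (lebesgue :: ('a \<times> 'b) measure). g (snd z) = f (snd z)"
    using g(2) AE_lebesgue_snd[of "\<lambda>z. g z = f z"] by (simp add: AE_completion_iff eq_commute)
  ultimately show ?thesis by (rule borel_measurable_AE)
qed

lemma borel_measurable_lebesgue_outer:
  fixes f :: "'a::euclidean_space \<times> 'c::euclidean_space \<Rightarrow> real"
  assumes "f \<in> borel_measurable lebesgue"
  shows "(\<lambda>z :: 'a \<times> 'b::euclidean_space \<times> 'c. f (fst z, snd (snd z))) \<in> borel_measurable lebesgue"
proof -
  obtain g where g: "g \<in> borel_measurable lborel" "AE z in lborel. f z = g z"
    using completion_ex_borel_measurable_real[OF assms] by blast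
  have "(\<lambda>z :: 'a \<times> 'b \<times> 'c. g (fst z, snd (snd z))) \<in> borel_measurable borel"
    by (rule borel_measurable_comp_continuous[where g = g])
      (use g(1) in \<open>auto intro!: continuous_intros\<close>)
  then have "(\<lambda>z :: 'a \<times> 'b \<times> 'c. g (fst z, snd (snd z))) \<in> borel_measurable lebesgue"
    by (intro measurable_completion) simp
  moreover have "AE z in (lebesgue :: ('a \<times> 'b \<times> 'c) measure). g (fst z, snd (snd z)) = f (fst z, snd (snd z))"
    using g(2) AE_lebesgue_outer[of "\<lambda>z. g z = f z"]
    by (simp add: AE_completion_iff eq_commute)
  ultimately show ?thesis by (rule borel_measurable_AE)
qed

section \<open>The weighted space and kernel operators on it\<close>

lemma Xr_sets:
  fixes \<Omega> :: "'x::euclidean_space set"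
  assumes "open \<Omega>"
  shows "\<Omega> \<times> {0::real..} \<in> sets lebesgue" "\<Omega> \<times> {0::real..} \<times> {0::real..} \<in> sets lebesgue"
  using assms by (auto intro!: sets_completionI_sets borel_Times)

lemma Xr_weight_measurable: "(\<lambda>(x, m). ennreal (1 + m powr r)) \<in> borel_measurable (lebesgue_on (\<Omega> \<times> {0::real..}))"
  by (rule measurable_restrict_space1[OF weight_measurable])

lemma AE_Xr_iff:
  fixes \<Omega> :: "'x::euclidean_space set"
  assumes "open \<Omega>"
  shows "(AE z in Xr \<Omega> r. P z) \<longleftrightarrow> (AE z in lebesgue_on (\<Omega> \<times> {0..}). P z)"
    "(AE z in lebesgue_on (\<Omega> \<times> {0::real..}). P z) \<longleftrightarrow> (AE z in lebesgue. z \<in> \<Omega> \<times> {0..} \<longrightarrow> P z)"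
proof -
  have "(AE z in Xr \<Omega> r. P z) \<longleftrightarrow>
      (AE z in lebesgue_on (\<Omega> \<times> {0..}). 0 < (case z of (x, m) \<Rightarrow> ennreal (1 + m powr r)) \<longrightarrow> P z)"
    unfolding Xr_def by (rule AE_density[OF Xr_weight_measurable])
  moreover have "0 < (case z of (x, m) \<Rightarrow> ennreal (1 + m powr r))" for z :: "'x \<times> real"
    by (auto simp: split_beta add_pos_nonneg)
  ultimately show "(AE z in Xr \<Omega> r. P z) \<longleftrightarrow> (AE z in lebesgue_on (\<Omega> \<times> {0..}). P z)" by simp
  show "(AE z in lebesgue_on (\<Omega> \<times> {0::real..}). P z) \<longleftrightarrow> (AE z in lebesgue. z \<in> \<Omega> \<times> {0..} \<longrightarrow> P z)"
    using Xr_sets(1)[OF assms] by (intro AE_restrict_space_iff) simp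
qed

lemma nn_integral_Xr_density:
  fixes \<Omega> :: "'x::euclidean_space set"
  assumes "open \<Omega>" and f: "f \<in> borel_measurable (lebesgue_on (\<Omega> \<times> {0..}))"
  shows "(\<integral>\<^sup>+z. f z \<partial>Xr \<Omega> r) =
    (\<integral>\<^sup>+z. ennreal (1 + snd z powr r) * f z * indicator (\<Omega> \<times> {0..}) z \<partial>lebesgue)"
proof -
  have "(\<integral>\<^sup>+z. f z \<partial>Xr \<Omega> r) = (\<integral>\<^sup>+z. ennreal (1 + snd z powr r) * f z \<partial>lebesgue_on (\<Omega> \<times> {0..}))"
    unfolding Xr_def using Xr_weight_measurable f
    by (subst nn_integral_density) (auto simp: split_beta)
  also have "\<dots> = (\<integral>\<^sup>+z. ennreal (1 + snd z powr r) * f z * indicator (\<Omega> \<times> {0..}) z \<partial>lebesgue)"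
    using Xr_sets(1)[OF assms(1)] by (intro nn_integral_restrict_space) simp
  finally show ?thesis .
qed

text \<open>The common form of both gain operators: \<open>B_op\<close> has the kernel b(x,m,s)
  a(x,s), \<open>maj_B_op\<close> the kernel \<open>\<alpha>2 s * \<beta> (m, s)\<close>.\<close>

definition kern :: "('x \<times> real \<times> real \<Rightarrow> real) \<Rightarrow> ('x \<times> real \<Rightarrow> real) \<Rightarrow> 'x \<times> real \<Rightarrow> real" where
  "kern k u = (\<lambda>(x, m). LINT s:{m..}|lebesgue. k (x, m, s) * u (x, s))"

text \<open>\<open>k_bound\<close> is a column condition: it bounds the weighted mass of all
  fragments issuing from one source (x, s) by the weight of the source. Integrated against |u|, it
  becomes the relative bound with constants 1/2 and C.\<close>

locale kernel_operator =
  fixes \<Omega> :: "'x::euclidean_space set" and r :: real and q :: "'x \<times> real \<Rightarrow> real"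
    and k :: "'x \<times> real \<times> real \<Rightarrow> real" and C :: real
  assumes \<Omega>: "open \<Omega>"
    and k_meas: "k \<in> borel_measurable (lebesgue_on (\<Omega> \<times> {0..} \<times> {0..}))"
    and k_nonneg: "AE z in lebesgue_on (\<Omega> \<times> {0..} \<times> {0..}). 0 \<le> k z"
    and q_nonneg: "AE y in lebesgue_on (\<Omega> \<times> {0..}). 0 \<le> q y"
    and C: "0 \<le> C"
    and k_bound: "AE y in lebesgue_on (\<Omega> \<times> {0..}).
      (\<integral>\<^sup>+m\<in>{0..snd y}. ennreal (k (fst y, m, snd y)) * ennreal (1 + m powr r) \<partial>lebesgue)
        \<le> ennreal ((1 + snd y powr r) * (1 / 2 * q y + C))"
begin

text \<open>The integrand extended by zero outside x in \<Omega> and 0 \<le> m \<le> s, so that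
  Tonelli can be applied on the whole space in either order.\<close>

definition F :: "('x \<times> real \<Rightarrow> real) \<Rightarrow> 'x \<times> real \<times> real \<Rightarrow> real" where
  "F u z = (if fst z \<in> \<Omega> \<and> 0 \<le> fst (snd z) \<and> fst (snd z) \<le> snd (snd z)
     then k z * u (fst z, snd (snd z)) else 0)"

abbreviation (input) "S \<equiv> \<Omega> \<times> {0::real..}"
abbreviation (input) "S3 \<equiv> \<Omega> \<times> {0::real..} \<times> {0::real..}"

lemma S_sets: "S \<in> sets lebesgue" "S3 \<in> sets lebesgue"
  using Xr_sets[OF \<Omega>] by auto

lemma k0_meas: "(\<lambda>z. indicator S3 z * k z) \<in> borel_measurable lebesgue"
  using k_meas S_sets by (simp add: borel_measurable_restrict_space_iff)

lemma k_nonneg_AE: "AE z in lebesgue. z \<in> S3 \<longrightarrow> 0 \<le> k z"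
  using k_nonneg S_sets by (subst (asm) AE_restrict_space_iff) auto

lemma F_meas:
  assumes "u \<in> borel_measurable (lebesgue_on S)"
  shows "F u \<in> borel_measurable lebesgue"
proof -
  let ?T = "{z :: 'x \<times> real \<times> real. 0 \<le> fst (snd z) \<and> fst (snd z) \<le> snd (snd z)}"
  have "closed ?T"
    by (intro closed_Collect_conj closed_Collect_le continuous_intros)
  then have T: "?T \<in> sets lebesgue" by (intro sets_completionI_sets) auto
  have u0: "(\<lambda>z. indicator S z * u z) \<in> borel_measurable lebesgue"
    using assms S_sets by (simp add: borel_measurable_restrict_space_iff)
  have "(\<lambda>z. indicator ?T z * ((indicator S3 z * k z) *
      (\<lambda>y. indicator S y * u y) (fst z, snd (snd z)))) \<in> borel_measurable lebesgue"
    using k0_meas borel_measurable_lebesgue_outer[OF u0, where 'b = real] T by measurable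
  moreover have "(\<lambda>z. indicator ?T z * ((indicator S3 z * k z) *
      (\<lambda>y. indicator S y * u y) (fst z, snd (snd z)))) = F u"
    by (auto simp: F_def indicator_def fun_eq_iff)
  ultimately show ?thesis by simp
qed

lemma L1_meas: "u \<in> L1 (Xr \<Omega> r) \<Longrightarrow> u \<in> borel_measurable (lebesgue_on S)"
  using L1_Xr_iff[OF \<Omega>] by blast

abbreviation "D \<equiv> {u \<in> L1 (Xr \<Omega> r). (\<lambda>z. q z * u z) \<in> L1 (Xr \<Omega> r)}"

lemma wF_meas:
  assumes "u \<in> borel_measurable (lebesgue_on S)"
  shows "(\<lambda>z. ennreal \<bar>F u z\<bar> * ennreal (1 + fst (snd z) powr r)) \<in> borel_measurable lebesgue"
proof -
  have "(\<lambda>z :: 'x \<times> real \<times> real. fst (snd z)) \<in> borel_measurable borel"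
    by (intro borel_measurable_continuous_onI continuous_intros)
  then have "(\<lambda>z :: 'x \<times> real \<times> real. ennreal (1 + fst (snd z) powr r)) \<in> borel_measurable borel"
    by measurable
  then have "(\<lambda>z :: 'x \<times> real \<times> real. ennreal (1 + fst (snd z) powr r)) \<in> borel_measurable lebesgue"
    by (intro measurable_completion) simp
  then show ?thesis using F_meas[OF assms] by measurable
qed

lemma F_section_bound:
  assumes u: "u \<in> borel_measurable (lebesgue_on S)"
  shows "AE y in lebesgue. (\<integral>\<^sup>+m. ennreal \<bar>F u (fst y, m, snd y)\<bar> * ennreal (1 + m powr r) \<partial>lebesgue)
    \<le> ennreal (1 + snd y powr r) * ennreal (\<bar>u y\<bar> * (1 / 2 * q y + C)) * indicator S y"
proof -
  \<comment> \<open>Sections in m need to be measurable to pull the factor |u| out of the integral;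
    a Borel version of the kernel has this for every (x, s), and agrees with it on almost every
    section.\<close>
  obtain kb where kb: "kb \<in> borel_measurable lborel" "AE z in lborel. indicator S3 z * k z = kb z"
    using completion_ex_borel_measurable_real[OF k0_meas] by blast
  have "AE z in lebesgue. indicator S3 z * k z = kb z" using kb(2) by (simp add: AE_completion_iff)
  from AE_lebesgue_triple(2)[OF this] AE_lebesgue_triple(2)[OF k_nonneg_AE]
    k_bound[unfolded AE_Xr_iff(2)[OF \<Omega>]] q_nonneg[unfolded AE_Xr_iff(2)[OF \<Omega>]]
  show ?thesis
  proof eventually_elim
    fix y :: "'x \<times> real"
    assume a: "AE m in lebesgue. indicator S3 (fst y, m, snd y) * k (fst y, m, snd y) = kb (fst y, m, snd y)"
      and b: "AE m in lebesgue. (fst y, m, snd y) \<in> S3 \<longrightarrow> 0 \<le> k (fst y, m, snd y)"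
      and c: "y \<in> S \<longrightarrow> (\<integral>\<^sup>+m\<in>{0..snd y}. ennreal (k (fst y, m, snd y)) * ennreal (1 + m powr r) \<partial>lebesgue)
        \<le> ennreal ((1 + snd y powr r) * (1 / 2 * q y + C))"
      and d: "y \<in> S \<longrightarrow> 0 \<le> q y"
    show "(\<integral>\<^sup>+m. ennreal \<bar>F u (fst y, m, snd y)\<bar> * ennreal (1 + m powr r) \<partial>lebesgue)
      \<le> ennreal (1 + snd y powr r) * ennreal (\<bar>u y\<bar> * (1 / 2 * q y + C)) * indicator S y"
    proof (cases "y \<in> S")
      case False
      then have "F u (fst y, m, snd y) = 0" for m by (cases y) (auto simp: F_def)
      then show ?thesis by simp
    next
      case True
      then have s: "fst y \<in> \<Omega>" "0 \<le> snd y" by auto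
      let ?h = "\<lambda>m. ennreal (kb (fst y, m, snd y)) * ennreal (1 + m powr r) * indicator {0..snd y} m"
      have kbm: "(\<lambda>m. kb (fst y, m, snd y)) \<in> borel_measurable borel"
        by (rule borel_measurable_comp_continuous[where g = kb]) (use kb(1) in \<open>auto intro!: continuous_intros\<close>)
      have hm: "?h \<in> borel_measurable lebesgue"
      proof -
        have "(\<lambda>m :: real. ennreal (1 + m powr r)) \<in> borel_measurable borel"
          "(indicator {0..snd y} :: real \<Rightarrow> ennreal) \<in> borel_measurable borel" by measurable
        then have "?h \<in> borel_measurable borel" using kbm by measurable
        then show ?thesis by (intro measurable_completion) simp
      qed
      have "(\<integral>\<^sup>+m. ennreal \<bar>F u (fst y, m, snd y)\<bar> * ennreal (1 + m powr r) \<partial>lebesgue) =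
          (\<integral>\<^sup>+m. ennreal \<bar>u y\<bar> * ?h m \<partial>lebesgue)"
        using a b
      proof (intro nn_integral_cong_AE, eventually_elim)
        fix m assume a: "indicator S3 (fst y, m, snd y) * k (fst y, m, snd y) = kb (fst y, m, snd y)"
          and b: "(fst y, m, snd y) \<in> S3 \<longrightarrow> 0 \<le> k (fst y, m, snd y)"
        show "ennreal \<bar>F u (fst y, m, snd y)\<bar> * ennreal (1 + m powr r) = ennreal \<bar>u y\<bar> * ?h m"
        proof (cases "m \<in> {0..snd y}")
          case True
          then have "kb (fst y, m, snd y) = k (fst y, m, snd y)" "0 \<le> k (fst y, m, snd y)"
            using a b s by auto
          then show ?thesis using True s
            by (simp add: F_def abs_mult ennreal_mult mult_ac)
        next
          case False
          then show ?thesis by (auto simp: F_def)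
        qed
      qed
      also have "\<dots> = ennreal \<bar>u y\<bar> * (\<integral>\<^sup>+m. ?h m \<partial>lebesgue)"
        by (rule nn_integral_cmult[OF hm])
      also have "(\<integral>\<^sup>+m. ?h m \<partial>lebesgue) =
          (\<integral>\<^sup>+m\<in>{0..snd y}. ennreal (k (fst y, m, snd y)) * ennreal (1 + m powr r) \<partial>lebesgue)"
        using a
      proof (intro nn_integral_cong_AE, eventually_elim)
        fix m assume "indicator S3 (fst y, m, snd y) * k (fst y, m, snd y) = kb (fst y, m, snd y)"
        then show "?h m = ennreal (k (fst y, m, snd y)) * ennreal (1 + m powr r) * indicator {0..snd y} m"
          using s by (cases "m \<in> {0..snd y}") auto
      qed
      also have "ennreal \<bar>u y\<bar> * \<dots> \<le> ennreal \<bar>u y\<bar> * ennreal ((1 + snd y powr r) * (1 / 2 * q y + C))"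
        using c True by (intro mult_left_mono) auto
      also have "\<dots> = ennreal (1 + snd y powr r) * ennreal (\<bar>u y\<bar> * (1 / 2 * q y + C))"
      proof -
        have p: "0 \<le> 1 / 2 * q y + C" using d True C by simp
        have p': "0 \<le> 1 + snd y powr r" by (simp add: add_nonneg_nonneg)
        show ?thesis
          unfolding ennreal_mult[OF p' p] ennreal_mult[OF abs_ge_zero p] by (rule mult.left_commute)
      qed
      finally show ?thesis using True by simp
    qed
  qed
qed

lemma nn_integral_triple_lebesgue:
  fixes f :: "'x \<times> real \<times> real \<Rightarrow> ennreal"
  assumes "f \<in> borel_measurable lebesgue"
  shows "(\<integral>\<^sup>+z. f z \<partial>lebesgue) = (\<integral>\<^sup>+y. \<integral>\<^sup>+s. f (fst y, snd y, s) \<partial>lebesgue \<partial>lebesgue)"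
    "(\<integral>\<^sup>+z. f z \<partial>lebesgue) = (\<integral>\<^sup>+y. \<integral>\<^sup>+m. f (fst y, m, snd y) \<partial>lebesgue \<partial>lebesgue)"
proof -
  obtain g where g: "g \<in> borel_measurable lborel" "AE z in lborel. f z = g z"
    using completion_ex_borel_measurable[OF assms] by blast
  have gb: "g \<in> borel_measurable borel" using g(1) by simp
  have AE: "AE z in lebesgue. f z = g z" using g(2) by (simp add: AE_completion_iff)
  have "(\<integral>\<^sup>+z. f z \<partial>lebesgue) = (\<integral>\<^sup>+z. g z \<partial>lborel)"
    using g(2) by (simp add: nn_integral_completion nn_integral_cong_AE)
  moreover have "(\<integral>\<^sup>+y. \<integral>\<^sup>+s. f (fst y, snd y, s) \<partial>lebesgue \<partial>lebesgue) =
      (\<integral>\<^sup>+y. \<integral>\<^sup>+s. g (fst y, snd y, s) \<partial>lebesgue \<partial>lebesgue)"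
    by (intro nn_integral_cong_AE eventually_mono[OF AE_lebesgue_triple(1)[OF AE]])
  moreover have "(\<integral>\<^sup>+y. \<integral>\<^sup>+m. f (fst y, m, snd y) \<partial>lebesgue \<partial>lebesgue) =
      (\<integral>\<^sup>+y. \<integral>\<^sup>+m. g (fst y, m, snd y) \<partial>lebesgue \<partial>lebesgue)"
    by (intro nn_integral_cong_AE eventually_mono[OF AE_lebesgue_triple(2)[OF AE]])
  ultimately show "(\<integral>\<^sup>+z. f z \<partial>lebesgue) = (\<integral>\<^sup>+y. \<integral>\<^sup>+s. f (fst y, snd y, s) \<partial>lebesgue \<partial>lebesgue)"
    "(\<integral>\<^sup>+z. f z \<partial>lebesgue) = (\<integral>\<^sup>+y. \<integral>\<^sup>+m. f (fst y, m, snd y) \<partial>lebesgue \<partial>lebesgue)"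
    using nn_integral_lborel_triple[OF gb] by (simp_all add: nn_integral_completion)
qed

text \<open>The target mass m is integrated first, so that the column bound applies for each source,
  and the remaining integral is the norm of (q/2 + C) u in the weighted space.\<close>

lemma F_bound:
  assumes u: "u \<in> D"
  shows "(\<integral>\<^sup>+z. ennreal \<bar>F u z\<bar> * ennreal (1 + fst (snd z) powr r) \<partial>lebesgue)
    \<le> ennreal (1 / 2 * L1_norm (Xr \<Omega> r) (\<lambda>z. q z * u z) + C * L1_norm (Xr \<Omega> r) u)"
proof -
  have uL: "u \<in> L1 (Xr \<Omega> r)" and qu: "(\<lambda>z. q z * u z) \<in> L1 (Xr \<Omega> r)" using u by auto
  note um = L1_meas[OF uL] and qum = L1_meas[OF qu]
  have "(\<integral>\<^sup>+z. ennreal \<bar>F u z\<bar> * ennreal (1 + fst (snd z) powr r) \<partial>lebesgue) =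
      (\<integral>\<^sup>+y. \<integral>\<^sup>+m. ennreal \<bar>F u (fst y, m, snd y)\<bar> * ennreal (1 + m powr r) \<partial>lebesgue \<partial>lebesgue)"
    using nn_integral_triple_lebesgue(2)[OF wF_meas[OF um]] by simp
  also have "\<dots> \<le> (\<integral>\<^sup>+y. ennreal (1 + snd y powr r) * ennreal (\<bar>u y\<bar> * (1 / 2 * q y + C)) * indicator S y \<partial>lebesgue)"
    by (intro nn_integral_mono_AE F_section_bound um)
  also have "\<dots> = (\<integral>\<^sup>+y. ennreal (1 + snd y powr r) * ennreal (1 / 2 * \<bar>q y * u y\<bar> + C * \<bar>u y\<bar>) * indicator S y \<partial>lebesgue)"
    using q_nonneg[unfolded AE_Xr_iff(2)[OF \<Omega>]]
  proof (intro nn_integral_cong_AE, eventually_elim)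
    fix y assume "y \<in> S \<longrightarrow> 0 \<le> q y"
    then have "y \<in> S \<Longrightarrow> \<bar>u y\<bar> * (1 / 2 * q y + C) = 1 / 2 * \<bar>q y * u y\<bar> + C * \<bar>u y\<bar>"
      by (simp add: abs_mult algebra_simps)
    then show "ennreal (1 + snd y powr r) * ennreal (\<bar>u y\<bar> * (1 / 2 * q y + C)) * indicator S y =
        ennreal (1 + snd y powr r) * ennreal (1 / 2 * \<bar>q y * u y\<bar> + C * \<bar>u y\<bar>) * indicator S y"
      by (cases "y \<in> S") (simp_all only: indicator_def if_True if_False of_bool_eq simp_thms mult_zero_right)
  qed
  also have "\<dots> = (\<integral>\<^sup>+y. ennreal (1 / 2 * \<bar>q y * u y\<bar> + C * \<bar>u y\<bar>) \<partial>Xr \<Omega> r)"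
    by (intro nn_integral_Xr_density[OF \<Omega>, symmetric] measurable_compose[OF _ measurable_ennreal]
        borel_measurable_add borel_measurable_times borel_measurable_const borel_measurable_abs um qum)
  also have "\<dots> = ennreal (LINT y|Xr \<Omega> r. 1 / 2 * \<bar>q y * u y\<bar> + C * \<bar>u y\<bar>)"
    using uL qu C by (intro nn_integral_eq_integral) (auto simp: L1_def)
  also have "(LINT y|Xr \<Omega> r. 1 / 2 * \<bar>q y * u y\<bar> + C * \<bar>u y\<bar>) =
      1 / 2 * L1_norm (Xr \<Omega> r) (\<lambda>z. q z * u z) + C * L1_norm (Xr \<Omega> r) u"
    using uL qu unfolding L1_norm_def
    by (subst Bochner_Integration.integral_add) (auto simp: L1_def)
  finally show ?thesis .
qed

lemma kern_section:
  assumes y: "y \<in> S"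
  shows "(\<lambda>s. indicator {snd y..} s *\<^sub>R (k (fst y, snd y, s) * u (fst y, s))) = (\<lambda>s. F u (fst y, snd y, s))"
  using y by (auto simp: F_def indicator_def fun_eq_iff)

lemma kern_eq:
  assumes y: "y \<in> S"
  shows "kern k u y = (LINT s|lebesgue. F u (fst y, snd y, s))"
  using kern_section[OF y, of u] by (simp add: kern_def split_beta set_lebesgue_integral_def)

text \<open>The triple integral of \<open>F_bound\<close> is now read with m outside. The weight 1 +
  m^r is constant in the inner integral and at least 1, so finiteness of the total makes almost
  every inner integral absolutely convergent. Measurability of the result is taken from a Borel
  version of the integrand.\<close>

lemma kern_props:
  assumes u: "u \<in> D"
  shows "AE y in lebesgue. integrable lebesgue (\<lambda>s. F u (fst y, snd y, s))"
    and "kern k u \<in> L1 (Xr \<Omega> r)"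
    and "L1_norm (Xr \<Omega> r) (kern k u) \<le> 1 / 2 * L1_norm (Xr \<Omega> r) (\<lambda>z. q z * u z) + C * L1_norm (Xr \<Omega> r) u"
proof -
  let ?c = "1 / 2 * L1_norm (Xr \<Omega> r) (\<lambda>z. q z * u z) + C * L1_norm (Xr \<Omega> r) u"
  have um: "u \<in> borel_measurable (lebesgue_on S)" using L1_meas u by blast
  obtain g where g: "g \<in> borel_measurable lborel" "AE z in lborel. F u z = g z"
    using completion_ex_borel_measurable_real[OF F_meas[OF um]] by blast
  have gb: "g \<in> borel_measurable borel" using g(1) by simp
  have "AE z in lebesgue. F u z = g z" using g(2) by (simp add: AE_completion_iff)
  note AEs = AE_lebesgue_triple(1)[OF this]
  have sec: "(\<lambda>s. g (fst y, snd y, s)) \<in> borel_measurable borel" for y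
    by (rule borel_measurable_comp_continuous[OF gb]) (intro continuous_intros)
  let ?I = "\<lambda>y. \<integral>\<^sup>+s. ennreal \<bar>g (fst y, snd y, s)\<bar> \<partial>lborel"
  have gs: "(\<lambda>z. g (fst (fst z), snd (fst z), snd z)) \<in> borel_measurable (lborel \<Otimes>\<^sub>M lborel)"
    using borel_measurable_shuffle(1)[OF gb] by (simp add: lborel_prod)
  have Im: "?I \<in> borel_measurable lborel"
    using lborel.borel_measurable_nn_integral_fst[of "\<lambda>z. ennreal \<bar>g (fst (fst z), snd (fst z), snd z)\<bar>" lborel] gs
    by simp
  have "(\<integral>\<^sup>+y. ennreal (1 + snd y powr r) * ?I y \<partial>lebesgue) =
      (\<integral>\<^sup>+y. \<integral>\<^sup>+s. ennreal \<bar>F u (fst y, snd y, s)\<bar> * ennreal (1 + snd y powr r) \<partial>lebesgue \<partial>lebesgue)"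
    using AEs
  proof (intro nn_integral_cong_AE, eventually_elim)
    fix y assume a: "AE s in lebesgue. F u (fst y, snd y, s) = g (fst y, snd y, s)"
    have "(\<integral>\<^sup>+s. ennreal \<bar>F u (fst y, snd y, s)\<bar> * ennreal (1 + snd y powr r) \<partial>lebesgue) =
        (\<integral>\<^sup>+s. ennreal \<bar>g (fst y, snd y, s)\<bar> * ennreal (1 + snd y powr r) \<partial>lebesgue)"
      by (intro nn_integral_cong_AE eventually_mono[OF a]) simp
    also have "\<dots> = ?I y * ennreal (1 + snd y powr r)"
      unfolding nn_integral_completion using sec[of y] by (intro nn_integral_multc) measurable
    finally show "ennreal (1 + snd y powr r) * ?I y =
        (\<integral>\<^sup>+s. ennreal \<bar>F u (fst y, snd y, s)\<bar> * ennreal (1 + snd y powr r) \<partial>lebesgue)"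
      by (simp add: mult.commute)
  qed
  also have "\<dots> = (\<integral>\<^sup>+z. ennreal \<bar>F u z\<bar> * ennreal (1 + fst (snd z) powr r) \<partial>lebesgue)"
    using nn_integral_triple_lebesgue(1)[OF wF_meas[OF um]] by simp
  also have "\<dots> \<le> ennreal ?c" by (rule F_bound[OF u])
  finally have wI: "(\<integral>\<^sup>+y. ennreal (1 + snd y powr r) * ?I y \<partial>lebesgue) \<le> ennreal ?c" .
  have "(\<integral>\<^sup>+y. ?I y \<partial>lborel) \<le> (\<integral>\<^sup>+y. ennreal (1 + snd y powr r) * ?I y \<partial>lborel)"
  proof (intro nn_integral_mono)
    fix y :: "'x \<times> real"
    have "1 * ?I y \<le> ennreal (1 + snd y powr r) * ?I y"
      by (intro mult_right_mono) (simp_all flip: ennreal_1)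
    then show "?I y \<le> ennreal (1 + snd y powr r) * ?I y" by simp
  qed
  also have "\<dots> \<le> ennreal ?c" using wI by (simp add: nn_integral_completion)
  finally have "(\<integral>\<^sup>+y. ?I y \<partial>lborel) \<noteq> \<infinity>" by (auto simp: top_unique)
  then have fin: "AE y in lebesgue. ?I y \<noteq> \<infinity>"
    using nn_integral_PInf_AE[OF Im] by (simp add: AE_completion_iff)
  have eq: "AE y in lebesgue. integrable lebesgue (\<lambda>s. F u (fst y, snd y, s)) \<and>
      (LINT s|lebesgue. F u (fst y, snd y, s)) = (LINT s|lborel. g (fst y, snd y, s))"
    using AEs fin
  proof eventually_elim
    fix y assume a: "AE s in lebesgue. F u (fst y, snd y, s) = g (fst y, snd y, s)" and b: "?I y \<noteq> \<infinity>"
    have gm: "(\<lambda>s. g (fst y, snd y, s)) \<in> borel_measurable lebesgue"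
      using sec[of y] by (intro measurable_completion) simp
    then have Fm: "(\<lambda>s. F u (fst y, snd y, s)) \<in> borel_measurable lebesgue"
      by (rule borel_measurable_AE) (use a in eventually_elim, simp)
    have gi: "integrable lborel (\<lambda>s. g (fst y, snd y, s))"
      using b sec[of y] by (simp add: integrable_iff_bounded top.not_eq_extremum)
    then have "integrable lebesgue (\<lambda>s. g (fst y, snd y, s))"
      using sec[of y] by (simp add: integrable_completion)
    then have "integrable lebesgue (\<lambda>s. F u (fst y, snd y, s))"
      using integrable_cong_AE[OF Fm gm a] by simp
    moreover have "(LINT s|lebesgue. F u (fst y, snd y, s)) = (LINT s|lborel. g (fst y, snd y, s))"
      using integral_cong_AE[OF Fm gm a] sec[of y] by (simp add: integral_completion)
    ultimately show "integrable lebesgue (\<lambda>s. F u (fst y, snd y, s)) \<and>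
      (LINT s|lebesgue. F u (fst y, snd y, s)) = (LINT s|lborel. g (fst y, snd y, s))" by simp
  qed
  then show "AE y in lebesgue. integrable lebesgue (\<lambda>s. F u (fst y, snd y, s))"
    by eventually_elim simp
  let ?\<Gamma> = "\<lambda>y. LINT s|lborel. g (fst y, snd y, s)"
  have "?\<Gamma> \<in> borel_measurable lborel"
    using lborel.borel_measurable_lebesgue_integral[of "\<lambda>y s. g (fst y, snd y, s)" lborel] gs
    by (simp add: split_beta)
  then have Gm: "?\<Gamma> \<in> borel_measurable lebesgue" by (rule measurable_completion)
  have kG: "AE y in lebesgue. indicator S y * ?\<Gamma> y = indicator S y * kern k u y"
    using eq
  proof eventually_elim
    fix y assume "integrable lebesgue (\<lambda>s. F u (fst y, snd y, s)) \<and>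
      (LINT s|lebesgue. F u (fst y, snd y, s)) = ?\<Gamma> y"
    then show "indicator S y * ?\<Gamma> y = indicator S y * kern k u y"
      by (cases "y \<in> S") (simp_all add: kern_eq)
  qed
  have "(\<lambda>y. indicator S y * ?\<Gamma> y) \<in> borel_measurable lebesgue" using Gm S_sets(1) by measurable
  then have "(\<lambda>y. indicator S y * kern k u y) \<in> borel_measurable lebesgue"
    by (rule borel_measurable_AE[OF _ kG])
  then have km: "kern k u \<in> borel_measurable (lebesgue_on S)"
    using S_sets(1) by (simp add: borel_measurable_restrict_space_iff)
  have "(\<integral>\<^sup>+y. ennreal \<bar>kern k u y\<bar> \<partial>Xr \<Omega> r) =
      (\<integral>\<^sup>+y. ennreal (1 + snd y powr r) * ennreal \<bar>kern k u y\<bar> * indicator S y \<partial>lebesgue)"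
    using km by (intro nn_integral_Xr_density[OF \<Omega>]) measurable
  also have "\<dots> \<le> (\<integral>\<^sup>+y. ennreal (1 + snd y powr r) * ?I y \<partial>lebesgue)"
    using kG
  proof (intro nn_integral_mono_AE, eventually_elim)
    fix y assume a: "indicator S y * ?\<Gamma> y = indicator S y * kern k u y"
    show "ennreal (1 + snd y powr r) * ennreal \<bar>kern k u y\<bar> * indicator S y \<le> ennreal (1 + snd y powr r) * ?I y"
    proof (cases "y \<in> S")
      case True
      then have "kern k u y = ?\<Gamma> y" using a by simp
      \<comment> \<open>If the section is not integrable, its integral is 0 by convention and the
        inequality still holds.\<close>
      moreover have "ennreal \<bar>?\<Gamma> y\<bar> \<le> ?I y"
        using integral_norm_bound_ennreal[of lborel "\<lambda>s. g (fst y, snd y, s)"]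
        by (cases "integrable lborel (\<lambda>s. g (fst y, snd y, s))") (simp_all add: not_integrable_integral_eq)
      ultimately show ?thesis using True by (simp add: mult_left_mono)
    qed simp
  qed
  also note wI
  finally have kb: "(\<integral>\<^sup>+y. ennreal \<bar>kern k u y\<bar> \<partial>Xr \<Omega> r) \<le> ennreal ?c" .
  then have "(\<integral>\<^sup>+y. ennreal \<bar>kern k u y\<bar> \<partial>Xr \<Omega> r) < \<infinity>" by (rule order_le_less_trans) simp
  then show kL: "kern k u \<in> L1 (Xr \<Omega> r)"
    using km by (simp add: L1_def integrable_iff_bounded L1_Xr_measurable)
  have "0 \<le> ?c" using C L1_norm_nonneg by (intro add_nonneg_nonneg mult_nonneg_nonneg) auto
  moreover have "ennreal (L1_norm (Xr \<Omega> r) (kern k u)) \<le> ennreal ?c"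
    using kb by (simp only: ennreal_L1_norm[OF kL])
  ultimately show "L1_norm (Xr \<Omega> r) (kern k u) \<le> ?c"
    by (simp only: ennreal_le_iff)
qed

lemma kern_lin:
  assumes u: "u \<in> D" and v: "v \<in> D"
  shows "AE y in Xr \<Omega> r. kern k (\<lambda>z. c * u z + d * v z) y = c * kern k u y + d * kern k v y"
  unfolding AE_Xr_iff[OF \<Omega>]
  using kern_props(1)[OF u] kern_props(1)[OF v]
proof eventually_elim
  fix y assume i: "integrable lebesgue (\<lambda>s. F u (fst y, snd y, s))"
    "integrable lebesgue (\<lambda>s. F v (fst y, snd y, s))"
  have F: "F (\<lambda>z. c * u z + d * v z) w = c * F u w + d * F v w" for w
    by (simp add: F_def algebra_simps)
  show "y \<in> S \<longrightarrow> kern k (\<lambda>z. c * u z + d * v z) y = c * kern k u y + d * kern k v y"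
    using i by (simp add: kern_eq F del: mem_Times_iff)
qed

lemma kern_nonneg:
  assumes u: "AE y in Xr \<Omega> r. 0 \<le> u y"
  shows "AE y in Xr \<Omega> r. 0 \<le> kern k u y"
proof -
  have "AE z in lebesgue. 0 \<le> F u z"
    using AE_lebesgue_outer[OF u[unfolded AE_Xr_iff[OF \<Omega>]]] k_nonneg_AE
    by eventually_elim (auto simp: F_def)
  from AE_lebesgue_triple(1)[OF this] show ?thesis
    unfolding AE_Xr_iff[OF \<Omega>]
    by eventually_elim (auto simp: kern_eq intro!: integral_nonneg_AE simp del: mem_Times_iff)
qed

end

section \<open>Moments of the daughter distribution\<close>

lemma nn_integral_lebesgue_scale:
  fixes f :: "real \<Rightarrow> ennreal"
  assumes f: "f \<in> borel_measurable lebesgue" and c: "0 < c"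
  shows "(\<integral>\<^sup>+x. f x \<partial>lebesgue) = ennreal c * (\<integral>\<^sup>+x. f (c * x) \<partial>lebesgue)"
proof -
  obtain g where g: "g \<in> borel_measurable lborel" "AE x in lborel. f x = g x"
    using completion_ex_borel_measurable[OF f] by blast
  have "AE x in lebesgue. f x = g x" using g(2) by (simp add: AE_completion_iff)
  then obtain N where N: "N \<in> sets borel" "(\<integral>\<^sup>+x. indicator N x \<partial>lborel) = (0::ennreal)" "\<And>x. x \<notin> N \<Longrightarrow> f x = g x"
    using lebesgue_null_borel by blast
  have "AE x in lborel. x \<notin> N" using N(1,2) by (intro AE_not_in) (simp add: null_sets_def)
  then have "AE x in lborel. 0 + c * x \<notin> N"
    using c N(1) by (intro AE_borel_affine) auto
  then have AE: "AE x in lborel. f (c * x) = g (c * x)" by eventually_elim (use N(3) in simp)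
  have "(\<integral>\<^sup>+x. f x \<partial>lebesgue) = (\<integral>\<^sup>+x. g x \<partial>lborel)"
    using g(2) by (simp add: nn_integral_completion nn_integral_cong_AE)
  also have "\<dots> = ennreal c * (\<integral>\<^sup>+x. g (c * x) \<partial>lborel)"
    using nn_integral_real_affine[of g c 0] g(1) c by simp
  also have "(\<integral>\<^sup>+x. g (c * x) \<partial>lborel) = (\<integral>\<^sup>+x. f (c * x) \<partial>lborel)"
    using AE by (intro nn_integral_cong_AE) (auto elim: eventually_mono)
  finally show ?thesis by (simp add: nn_integral_completion)
qed

text \<open>High powers z^t concentrate near z = 1. On a short interval ending at 1 the family has
  uniformly small mass by equi-integrability; to the left of it z^t is at most (1-d)^n, which beats
  the common bound on the norms.\<close>

lemma equi_integrable_moment: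
  assumes E: "equi_integrable01 E" and e: "0 < e"
  shows "\<exists>\<rho>. \<forall>t\<ge>\<rho>. \<forall>f\<in>E. (\<forall>z\<in>{0..1}. 0 \<le> f z) \<longrightarrow>
    (\<integral>\<^sup>+z\<in>{0..1}. ennreal (z powr t * f z) \<partial>lebesgue) \<le> ennreal e"
proof -
  have "\<exists>Cb. \<forall>f\<in>E. L1_norm (lebesgue_on {0..1}) f \<le> Cb"
    using E by (simp add: equi_integrable01_def)
  then obtain Cb where Cb: "\<And>f. f \<in> E \<Longrightarrow> L1_norm (lebesgue_on {0..1}) f \<le> Cb" by blast
  have "\<forall>\<epsilon>>0. \<exists>\<delta>>0. \<forall>\<Theta>. \<Theta> \<in> sets lebesgue \<and> \<Theta> \<subseteq> {0..1} \<and> measure lebesgue \<Theta> < \<delta> \<longrightarrow>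
      (SUP f\<in>E. \<integral>\<^sup>+z\<in>\<Theta>. ennreal \<bar>f z\<bar> \<partial>lebesgue) < ennreal \<epsilon>"
    using E[unfolded equi_integrable01_def] by (elim conjE)
  from this[rule_format, OF half_gt_zero[OF e]]
  obtain \<delta> where \<delta>: "0 < \<delta>" "\<And>\<Theta>. \<Theta> \<in> sets lebesgue \<Longrightarrow> \<Theta> \<subseteq> {0..1} \<Longrightarrow> measure lebesgue \<Theta> < \<delta> \<Longrightarrow>
      (SUP f\<in>E. \<integral>\<^sup>+z\<in>\<Theta>. ennreal \<bar>f z\<bar> \<partial>lebesgue) < ennreal (e / 2)"
    by auto
  \<comment> \<open>The interval from 1 - d to 1 has measure d, kept below \<delta>; the cap at 1/2
    keeps 1 - d positive.\<close>
  define d where "d = min (\<delta> / 2) (1 / 2)"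
  have d: "0 < d" "d < 1" "d < \<delta>" using \<delta>(1) by (auto simp: d_def)
  \<comment> \<open>Adding 1 to the absolute value gives a positive bound on the norms, by which one
    can divide.\<close>
  let ?K = "\<bar>Cb\<bar> + 1"
  have "\<exists>n. (1 - d) ^ n < e / (2 * ?K)"
    using d e by (intro real_arch_pow_inv) auto
  then obtain n where n: "(1 - d) ^ n < e / (2 * ?K)" by blast
  have "(\<integral>\<^sup>+z\<in>{0..1}. ennreal (z powr t * f z) \<partial>lebesgue) \<le> ennreal e"
    if t: "t \<ge> real n" and f: "f \<in> E" and nonneg: "\<forall>z\<in>{0..1}. 0 \<le> f z" for t f
  proof -
    have fL: "f \<in> L1 (lebesgue_on {0..1})" using E f by (auto simp: equi_integrable01_def)
    let ?\<phi> = "\<lambda>z. ennreal \<bar>f z\<bar> * indicator {0..1} z"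
    have \<phi>m: "?\<phi> \<in> borel_measurable lebesgue"
      using fL by (subst borel_measurable_restrict_space_iff_ennreal[symmetric]) (auto simp: L1_def)
    have total: "(\<integral>\<^sup>+z. ?\<phi> z \<partial>lebesgue) \<le> ennreal ?K"
    proof -
      have "(\<integral>\<^sup>+z. ?\<phi> z \<partial>lebesgue) = (\<integral>\<^sup>+z. ennreal \<bar>f z\<bar> \<partial>lebesgue_on {0..1})"
        by (subst nn_integral_restrict_space) auto
      also have "\<dots> = ennreal (L1_norm (lebesgue_on {0..1}) f)" by (rule ennreal_L1_norm[OF fL, symmetric])
      also have "\<dots> \<le> ennreal ?K" using Cb[OF f] by (intro ennreal_leI) simp
      finally show ?thesis .
    qed
    let ?\<Theta> = "{1 - d<..1}"
    have "(\<integral>\<^sup>+z\<in>?\<Theta>. ennreal \<bar>f z\<bar> \<partial>lebesgue) \<le> (SUP f\<in>E. \<integral>\<^sup>+z\<in>?\<Theta>. ennreal \<bar>f z\<bar> \<partial>lebesgue)"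
      using f by (rule SUP_upper)
    also have "\<dots> < ennreal (e / 2)" using d by (intro \<delta>(2)) auto
    finally have tail: "(\<integral>\<^sup>+z\<in>?\<Theta>. ennreal \<bar>f z\<bar> \<partial>lebesgue) \<le> ennreal (e / 2)" by simp
    have "(\<integral>\<^sup>+z\<in>{0..1}. ennreal (z powr t * f z) \<partial>lebesgue) \<le>
        (\<integral>\<^sup>+z. ?\<phi> z * indicator ?\<Theta> z + ennreal ((1 - d) ^ n) * ?\<phi> z \<partial>lebesgue)"
    proof (intro nn_integral_mono)
      fix z :: real
      show "ennreal (z powr t * f z) * indicator {0..1} z \<le>
          ?\<phi> z * indicator ?\<Theta> z + ennreal ((1 - d) ^ n) * ?\<phi> z"
      proof (cases "z \<in> {0..1}")
        case True
        then have fz: "0 \<le> f z" and z: "0 \<le> z" "z \<le> 1" using nonneg by auto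
        show ?thesis
        proof (cases "z \<in> ?\<Theta>")
          case True
          have "z powr t \<le> 1" using z t by (intro powr_le1) auto
          then have "z powr t * f z \<le> \<bar>f z\<bar>" using fz by (simp add: mult_left_le_one_le)
          then have "ennreal (z powr t * f z) \<le> ennreal \<bar>f z\<bar> + 0" by (simp add: ennreal_leI)
          also have "\<dots> \<le> ennreal \<bar>f z\<bar> + ennreal ((1 - d) ^ n) * ennreal \<bar>f z\<bar>" by (intro add_left_mono) simp
          finally show ?thesis using True z by (simp add: indicator_def)
        next
          case False
          then have zd: "z \<le> 1 - d" using z by auto
          have "z powr t \<le> (1 - d) ^ n"
          \<comment> \<open>At z = 0 the power is 0 for every exponent, including t = 0;
            monotonicity of \<open>powr\<close> is used for z > 0.\<close>
          proof (cases "z = 0")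
            case False
            then have "z powr t \<le> (1 - d) powr t" using z zd t by (intro powr_mono2) auto
            also have "\<dots> \<le> (1 - d) powr real n" using d t by (intro powr_mono') auto
            also have "\<dots> = (1 - d) ^ n" using d by (simp add: powr_realpow)
            finally show ?thesis .
          qed (use d in simp)
          then have "z powr t * f z \<le> (1 - d) ^ n * \<bar>f z\<bar>" using fz by (simp add: mult_right_mono)
          then have "ennreal (z powr t * f z) \<le> ennreal ((1 - d) ^ n) * ennreal \<bar>f z\<bar>"
            using d by (simp add: ennreal_mult[symmetric] ennreal_leI)
          then show ?thesis using False z by (auto simp: indicator_def)
        qed
      qed simp
    qed
    also have "\<dots> = (\<integral>\<^sup>+z. ?\<phi> z * indicator ?\<Theta> z \<partial>lebesgue) + ennreal ((1 - d) ^ n) * (\<integral>\<^sup>+z. ?\<phi> z \<partial>lebesgue)"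
    proof -
      have "(\<lambda>z. ?\<phi> z * indicator ?\<Theta> z) \<in> borel_measurable lebesgue"
        using \<phi>m by (rule borel_measurable_times_ennreal) (intro borel_measurable_indicator, simp)
      then show ?thesis using \<phi>m by (simp add: nn_integral_add nn_integral_cmult)
    qed
    also have "(\<integral>\<^sup>+z. ?\<phi> z * indicator ?\<Theta> z \<partial>lebesgue) \<le> ennreal (e / 2)"
      using d by (intro order_trans[OF _ tail] nn_integral_mono) (auto simp: indicator_def)
    also have "ennreal ((1 - d) ^ n) * (\<integral>\<^sup>+z. ?\<phi> z \<partial>lebesgue) \<le> ennreal ((1 - d) ^ n) * ennreal ?K"
      by (intro mult_left_mono total) simp
    also have "\<dots> = ennreal ((1 - d) ^ n * ?K)" using d by (simp add: ennreal_mult)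
    also have "\<dots> \<le> ennreal (e / 2)"
    proof (rule ennreal_leI)
      have "(1 - d) ^ n * ?K \<le> e / (2 * ?K) * ?K" using n by (intro mult_right_mono) auto
      also have "\<dots> = e / 2"
      proof -
        have "e / (2 * K) * K = e / 2" if "K \<noteq> 0" for K :: real using that by simp
        moreover have "?K \<noteq> 0" using abs_ge_zero[of Cb] by linarith
        ultimately show ?thesis by blast
      qed
      finally show "(1 - d) ^ n * ?K \<le> e / 2" .
    qed
    also have "ennreal (e / 2) + ennreal (e / 2) = ennreal e"
      using e by (simp flip: ennreal_plus)
    finally show ?thesis by (simp add: add_mono)
  qed
  then show ?thesis by blast
qed

context
  fixes \<beta> :: "real \<times> real \<Rightarrow> real" and \<beta>0 l r0 s0 M :: real
  assumes nonneg: "\<And>m s. m \<ge> 0 \<Longrightarrow> s \<ge> 0 \<Longrightarrow> \<beta> (m, s) \<ge> 0"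
    and mass: "\<And>s. s \<ge> 0 \<Longrightarrow>
      (\<integral>\<^sup>+m\<in>{0..s}. ennreal (\<beta> (m, s)) \<partial>lebesgue) \<le> ennreal (\<beta>0 * (1 + s powr l))"
    and equi: "equi_integrable01 ((\<lambda>s z. s * z powr r0 * \<beta> (z * s, s)) ` {s0..})"
    and l: "0 \<le> l" and r0: "0 \<le> r0" and s0: "0 \<le> s0" and M: "0 < M"
begin

text \<open>The substitution m = s z turns the r-th moment of the fragments of a particle of mass s
  into s^r times a moment over [0,1]. Splitting z^r into z^(r - r0) and z^r0 exposes the
  equi-integrable family, with the exponent r - r0 at our disposal.\<close>

lemma power_moment:
  assumes s: "0 < s" and bm: "(\<lambda>m. indicator {0..} m * \<beta> (m, s)) \<in> borel_measurable lebesgue"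
  shows "(\<integral>\<^sup>+m\<in>{0..s}. ennreal (\<beta> (m, s)) * ennreal (m powr r) \<partial>lebesgue) =
    ennreal (s powr r) * (\<integral>\<^sup>+z\<in>{0..1}. ennreal (z powr (r - r0) * (s * z powr r0 * \<beta> (z * s, s))) \<partial>lebesgue)"
proof -
  let ?f = "\<lambda>m. ennreal (indicator {0..} m * \<beta> (m, s)) * ennreal (m powr r) * indicator {0..s} m"
  have pm: "(\<lambda>m. ennreal (m powr r) * indicator {0..s} m) \<in> borel_measurable lebesgue"
  proof -
    have "(\<lambda>m. ennreal (m powr r) * indicator {0..s} m) \<in> borel_measurable borel" by measurable
    then show ?thesis by (intro measurable_completion) simp
  qed
  have fm: "?f \<in> borel_measurable lebesgue"
    unfolding mult.assoc using measurable_compose[OF bm measurable_ennreal] pm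
    by (rule borel_measurable_times_ennreal)
  let ?h = "\<lambda>z. ennreal (z powr (r - r0) * (s * z powr r0 * \<beta> (z * s, s))) * indicator {0..1} z"
  have eq: "ennreal s * ?f (s * z) = ennreal (s powr r) * ?h z" for z
  proof (cases "0 \<le> z \<and> z \<le> 1")
    case True
    have ind: "indicator {0..s} (s * z) = (1 :: ennreal)" using True s by (simp add: mult_left_le)
    have b: "0 \<le> \<beta> (z * s, s)" using nonneg True s by simp
    have "s * (\<beta> (z * s, s) * (s * z) powr r) =
        s powr r * (z powr (r - r0) * (s * z powr r0 * \<beta> (z * s, s)))"
    \<comment> \<open>The powers of z split only for z > 0; at z = 0 both sides vanish, as
      \<open>0 powr _\<close> is 0.\<close>
    proof (cases "z = 0")
      case False
      then have "z powr r = z powr (r - r0) * z powr r0" by (simp flip: powr_add)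
      then show ?thesis using True s by (simp add: powr_mult mult_ac)
    qed simp
    then have "ennreal s * (ennreal (\<beta> (z * s, s)) * ennreal ((s * z) powr r)) =
        ennreal (s powr r) * ennreal (z powr (r - r0) * (s * z powr r0 * \<beta> (z * s, s)))"
      using b s by (simp flip: ennreal_mult)
    then show ?thesis using True s ind by (simp add: mult.commute[of z s])
  next
    case False
    then have "indicator {0..s} (s * z) = (0 :: ennreal)" using s by (auto simp: indicator_def zero_le_mult_iff)
    then show ?thesis using False by (auto simp: indicator_def)
  qed
  have "(\<integral>\<^sup>+m\<in>{0..s}. ennreal (\<beta> (m, s)) * ennreal (m powr r) \<partial>lebesgue) = (\<integral>\<^sup>+m. ?f m \<partial>lebesgue)"
    by (intro nn_integral_cong) (auto simp: indicator_def)
  also have "\<dots> = ennreal s * (\<integral>\<^sup>+z. ?f (s * z) \<partial>lebesgue)"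
    by (rule nn_integral_lebesgue_scale[OF fm s])
  finally have 1: "(\<integral>\<^sup>+m\<in>{0..s}. ennreal (\<beta> (m, s)) * ennreal (m powr r) \<partial>lebesgue) =
      ennreal s * (\<integral>\<^sup>+z. ?f (s * z) \<partial>lebesgue)" .
  have "?f (s * z) = ennreal (s powr r / s) * ?h z" for z
  proof -
    have "?f (s * z) = ennreal (1 / s) * (ennreal s * ?f (s * z))"
      using s by (simp add: mult.assoc[symmetric] ennreal_mult[symmetric])
    also have "\<dots> = ennreal (1 / s) * (ennreal (s powr r) * ?h z)" by (simp only: eq)
    finally show ?thesis using s by (simp add: mult.assoc[symmetric] ennreal_mult[symmetric])
  qed
  note f_eq = this
  have "ennreal s * (\<integral>\<^sup>+z. ?f (s * z) \<partial>lebesgue) = ennreal (s powr r) * (\<integral>\<^sup>+z. ?h z \<partial>lebesgue)"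
  proof -
    have hm': "?h \<in> borel_measurable lebesgue"
    proof -
      have h_eq: "?h = (\<lambda>z. ennreal (s / s powr r) * ?f (s * z))"
      proof
        fix z
        show "?h z = ennreal (s / s powr r) * ?f (s * z)"
          unfolding f_eq using s by (simp add: mult.assoc[symmetric] ennreal_mult[symmetric])
      qed
      have "(\<lambda>z. ?f (s * z)) \<in> borel_measurable lebesgue"
        using measurable_compose[OF lebesgue_measurable_scaling fm, of s] by simp
      then show ?thesis
        by (subst h_eq) (rule borel_measurable_times_ennreal[OF borel_measurable_const])
    qed
    have "(\<integral>\<^sup>+z. ?f (s * z) \<partial>lebesgue) = ennreal (s powr r / s) * (\<integral>\<^sup>+z. ?h z \<partial>lebesgue)"
      unfolding f_eq by (rule nn_integral_cmult[OF hm'])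
    then show ?thesis using s by (simp add: mult.assoc[symmetric] ennreal_mult[symmetric])
  qed
  with 1 show ?thesis by simp
qed

text \<open>The weight 1 + m^r is treated as two terms. The mass of \<open>\<beta>\<close> is of
  order s^l, hence small against s^r beyond some s1; the moment m^r is small against s^r by
  equi-integrability. For s up to s1 a constant suffices. Measurability of the section is a premise
  on each s because it is available for almost every s only.\<close>

lemma weighted_moment:
  "\<exists>r1 > max l r0. \<forall>r\<ge>r1. \<exists>s1\<ge>0. \<exists>c\<ge>0. \<forall>s\<ge>0.
    (\<lambda>m. indicator {0..} m * \<beta> (m, s)) \<in> borel_measurable lebesgue \<longrightarrow>
    (s1 < s \<longrightarrow> (\<integral>\<^sup>+m\<in>{0..s}. ennreal (\<beta> (m, s)) * ennreal (1 + m powr r) \<partial>lebesgue) \<le> ennreal ((1 + s powr r) / (2 * M))) \<and>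
    (s \<le> s1 \<longrightarrow> (\<integral>\<^sup>+m\<in>{0..s}. ennreal (\<beta> (m, s)) * ennreal (1 + m powr r) \<partial>lebesgue) \<le> ennreal c)"
proof -
  \<comment> \<open>Half of the target 1/(2M) goes to the r-th moment; the other half is reserved
    for the mass term.\<close>
  have "0 < 1 / (4 * M)" using M by simp
  from equi_integrable_moment[OF equi this] obtain \<rho> where \<rho>: "\<And>t s. \<rho> \<le> t \<Longrightarrow> s0 \<le> s \<Longrightarrow>
      (\<forall>z\<in>{0..1}. 0 \<le> s * z powr r0 * \<beta> (z * s, s)) \<Longrightarrow>
      (\<integral>\<^sup>+z\<in>{0..1}. ennreal (z powr t * (s * z powr r0 * \<beta> (z * s, s))) \<partial>lebesgue) \<le> ennreal (1 / (4 * M))"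
    by auto
  show ?thesis
  \<comment> \<open>This choice gives r > l, needed to let s^r dominate s^l, and r - r0 \<ge>
    \<rho>, needed for the small moment; the absolute value covers a negative \<rho>.\<close>
  proof (rule exI[of _ "max l r0 + 1 + \<bar>\<rho>\<bar>"], rule conjI, rule_tac [2] allI, rule_tac [2] impI)
    show "max l r0 < max l r0 + 1 + \<bar>\<rho>\<bar>" by linarith
    fix r assume "max l r0 + 1 + \<bar>\<rho>\<bar> \<le> r"
    then have r: "l < r" "\<rho> \<le> r - r0" by linarith+
    \<comment> \<open>For s \<ge> 1 the mass is at most 2 |\<open>\<beta>0\<close>| s^l, which is
      below s^r/(4M) as soon as s^(r-l) \<ge> 8 |\<open>\<beta>0\<close>| M; the summand 1 keeps K
      positive.\<close>
    define K where "K = 8 * \<bar>\<beta>0\<bar> * M + 1"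
    have K: "0 < K" using M by (simp add: K_def add_nonneg_pos)
    \<comment> \<open>Beyond s1 three facts hold at once: s \<ge> 1 for 1 + s^l \<le> 2 s^l, s \<ge>
      s0 for equi-integrability, and s^(r-l) \<ge> K.\<close>
    define s1 where "s1 = max (max 1 s0) (K powr (1 / (r - l)))"
    \<comment> \<open>For s \<le> s1 the weight is bounded by its value at s1, and so is the
      mass.\<close>
    define c where "c = (1 + s1 powr r) * (\<bar>\<beta>0\<bar> * (1 + s1 powr l))"
    have s1: "1 \<le> s1" "s0 \<le> s1" "K powr (1 / (r - l)) \<le> s1" by (auto simp: s1_def)
    show "\<exists>s1\<ge>0. \<exists>c\<ge>0. \<forall>s\<ge>0.
      (\<lambda>m. indicator {0..} m * \<beta> (m, s)) \<in> borel_measurable lebesgue \<longrightarrow>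
      (s1 < s \<longrightarrow> (\<integral>\<^sup>+m\<in>{0..s}. ennreal (\<beta> (m, s)) * ennreal (1 + m powr r) \<partial>lebesgue) \<le> ennreal ((1 + s powr r) / (2 * M))) \<and>
      (s \<le> s1 \<longrightarrow> (\<integral>\<^sup>+m\<in>{0..s}. ennreal (\<beta> (m, s)) * ennreal (1 + m powr r) \<partial>lebesgue) \<le> ennreal c)"
    proof (rule exI[of _ s1], rule conjI[OF _ exI[of _ c]], rule_tac [2] conjI, rule_tac [3] allI)
      show "0 \<le> s1" using s1 by simp
      show "0 \<le> c" by (simp add: c_def add_nonneg_nonneg)
      fix s :: real
      show "0 \<le> s \<longrightarrow> (\<lambda>m. indicator {0..} m * \<beta> (m, s)) \<in> borel_measurable lebesgue \<longrightarrow>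
        (s1 < s \<longrightarrow> (\<integral>\<^sup>+m\<in>{0..s}. ennreal (\<beta> (m, s)) * ennreal (1 + m powr r) \<partial>lebesgue) \<le> ennreal ((1 + s powr r) / (2 * M))) \<and>
        (s \<le> s1 \<longrightarrow> (\<integral>\<^sup>+m\<in>{0..s}. ennreal (\<beta> (m, s)) * ennreal (1 + m powr r) \<partial>lebesgue) \<le> ennreal c)"
      proof (rule impI, rule impI)
        assume s: "0 \<le> s" and bm: "(\<lambda>m. indicator {0..} m * \<beta> (m, s)) \<in> borel_measurable lebesgue"
        let ?f = "\<lambda>m. ennreal (indicator {0..} m * \<beta> (m, s)) * indicator {0..s} m"
        have fm: "?f \<in> borel_measurable lebesgue"
          using measurable_compose[OF bm measurable_ennreal]
          by (rule borel_measurable_times_ennreal) (intro borel_measurable_indicator, simp)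
        have f_int: "(\<integral>\<^sup>+m. ?f m \<partial>lebesgue) \<le> ennreal (\<beta>0 * (1 + s powr l))"
          using mass[OF s] by (rule order_trans[rotated]) (auto intro!: nn_integral_mono simp: indicator_def)
        show "(s1 < s \<longrightarrow> (\<integral>\<^sup>+m\<in>{0..s}. ennreal (\<beta> (m, s)) * ennreal (1 + m powr r) \<partial>lebesgue) \<le> ennreal ((1 + s powr r) / (2 * M))) \<and>
          (s \<le> s1 \<longrightarrow> (\<integral>\<^sup>+m\<in>{0..s}. ennreal (\<beta> (m, s)) * ennreal (1 + m powr r) \<partial>lebesgue) \<le> ennreal c)"
        proof (intro conjI impI)
          assume "s1 < s"
          then have s': "1 < s" "0 < s" "s0 \<le> s" "K powr (1 / (r - l)) \<le> s" using s1 by auto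
          let ?p = "\<lambda>m. ennreal (m powr r)"
          have pm: "?p \<in> borel_measurable lebesgue"
          proof -
            have "?p \<in> borel_measurable borel" by measurable
            then show ?thesis by (intro measurable_completion) simp
          qed
          have "(\<integral>\<^sup>+m\<in>{0..s}. ennreal (\<beta> (m, s)) * ennreal (1 + m powr r) \<partial>lebesgue) =
              (\<integral>\<^sup>+m. ?f m + ?f m * ?p m \<partial>lebesgue)"
            by (intro nn_integral_cong) (auto simp: indicator_def distrib_left)
          also have "\<dots> = (\<integral>\<^sup>+m. ?f m \<partial>lebesgue) + (\<integral>\<^sup>+m. ?f m * ?p m \<partial>lebesgue)"
            by (intro nn_integral_add fm borel_measurable_times_ennreal pm)
          also have "(\<integral>\<^sup>+m. ?f m * ?p m \<partial>lebesgue) =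
              (\<integral>\<^sup>+m\<in>{0..s}. ennreal (\<beta> (m, s)) * ennreal (m powr r) \<partial>lebesgue)"
            by (intro nn_integral_cong) (auto simp: indicator_def)
          also have "\<dots> = ennreal (s powr r) *
              (\<integral>\<^sup>+z\<in>{0..1}. ennreal (z powr (r - r0) * (s * z powr r0 * \<beta> (z * s, s))) \<partial>lebesgue)"
            by (rule power_moment[OF s'(2) bm])
          also have "(\<integral>\<^sup>+z\<in>{0..1}. ennreal (z powr (r - r0) * (s * z powr r0 * \<beta> (z * s, s))) \<partial>lebesgue)
              \<le> ennreal (1 / (4 * M))"
            using nonneg s by (intro \<rho> r(2) s'(3)) auto
          finally have "(\<integral>\<^sup>+m\<in>{0..s}. ennreal (\<beta> (m, s)) * ennreal (1 + m powr r) \<partial>lebesgue) \<le>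
              (\<integral>\<^sup>+m. ?f m \<partial>lebesgue) + ennreal (s powr r) * ennreal (1 / (4 * M))"
            by - (erule meta_mp, intro add_left_mono mult_left_mono; simp)
          then have "(\<integral>\<^sup>+m\<in>{0..s}. ennreal (\<beta> (m, s)) * ennreal (1 + m powr r) \<partial>lebesgue) \<le>
              ennreal (\<beta>0 * (1 + s powr l)) + ennreal (s powr r) * ennreal (1 / (4 * M))"
            by (rule order_trans) (rule add_right_mono[OF f_int])
          also have "ennreal (\<beta>0 * (1 + s powr l)) \<le> ennreal (s powr r / (4 * M))"
          proof (rule ennreal_leI)
            have "K = (K powr (1 / (r - l))) powr (r - l)" using K r(1) by (simp add: powr_powr)
            also have "\<dots> \<le> s powr (r - l)" using s'(4) r(1) by (intro powr_mono2) auto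
            finally have "K * s powr l \<le> s powr (r - l) * s powr l" by (intro mult_right_mono) auto
            also have "\<dots> = s powr r" by (simp flip: powr_add)
            finally have Ks: "K * s powr l \<le> s powr r" .
            have "1 \<le> s powr l" using s'(1) l by (simp add: ge_one_powr_ge_zero)
            then have "\<beta>0 * (1 + s powr l) \<le> \<bar>\<beta>0\<bar> * (2 * s powr l)" by (intro mult_mono) auto
            also have "\<dots> = (8 * \<bar>\<beta>0\<bar> * M) * s powr l / (4 * M)" using M by simp
            also have "\<dots> \<le> K * s powr l / (4 * M)" using M by (intro divide_right_mono mult_right_mono) (auto simp: K_def)
            also have "\<dots> \<le> s powr r / (4 * M)" using Ks M by (intro divide_right_mono) auto
            finally show "\<beta>0 * (1 + s powr l) \<le> s powr r / (4 * M)" .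
          qed
          also have "ennreal (s powr r / (4 * M)) + ennreal (s powr r) * ennreal (1 / (4 * M)) =
              ennreal (s powr r / (2 * M))"
            using M by (simp add: ennreal_mult[symmetric] ennreal_plus[symmetric] del: ennreal_plus)
          also have "\<dots> \<le> ennreal ((1 + s powr r) / (2 * M))"
            using M by (intro ennreal_leI divide_right_mono) auto
          finally show "(\<integral>\<^sup>+m\<in>{0..s}. ennreal (\<beta> (m, s)) * ennreal (1 + m powr r) \<partial>lebesgue) \<le>
              ennreal ((1 + s powr r) / (2 * M))" by (simp add: add_mono)
        next
          assume le: "s \<le> s1"
          have "(\<integral>\<^sup>+m\<in>{0..s}. ennreal (\<beta> (m, s)) * ennreal (1 + m powr r) \<partial>lebesgue) \<le>
              (\<integral>\<^sup>+m. ennreal (1 + s1 powr r) * ?f m \<partial>lebesgue)"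
          proof (intro nn_integral_mono)
            fix m :: real
            show "ennreal (\<beta> (m, s)) * ennreal (1 + m powr r) * indicator {0..s} m \<le> ennreal (1 + s1 powr r) * ?f m"
            proof (cases "m \<in> {0..s}")
              case True
              then have "m powr r \<le> s1 powr r" using le l r(1) by (intro powr_mono2) auto
              then have "ennreal (\<beta> (m, s)) * ennreal (1 + m powr r) \<le> ennreal (\<beta> (m, s)) * ennreal (1 + s1 powr r)"
                by (intro mult_left_mono ennreal_leI) auto
              then show ?thesis using True by (simp add: mult.commute)
            qed simp
          qed
          also have "\<dots> = ennreal (1 + s1 powr r) * (\<integral>\<^sup>+m. ?f m \<partial>lebesgue)" by (rule nn_integral_cmult[OF fm])
          also have "\<dots> \<le> ennreal (1 + s1 powr r) * ennreal (\<bar>\<beta>0\<bar> * (1 + s1 powr l))"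
          proof (intro mult_left_mono order_trans[OF f_int] ennreal_leI)
            have "s powr l \<le> s1 powr l" using le s l by (intro powr_mono2) auto
            then show "\<beta>0 * (1 + s powr l) \<le> \<bar>\<beta>0\<bar> * (1 + s1 powr l)" by (intro mult_mono) auto
          qed simp
          also have "\<dots> = ennreal c" by (simp add: c_def ennreal_mult)
          finally show "(\<integral>\<^sup>+m\<in>{0..s}. ennreal (\<beta> (m, s)) * ennreal (1 + m powr r) \<partial>lebesgue) \<le> ennreal c" .
        qed
      qed
    qed
  qed
qed

end

section \<open>Slicing the mass variable\<close>

text \<open>The norm is an iterated integral over fibres, so it vanishes; joint measurability of
  \<open>d\<close> is what excludes exceptional sets that are null on each fibre only.\<close>

lemma AE_Xr_fibres:
  fixes \<Omega> :: "'x::euclidean_space set"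
  assumes \<Omega>: "open \<Omega>" and d: "d \<in> L1 (Xr \<Omega> r)"
    and 0: "AE m in lebesgue_on {0..}. AE x in Xx \<Omega>. d (x, m) = 0"
  shows "AE z in Xr \<Omega> r. d z = 0"
proof -
  have "ennreal (L1_norm (Xr \<Omega> r) d) =
      (\<integral>\<^sup>+m. ennreal (L1_norm (Xx \<Omega>) (\<lambda>x. d (x, m)) * (1 + m powr r)) \<partial>lebesgue_on {0..})"
    by (rule L1_norm_Xr[OF \<Omega> d])
  also have "\<dots> = (\<integral>\<^sup>+m. 0 \<partial>lebesgue_on {0::real..})"
    using 0
  proof (intro nn_integral_cong_AE, eventually_elim)
    fix m :: real assume "AE x in Xx \<Omega>. d (x, m) = 0"
    then have "AE x in Xx \<Omega>. \<bar>d (x, m)\<bar> = 0" by eventually_elim simp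
    then show "ennreal (L1_norm (Xx \<Omega>) (\<lambda>x. d (x, m)) * (1 + m powr r)) = 0"
      by (simp add: L1_norm_def integral_eq_zero_AE)
  qed
  finally have "ennreal (L1_norm (Xr \<Omega> r) d) = 0" by simp
  then have "L1_norm (Xr \<Omega> r) d \<le> 0" by (simp only: ennreal_eq_0_iff)
  then show ?thesis using L1_norm_eq_0[OF d] L1_norm_nonneg[of "Xr \<Omega> r" d] by simp
qed

lemma substochastic_zero:
  assumes "substochastic M G" "0 \<le> t"
  shows "AE z in M. G t (\<lambda>y. 0) z = 0"
proof -
  have "\<forall>t\<ge>0. \<forall>u\<in>L1 M. \<forall>v\<in>L1 M. \<forall>c d.
      AE z in M. G t (\<lambda>y. c * u y + d * v y) z = c * G t u z + d * G t v z"
    using assms(1) unfolding substochastic_def positive_semigroup_def C0_semigroup_def by (elim conjE)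
  from this[rule_format, OF assms(2) zero_L1 zero_L1, of 0 0] show ?thesis by simp
qed

lemma substochastic_cong:
  assumes G: "substochastic M G" and t: "0 \<le> t" and u: "u \<in> L1 M" "v \<in> L1 M" "AE z in M. u z = v z"
  shows "AE z in M. G t u z = G t v z"
proof -
  have "emb M u = emb M v" using emb_eq_iff[OF u(1,2)] u(3) by blast
  then have "emb M (G t u) = emb M (G t v)"
    using lift_sg_emb[OF G t u(1)] lift_sg_emb[OF G t u(2)] by simp
  then show ?thesis using emb_eq_iff[OF G_L1[OF G t u(1)] G_L1[OF G t u(2)]] by blast
qed

text \<open>For fixed m the cut either leaves the fibre of u unchanged or replaces it by 0, and the
  fibre semigroup sends 0 to 0. The x-variable is untouched by the cut, which is why it commutes
  with transport.\<close>

lemma fibrewise_slice: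
  fixes \<Omega> :: "'x::euclidean_space set"
  assumes \<Omega>: "open \<Omega>" and I: "I \<in> sets borel"
    and G: "substochastic (Xr \<Omega> r) G"
    and fib: "\<And>u. u \<in> L1 (Xr \<Omega> r) \<Longrightarrow> fibre_eq \<Omega> (G t u) (\<lambda>m. Gx m t (\<lambda>x. u (x, m)))"
    and Gx: "AE m in lebesgue_on {0..}. substochastic (Xx \<Omega>) (Gx m)"
    and t: "0 \<le> t" and u: "u \<in> L1 (Xr \<Omega> r)"
  shows "AE z in Xr \<Omega> r. G t (\<lambda>y. indicator (\<Omega> \<times> I) y * u y) z = indicator (\<Omega> \<times> I) z * G t u z"
proof -
  let ?M = "Xr \<Omega> r"
  \<comment> \<open>Cutting with \<open>I\<close> in m alone makes the fibres equal to those of u,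
    or to 0, as functions on the whole type; with \<Omega> included they could differ outside
    \<Omega>. Both cuts agree almost everywhere in the space.\<close>
  let ?w = "\<lambda>y. indicator (\<Omega> \<times> I) y * u y" and ?v = "\<lambda>y. indicator I (snd y) * u y"
  have vI: "{z \<in> space ?M. snd z \<in> I} \<in> sets ?M"
  proof -
    have "snd -` I \<inter> UNIV \<in> sets (borel :: ('x \<times> real) measure)"
      using measurable_sets[of snd "borel :: ('x \<times> real) measure" borel I] I
      by (simp add: borel_measurable_continuous_onI continuous_on_snd)
    then have "(\<Omega> \<times> {0..}) \<inter> (snd -` I) \<in> sets (lebesgue_on (\<Omega> \<times> {0..}))"
      by (auto simp: sets_restrict_space intro: sets_completionI_sets)
    moreover have "{z \<in> space ?M. snd z \<in> I} = (\<Omega> \<times> {0..}) \<inter> (snd -` I)"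
      by (auto simp: Xr_def space_restrict_space)
    ultimately show ?thesis by (simp add: Xr_def)
  qed
  have cut: "(\<lambda>y. indicator I (snd y) * h y) \<in> L1 ?M" if "h \<in> L1 ?M" for h
  proof -
    have "integrable ?M (\<lambda>y. h y * indicator {z \<in> space ?M. snd z \<in> I} y)"
      using that by (intro integrable_real_mult_indicator vI) (simp add: L1_def)
    then show ?thesis
      unfolding L1_def
      by (simp, subst Bochner_Integration.integrable_cong[OF refl]) (auto simp: indicator_def)
  qed
  have sp: "AE z in ?M. z \<in> \<Omega> \<times> {0..}"
    by (rule AE_I2) (simp add: Xr_def space_restrict_space)
  have vL: "?v \<in> L1 ?M" using cut[OF u] .
  have wv: "AE z in ?M. ?w z = ?v z"
    using sp by eventually_elim (auto simp: indicator_def)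
  have wL: "?w \<in> L1 ?M"
  proof -
    have "integrable ?M ?w"
      using vL unfolding L1_def
      by (simp, subst Bochner_Integration.integrable_cong[OF refl, of _ _ ?v])
        (auto simp: indicator_def Xr_def space_restrict_space)
    then show ?thesis by (simp add: L1_def)
  qed
  let ?d = "\<lambda>z. G t ?v z - indicator I (snd z) * G t u z"
  have dL: "?d \<in> L1 ?M" using L1_diff[OF G_L1[OF G t vL] cut[OF G_L1[OF G t u]]] .
  have "AE m in lebesgue_on {0..}. AE x in Xx \<Omega>. ?d (x, m) = 0"
    using fib[OF u, unfolded fibre_eq_def] fib[OF vL, unfolded fibre_eq_def] Gx
  proof eventually_elim
    fix m assume a: "AE x in Xx \<Omega>. G t u (x, m) = Gx m t (\<lambda>x. u (x, m)) x"
      and b: "AE x in Xx \<Omega>. G t ?v (x, m) = Gx m t (\<lambda>x. ?v (x, m)) x"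
      and c: "substochastic (Xx \<Omega>) (Gx m)"
    show "AE x in Xx \<Omega>. ?d (x, m) = 0"
    proof (cases "m \<in> I")
      case True
      then have "(\<lambda>x. ?v (x, m)) = (\<lambda>x. u (x, m))" by simp
      with b have b': "AE x in Xx \<Omega>. G t ?v (x, m) = Gx m t (\<lambda>x. u (x, m)) x" by simp
      from a b' show ?thesis by eventually_elim (use True in simp)
    next
      case False
      then have "(\<lambda>x. ?v (x, m)) = (\<lambda>x. 0)" by simp
      with b have b': "AE x in Xx \<Omega>. G t ?v (x, m) = Gx m t (\<lambda>x. 0) x" by simp
      from b' substochastic_zero[OF c t] show ?thesis by eventually_elim (use False in simp)
    qed
  qed
  from AE_Xr_fibres[OF \<Omega> dL this] substochastic_cong[OF G t wL vL wv] sp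
  show ?thesis by eventually_elim (auto simp: indicator_def)
qed

lemma borel_measurable_Xr_snd:
  fixes \<Omega> :: "'x::euclidean_space set" and f :: "real \<Rightarrow> real"
  assumes "open \<Omega>" and f: "f \<in> borel_measurable (lebesgue_on {0..})"
  shows "(\<lambda>z. f (snd z)) \<in> borel_measurable (lebesgue_on (\<Omega> \<times> {0..}))"
    "(\<lambda>z. f (snd (snd z))) \<in> borel_measurable (lebesgue_on (\<Omega> \<times> {0::real..} \<times> {0..}))"
proof -
  have "(\<lambda>m. indicator {0..} m * f m) \<in> borel_measurable lebesgue"
    using f by (simp add: borel_measurable_restrict_space_iff)
  note m1 = borel_measurable_lebesgue_snd[OF this]
  have "(\<lambda>z :: 'x \<times> real. indicator {0..} (snd z) * f (snd z)) \<in> borel_measurable (lebesgue_on (\<Omega> \<times> {0..}))"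
    using m1 by (rule measurable_restrict_space1)
  then show "(\<lambda>z. f (snd z)) \<in> borel_measurable (lebesgue_on (\<Omega> \<times> {0..}))"
    by (subst measurable_cong) (auto simp: space_restrict_space)
  have "(\<lambda>z :: 'x \<times> real \<times> real. indicator {0..} (snd (snd z)) * f (snd (snd z)))
      \<in> borel_measurable (lebesgue_on (\<Omega> \<times> {0..} \<times> {0..}))"
    using borel_measurable_lebesgue_snd[OF m1] by (rule measurable_restrict_space1)
  then show "(\<lambda>z. f (snd (snd z))) \<in> borel_measurable (lebesgue_on (\<Omega> \<times> {0::real..} \<times> {0..}))"
    by (subst measurable_cong) (auto simp: space_restrict_space)
qed

lemma AE_Linf_loc_bound:
  fixes \<Omega> :: "'x::euclidean_space set" and c :: real
  assumes "Linf_loc {0..} \<alpha>"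
  shows "\<exists>C. AE z in (lebesgue :: ('x \<times> real) measure). snd z \<in> {0..c} \<longrightarrow> \<bar>\<alpha> (snd z)\<bar> \<le> C"
proof -
  have "\<exists>C. AE m in lebesgue_on {0..c}. \<bar>\<alpha> m\<bar> \<le> C"
    using assms by (simp add: Linf_loc_def)
  then obtain C where "AE m in lebesgue_on {0..c}. \<bar>\<alpha> m\<bar> \<le> C" by blast
  then have "AE m in lebesgue. m \<in> {0..c} \<longrightarrow> \<bar>\<alpha> m\<bar> \<le> C"
    by (subst (asm) AE_restrict_space_iff) auto
  from AE_lebesgue_snd[OF this] show ?thesis by blast
qed

section \<open>The fragmentation semigroup\<close>

text \<open>The rate q may depend on x. On a mass slice it is still bounded, because it lies below a
  locally bounded function of m alone.\<close>

lemma fragmentation_generates: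
  fixes \<Omega> :: "'x::euclidean_space set"
  assumes ker: "kernel_operator \<Omega> r q k C"
    and q_meas: "q \<in> borel_measurable (lebesgue_on (\<Omega> \<times> {0..}))"
    and \<alpha>: "Linf_loc {0..} \<alpha>" and q_\<alpha>: "AE z in lebesgue_on (\<Omega> \<times> {0..}). q z \<le> \<alpha> (snd z)"
    and Gx: "AE m in lebesgue_on {0..}. substochastic (Xx \<Omega>) (Gx m)"
    and gen: "generates_fibrewise \<Omega> r T0 D0 Gx"
  shows "generates_positive_semigroup (Xr \<Omega> r) (\<lambda>u z. T0_op \<Omega> r T0 u z - q z * u z + kern k u z)
    (T0_dom \<Omega> r T0 D0 \<inter> {u \<in> L1 (Xr \<Omega> r). (\<lambda>z. q z * u z) \<in> L1 (Xr \<Omega> r)})"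
proof -
  interpret kernel_operator \<Omega> r q k C by (rule ker)
  obtain G where G: "substochastic (Xr \<Omega> r) G"
      "is_generator (Xr \<Omega> r) G (T0_op \<Omega> r T0) (T0_dom \<Omega> r T0 D0)"
      "\<And>t u. 0 \<le> t \<Longrightarrow> u \<in> L1 (Xr \<Omega> r) \<Longrightarrow> fibre_eq \<Omega> (G t u) (\<lambda>m. Gx m t (\<lambda>x. u (x, m)))"
    using gen by (auto simp: generates_fibrewise_def)
  \<comment> \<open>Half-open unit intervals are disjoint and cover the half-line; each lies in the
    compact interval up to n + 1, where the local bound on \<alpha> applies.\<close>
  define E where "E n = \<Omega> \<times> {real n..<real n + 1}" for n
  have "\<forall>n. \<exists>N. AE z in (lebesgue :: ('x \<times> real) measure). snd z \<in> {0..real n + 1} \<longrightarrow> \<bar>\<alpha> (snd z)\<bar> \<le> N"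
    using AE_Linf_loc_bound[OF \<alpha>] by blast
  then obtain N where N: "\<And>n. AE z in (lebesgue :: ('x \<times> real) measure). snd z \<in> {0..real n + 1} \<longrightarrow> \<bar>\<alpha> (snd z)\<bar> \<le> N n"
    by metis
  interpret L1_perturbation "Xr \<Omega> r" G "T0_op \<Omega> r T0" "T0_dom \<Omega> r T0 D0" q E N "kern k" C
  proof
    show "substochastic (Xr \<Omega> r) G" by (rule G(1))
    show "is_generator (Xr \<Omega> r) G (T0_op \<Omega> r T0) (T0_dom \<Omega> r T0 D0)" by (rule G(2))
    show "q \<in> borel_measurable (Xr \<Omega> r)" using q_meas by (simp add: L1_Xr_measurable)
    show "AE z in Xr \<Omega> r. 0 \<le> q z" using q_nonneg by (simp add: AE_Xr_iff(1)[OF \<Omega>])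
    show "E n \<in> sets (Xr \<Omega> r)" for n
    proof -
      have "E n \<in> sets lebesgue"
        unfolding E_def using \<Omega> by (intro sets_completionI_sets) (auto intro!: borel_Times)
      moreover have "E n \<subseteq> \<Omega> \<times> {0..}" by (auto simp: E_def)
      ultimately show ?thesis using S_sets(1) by (simp add: Xr_def sets_restrict_space_iff)
    qed
    show "disjoint_family E"
      unfolding disjoint_family_on_def
    proof (intro ballI impI)
      fix i j :: nat assume "i \<noteq> j"
      then have "real i + 1 \<le> real j \<or> real j + 1 \<le> real i" by linarith
      then show "E i \<inter> E j = {}" by (auto simp: E_def)
    qed
    show "space (Xr \<Omega> r) \<subseteq> (\<Union>n. E n)"
    proof
      fix z assume "z \<in> space (Xr \<Omega> r)"
      then have z: "fst z \<in> \<Omega>" "0 \<le> snd z" by (auto simp: Xr_def space_restrict_space)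
      have "real (nat \<lfloor>snd z\<rfloor>) \<le> snd z" "snd z < real (nat \<lfloor>snd z\<rfloor>) + 1" using z(2) by linarith+
      then show "z \<in> (\<Union>n. E n)" using z(1) by (cases z) (auto simp: E_def intro!: exI[of _ "nat \<lfloor>snd z\<rfloor>"])
    qed
    show "AE z in Xr \<Omega> r. z \<in> E n \<longrightarrow> q z \<le> N n" for n
      using q_\<alpha> N[of n] unfolding AE_Xr_iff[OF \<Omega>]
      by eventually_elim (auto simp: E_def)
    show "AE z in Xr \<Omega> r. G t (\<lambda>y. indicator (E n) y * u y) z = indicator (E n) z * G t u z"
      if "0 \<le> t" "u \<in> L1 (Xr \<Omega> r)" for t u n
      unfolding E_def by (rule fibrewise_slice[OF \<Omega> _ G(1) G(3) Gx]) (use that in auto)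
    show "0 \<le> C" by (rule C)
  qed (use kern_props(2,3) kern_lin kern_nonneg in auto)
  show ?thesis by (rule generates)
qed

text \<open>For s > s1 the weighted mass is at most \<alpha>(s) (1 + s^r)/(2M), and \<alpha> \<le> M
  q turns this into half of q times the weight. For s \<le> s1 both \<alpha> and the moment are
  bounded, and this contribution goes into C.\<close>

lemma kernel_operator_dominated:
  fixes \<Omega> :: "'x::euclidean_space set"
  assumes \<Omega>: "open \<Omega>"
    and k_meas: "k \<in> borel_measurable (lebesgue_on (\<Omega> \<times> {0..} \<times> {0..}))"
    and k_nonneg: "AE z in lebesgue_on (\<Omega> \<times> {0..} \<times> {0..}). 0 \<le> k z"
    and k_le: "AE z in lebesgue_on (\<Omega> \<times> {0..} \<times> {0..}). k z \<le> \<alpha> (snd (snd z)) * \<beta> (snd z)"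
    and q: "AE y in lebesgue_on (\<Omega> \<times> {0..}). 0 \<le> q y \<and> q y \<le> \<alpha> (snd y) \<and> \<alpha> (snd y) \<le> M * q y"
    and \<alpha>: "Linf_loc {0..} \<alpha>" and M: "0 < M"
    and \<beta>_meas: "\<beta> \<in> borel_measurable (lebesgue_on ({0..} \<times> {0..}))"
    and s1: "0 \<le> s1" and c: "0 \<le> c"
    and moment: "\<And>s. 0 \<le> s \<Longrightarrow> (\<lambda>m. indicator {0..} m * \<beta> (m, s)) \<in> borel_measurable lebesgue \<Longrightarrow>
      (s1 < s \<longrightarrow> (\<integral>\<^sup>+m\<in>{0..s}. ennreal (\<beta> (m, s)) * ennreal (1 + m powr r) \<partial>lebesgue) \<le> ennreal ((1 + s powr r) / (2 * M))) \<and>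
      (s \<le> s1 \<longrightarrow> (\<integral>\<^sup>+m\<in>{0..s}. ennreal (\<beta> (m, s)) * ennreal (1 + m powr r) \<partial>lebesgue) \<le> ennreal c)"
  shows "\<exists>C. kernel_operator \<Omega> r q k C"
proof -
  obtain N where N: "AE z in (lebesgue :: ('x \<times> real) measure). snd z \<in> {0..s1} \<longrightarrow> \<bar>\<alpha> (snd z)\<bar> \<le> N"
    using AE_Linf_loc_bound[OF \<alpha>] by blast
  \<comment> \<open>The product of the local bound of \<alpha> on [0, s1] with the moment bound c;
    the absolute value makes it nonnegative.\<close>
  let ?C = "\<bar>N\<bar> * c"
  let ?S3 = "\<Omega> \<times> {0::real..} \<times> {0::real..}"
  have kl: "AE z in lebesgue. z \<in> ?S3 \<longrightarrow> k z \<le> \<alpha> (snd (snd z)) * \<beta> (snd z)"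
    using k_le Xr_sets(2)[OF \<Omega>] by (subst (asm) AE_restrict_space_iff) auto
  have "(\<lambda>z. indicator ({0..} \<times> {0..}) z * \<beta> z) \<in> borel_measurable lebesgue"
    using \<beta>_meas by (subst (asm) borel_measurable_restrict_space_iff)
      (auto intro!: sets_completionI_sets borel_Times)
  from borel_measurable_fibres[OF this]
  have "AE s in lebesgue. (\<lambda>m. indicator ({0..} \<times> {0..}) (m, s) * \<beta> (m, s)) \<in> borel_measurable lebesgue" .
  from AE_lebesgue_snd[OF this]
  have bm: "AE y in (lebesgue :: ('x \<times> real) measure).
      (\<lambda>m. indicator ({0..} \<times> {0..}) (m, snd y) * \<beta> (m, snd y)) \<in> borel_measurable lebesgue" .
  have "kernel_operator \<Omega> r q k ?C"
  proof
    show "open \<Omega>" by (rule \<Omega>)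
    show "k \<in> borel_measurable (lebesgue_on ?S3)" by (rule k_meas)
    show "AE z in lebesgue_on ?S3. 0 \<le> k z" by (rule k_nonneg)
    show "AE y in lebesgue_on (\<Omega> \<times> {0..}). 0 \<le> q y" using q by eventually_elim simp
    show "0 \<le> ?C" using c by simp
    show "AE y in lebesgue_on (\<Omega> \<times> {0..}).
      (\<integral>\<^sup>+m\<in>{0..snd y}. ennreal (k (fst y, m, snd y)) * ennreal (1 + m powr r) \<partial>lebesgue)
        \<le> ennreal ((1 + snd y powr r) * (1 / 2 * q y + ?C))"
      unfolding AE_Xr_iff(2)[OF \<Omega>]
      using AE_lebesgue_triple(2)[OF kl] bm N q[unfolded AE_Xr_iff(2)[OF \<Omega>]]
    proof (eventually_elim, intro impI)
      fix y :: "'x \<times> real"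
      assume kl: "AE m in lebesgue. (fst y, m, snd y) \<in> ?S3 \<longrightarrow>
          k (fst y, m, snd y) \<le> \<alpha> (snd (snd (fst y, m, snd y))) * \<beta> (snd (fst y, m, snd y))"
        and bm: "(\<lambda>m. indicator ({0..} \<times> {0..}) (m, snd y) * \<beta> (m, snd y)) \<in> borel_measurable lebesgue"
        and N: "snd y \<in> {0..s1} \<longrightarrow> \<bar>\<alpha> (snd y)\<bar> \<le> N"
        and q: "y \<in> \<Omega> \<times> {0..} \<longrightarrow> 0 \<le> q y \<and> q y \<le> \<alpha> (snd y) \<and> \<alpha> (snd y) \<le> M * q y"
        and y: "y \<in> \<Omega> \<times> {0..}"
      obtain x s where xs: "y = (x, s)" by fastforce
      have s: "0 \<le> s" and x: "x \<in> \<Omega>" using y xs by auto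
      have qy: "0 \<le> q y" "q y \<le> \<alpha> s" "\<alpha> s \<le> M * q y" and \<alpha>s: "0 \<le> \<alpha> s" using q y xs by auto
      have bm': "(\<lambda>m. indicator {0..} m * \<beta> (m, s)) \<in> borel_measurable lebesgue"
        using bm s xs by (simp add: indicator_times)
      let ?g = "\<lambda>m. ennreal (indicator {0..} m * \<beta> (m, s)) * (ennreal (1 + m powr r) * indicator {0..s} m)"
      have w: "(\<lambda>m. ennreal (1 + m powr r) * indicator {0..s} m) \<in> borel_measurable lebesgue"
      proof -
        have "(\<lambda>m. ennreal (1 + m powr r) * indicator {0..s} m) \<in> borel_measurable borel" by measurable
        then show ?thesis by (intro measurable_completion) simp
      qed
      have gm: "?g \<in> borel_measurable lebesgue"
        by (rule borel_measurable_times_ennreal[OF measurable_compose[OF bm' measurable_ennreal] w])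
      let ?I = "\<integral>\<^sup>+m\<in>{0..s}. ennreal (\<beta> (m, s)) * ennreal (1 + m powr r) \<partial>lebesgue"
      have "(\<integral>\<^sup>+m\<in>{0..s}. ennreal (k (x, m, s)) * ennreal (1 + m powr r) \<partial>lebesgue) \<le>
          (\<integral>\<^sup>+m. ennreal (\<alpha> s) * ?g m \<partial>lebesgue)"
        using kl
      proof (intro nn_integral_mono_AE, eventually_elim)
        fix m assume a: "(fst y, m, snd y) \<in> ?S3 \<longrightarrow>
          k (fst y, m, snd y) \<le> \<alpha> (snd (snd (fst y, m, snd y))) * \<beta> (snd (fst y, m, snd y))"
        show "ennreal (k (x, m, s)) * ennreal (1 + m powr r) * indicator {0..s} m \<le> ennreal (\<alpha> s) * ?g m"
        proof (cases "m \<in> {0..s}")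
          case True
          then have "k (x, m, s) \<le> \<alpha> s * \<beta> (m, s)" using a x s xs by simp
          then have "ennreal (k (x, m, s)) \<le> ennreal (\<alpha> s) * ennreal (\<beta> (m, s))"
            using \<alpha>s by (simp add: ennreal_leI ennreal_mult' flip: ennreal_mult')
          then have "ennreal (k (x, m, s)) * ennreal (1 + m powr r) \<le>
              ennreal (\<alpha> s) * ennreal (\<beta> (m, s)) * ennreal (1 + m powr r)"
            by (rule mult_right_mono) simp
          then show ?thesis using True by (simp add: mult.assoc)
        qed simp
      qed
      also have "\<dots> = ennreal (\<alpha> s) * (\<integral>\<^sup>+m. ?g m \<partial>lebesgue)" by (rule nn_integral_cmult[OF gm])
      also have "(\<integral>\<^sup>+m. ?g m \<partial>lebesgue) = ?I"
        by (intro nn_integral_cong) (auto simp: indicator_def)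
      finally have kI: "(\<integral>\<^sup>+m\<in>{0..s}. ennreal (k (x, m, s)) * ennreal (1 + m powr r) \<partial>lebesgue) \<le> ennreal (\<alpha> s) * ?I" .
      have w1: "1 \<le> 1 + s powr r" by simp
      have "ennreal (\<alpha> s) * ?I \<le> ennreal ((1 + s powr r) * (1 / 2 * q y + ?C))"
      proof (cases "s1 < s")
        case True
        then have "?I \<le> ennreal ((1 + s powr r) / (2 * M))" using moment[OF s bm'] by blast
        then have "ennreal (\<alpha> s) * ?I \<le> ennreal (\<alpha> s) * ennreal ((1 + s powr r) / (2 * M))"
          by (rule mult_left_mono) simp
        also have "\<dots> = ennreal (\<alpha> s * ((1 + s powr r) / (2 * M)))" by (simp only: ennreal_mult'[OF \<alpha>s])
        also have "\<dots> \<le> ennreal ((1 + s powr r) * (1 / 2 * q y + ?C))"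
        proof (rule ennreal_leI)
          have "\<alpha> s * ((1 + s powr r) / (2 * M)) \<le> (M * q y) * ((1 + s powr r) / (2 * M))"
            using qy(3) w1 M by (intro mult_right_mono) auto
          also have "\<dots> = (1 + s powr r) * (1 / 2 * q y)" using M by (simp add: field_simps)
          also have "\<dots> \<le> (1 + s powr r) * (1 / 2 * q y + ?C)"
            using w1 c by (intro mult_left_mono) auto
          finally show "\<alpha> s * ((1 + s powr r) / (2 * M)) \<le> (1 + s powr r) * (1 / 2 * q y + ?C)" .
        qed
        finally show ?thesis .
      next
        case False
        then have "?I \<le> ennreal c" using moment[OF s bm'] by simp
        then have "ennreal (\<alpha> s) * ?I \<le> ennreal (\<alpha> s) * ennreal c"
          by (rule mult_left_mono) simp
        also have "\<dots> = ennreal (\<alpha> s * c)" using \<alpha>s by (simp add: ennreal_mult')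
        also have "\<dots> \<le> ennreal ((1 + s powr r) * (1 / 2 * q y + ?C))"
        proof (rule ennreal_leI)
          have "\<bar>\<alpha> s\<bar> \<le> N" using N False s xs by simp
          then have "\<alpha> s * c \<le> ?C" using c by (intro mult_right_mono) auto
          also have "\<dots> \<le> 1 / 2 * q y + ?C" using qy(1) by simp
          also have "\<dots> = 1 * (1 / 2 * q y + ?C)" by simp
          also have "\<dots> \<le> (1 + s powr r) * (1 / 2 * q y + ?C)"
            using w1 qy(1) c by (intro mult_right_mono) auto
          finally show "\<alpha> s * c \<le> (1 + s powr r) * (1 / 2 * q y + ?C)" .
        qed
        finally show ?thesis .
      qed
      with kI show "(\<integral>\<^sup>+m\<in>{0..snd y}. ennreal (k (fst y, m, snd y)) * ennreal (1 + m powr r) \<partial>lebesgue)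
        \<le> ennreal ((1 + snd y powr r) * (1 / 2 * q y + ?C))"
        unfolding xs fst_conv snd_conv by (rule order_trans)
    qed
  qed
  then show ?thesis by blast
qed

theorem corollary3p2:
  fixes \<Omega> :: "'x::euclidean_space set"
    and a :: "'x \<times> real \<Rightarrow> real"
    and \<alpha>1 \<alpha>2 :: "real \<Rightarrow> real"
    and M :: real
    and T0 :: "real \<Rightarrow> ('x \<Rightarrow> real) \<Rightarrow> 'x \<Rightarrow> real"
    and D0 :: "real \<Rightarrow> ('x \<Rightarrow> real) set"
    and Gx :: "real \<Rightarrow> real \<Rightarrow> ('x \<Rightarrow> real) \<Rightarrow> 'x \<Rightarrow> real"
    and b :: "'x \<times> real \<times> real \<Rightarrow> real"
    and \<beta> :: "real \<times> real \<Rightarrow> real"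
    and b0 l \<beta>0 r0 s0 :: real
  assumes Omega: "(bounded \<Omega> \<and> open \<Omega> \<and> C2_boundary \<Omega>) \<or> \<Omega> = UNIV"
    and a_loc: "Linf_loc (\<Omega> \<times> {0..}) a"
    and a_nonneg: "AE z in lebesgue_on (\<Omega> \<times> {0..}). 0 \<le> a z"
    and alpha_loc: "Linf_loc {0..} \<alpha>1" "Linf_loc {0..} \<alpha>2"
    and M_pos: "0 < M"
    and rates: "AE (x, m) in lebesgue_on (\<Omega> \<times> {0..}).
                  \<alpha>1 m \<le> a (x, m) \<and> a (x, m) \<le> \<alpha>2 m \<and> \<alpha>2 m \<le> M * \<alpha>1 m"
    and T0_gen: "AE m in lebesgue_on {0..}.
                  substochastic (Xx \<Omega>) (Gx m) \<and> is_generator (Xx \<Omega>) (Gx m) (T0 m) (D0 m)"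
    and T0_gen_fibrewise: "\<And>r. r \<ge> 0 \<Longrightarrow> generates_fibrewise \<Omega> r T0 D0 Gx"
    and b_meas: "b \<in> borel_measurable (lebesgue_on (\<Omega> \<times> {0..} \<times> {0..}))"
    and b_nonneg: "\<And>x m s. x \<in> \<Omega> \<Longrightarrow> m \<ge> 0 \<Longrightarrow> s \<ge> 0 \<Longrightarrow> b (x, m, s) \<ge> 0"
    and b_supp: "\<And>x m s. x \<in> \<Omega> \<Longrightarrow> s \<ge> 0 \<Longrightarrow> m > s \<Longrightarrow> b (x, m, s) = 0"
    and beta_meas: "\<beta> \<in> borel_measurable (lebesgue_on ({0..} \<times> {0..}))"
    and beta_nonneg: "\<And>m s. m \<ge> 0 \<Longrightarrow> s \<ge> 0 \<Longrightarrow> \<beta> (m, s) \<ge> 0"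
    and beta_supp: "\<And>m s. s \<ge> 0 \<Longrightarrow> m > s \<Longrightarrow> \<beta> (m, s) = 0"
    and h1: "b0 \<ge> 1" "l \<ge> 0"
            "AE (x, s) in lebesgue_on (\<Omega> \<times> {0..}). n0 b x s \<le> ennreal (b0 * (1 + s powr l))"
    and h2: "\<And>s. s \<ge> 0 \<Longrightarrow>
              (\<integral>\<^sup>+m\<in>{0..s}. ennreal (\<beta> (m, s)) \<partial>lebesgue) \<le> ennreal (\<beta>0 * (1 + s powr l))"
    and h3: "r0 \<ge> 0" "s0 \<ge> 0"
            "equi_integrable01 ((\<lambda>s z. s * z powr r0 * \<beta> (z * s, s)) ` {s0..})"
  shows "\<exists>r1 > max l r0. \<forall>r \<ge> r1.
           generates_positive_semigroup (Xr \<Omega> r)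
             (maj_K_op \<Omega> r T0 \<alpha>1 \<alpha>2 \<beta>) (T_dom \<Omega> r T0 D0 a) \<and>
           ((AE (x, m, s) in lebesgue_on (\<Omega> \<times> {0..} \<times> {0..}). m \<le> s \<longrightarrow> b (x, m, s) \<le> \<beta> (m, s)) \<longrightarrow>
            generates_positive_semigroup (Xr \<Omega> r)
              (K_op \<Omega> r T0 a b) (T_dom \<Omega> r T0 D0 a))"
proof -
  let ?S = "\<Omega> \<times> {0::real..}" and ?S3 = "\<Omega> \<times> {0::real..} \<times> {0::real..}"
  have \<Omega>: "open \<Omega>" using Omega by auto
  \<comment> \<open>Nonnegativity of \<open>\<alpha>1\<close> is inferred: M
    \<open>\<alpha>1\<close> lies above \<open>\<alpha>2\<close>, which lies above the nonnegative
    \<open>a\<close>.\<close>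
  have rate: "AE z in lebesgue_on ?S. 0 \<le> \<alpha>1 (snd z) \<and> \<alpha>1 (snd z) \<le> a z \<and> 0 \<le> a z \<and>
      a z \<le> \<alpha>2 (snd z) \<and> \<alpha>2 (snd z) \<le> M * \<alpha>1 (snd z)"
    using rates a_nonneg
  proof eventually_elim
    fix z assume "case z of (x, m) \<Rightarrow> \<alpha>1 m \<le> a (x, m) \<and> a (x, m) \<le> \<alpha>2 m \<and> \<alpha>2 m \<le> M * \<alpha>1 m" and a0: "0 \<le> a z"
    then have *: "\<alpha>1 (snd z) \<le> a z" "a z \<le> \<alpha>2 (snd z)" "\<alpha>2 (snd z) \<le> M * \<alpha>1 (snd z)"
      by (auto simp: split_beta)
    then have "0 \<le> M * \<alpha>1 (snd z)" using a0 by linarith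
    then have "0 \<le> \<alpha>1 (snd z)" using M_pos by (simp add: zero_le_mult_iff)
    with * a0 show "0 \<le> \<alpha>1 (snd z) \<and> \<alpha>1 (snd z) \<le> a z \<and> 0 \<le> a z \<and>
      a z \<le> \<alpha>2 (snd z) \<and> \<alpha>2 (snd z) \<le> M * \<alpha>1 (snd z)" by simp
  qed
  have a_meas: "a \<in> borel_measurable (lebesgue_on ?S)" using a_loc by (simp add: Linf_loc_def)
  have \<alpha>_meas: "\<alpha>1 \<in> borel_measurable (lebesgue_on {0..})" "\<alpha>2 \<in> borel_measurable (lebesgue_on {0..})"
    using alpha_loc by (simp_all add: Linf_loc_def)
  have \<alpha>1_meas: "(\<lambda>z. \<alpha>1 (snd z)) \<in> borel_measurable (lebesgue_on ?S)"
    by (rule borel_measurable_Xr_snd(1)[OF \<Omega> \<alpha>_meas(1)])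
  have S3: "(AE z in lebesgue_on ?S3. P z) \<longleftrightarrow> (AE z in lebesgue. z \<in> ?S3 \<longrightarrow> P z)" for P
    using Xr_sets(2)[OF \<Omega>] by (intro AE_restrict_space_iff) simp
  have rate3: "AE z in lebesgue_on ?S3. 0 \<le> a (fst z, snd (snd z)) \<and> a (fst z, snd (snd z)) \<le> \<alpha>2 (snd (snd z))"
    unfolding S3 using AE_lebesgue_outer[OF rate[unfolded AE_Xr_iff(2)[OF \<Omega>]], where 'b = real]
    by eventually_elim auto
  have Gx: "AE m in lebesgue_on {0..}. substochastic (Xx \<Omega>) (Gx m)"
    using T0_gen by eventually_elim simp
  obtain r1 where r1: "max l r0 < r1" "\<And>r. r1 \<le> r \<Longrightarrow> \<exists>s1\<ge>0. \<exists>c\<ge>0. \<forall>s\<ge>0.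
      (\<lambda>m. indicator {0..} m * \<beta> (m, s)) \<in> borel_measurable lebesgue \<longrightarrow>
      (s1 < s \<longrightarrow> (\<integral>\<^sup>+m\<in>{0..s}. ennreal (\<beta> (m, s)) * ennreal (1 + m powr r) \<partial>lebesgue) \<le> ennreal ((1 + s powr r) / (2 * M))) \<and>
      (s \<le> s1 \<longrightarrow> (\<integral>\<^sup>+m\<in>{0..s}. ennreal (\<beta> (m, s)) * ennreal (1 + m powr r) \<partial>lebesgue) \<le> ennreal c)"
    using weighted_moment[OF beta_nonneg h2 h3(3) h1(2) h3(1,2) M_pos] by blast
  show ?thesis
  proof (rule exI[of _ r1], rule conjI[OF r1(1)], rule allI, rule impI)
    fix r assume r: "r1 \<le> r"
    then have r_nonneg: "0 \<le> r" using r1(1) h1(2) by simp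
    obtain s1 c where s1: "0 \<le> s1" and c: "0 \<le> c" and moment: "\<And>s. 0 \<le> s \<Longrightarrow>
      (\<lambda>m. indicator {0..} m * \<beta> (m, s)) \<in> borel_measurable lebesgue \<Longrightarrow>
      (s1 < s \<longrightarrow> (\<integral>\<^sup>+m\<in>{0..s}. ennreal (\<beta> (m, s)) * ennreal (1 + m powr r) \<partial>lebesgue) \<le> ennreal ((1 + s powr r) / (2 * M))) \<and>
      (s \<le> s1 \<longrightarrow> (\<integral>\<^sup>+m\<in>{0..s}. ennreal (\<beta> (m, s)) * ennreal (1 + m powr r) \<partial>lebesgue) \<le> ennreal c)"
      using r1(2)[OF r] by blast
    \<comment> \<open>Stated for any rate between \<open>\<alpha>1\<close> and \<open>a\<close> and
      any nonnegative kernel below \<open>\<alpha>2 s * \<beta> (m, s)\<close>, so that the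
      majorising operator and the original one are both instances.\<close>
    have generates: "generates_positive_semigroup (Xr \<Omega> r) (\<lambda>u z. T0_op \<Omega> r T0 u z - q z * u z + kern k u z)
        (T_dom \<Omega> r T0 D0 a)"
      if q: "q \<in> borel_measurable (lebesgue_on ?S)"
        "AE z in lebesgue_on ?S. \<alpha>1 (snd z) \<le> q z \<and> q z \<le> a z"
        and k: "k \<in> borel_measurable (lebesgue_on ?S3)" "AE z in lebesgue_on ?S3. 0 \<le> k z"
        "AE z in lebesgue_on ?S3. k z \<le> \<alpha>2 (snd (snd z)) * \<beta> (snd z)" for q k
    proof -
      have qr: "AE z in lebesgue_on ?S. 0 \<le> q z \<and> q z \<le> \<alpha>2 (snd z) \<and> \<alpha>2 (snd z) \<le> M * q z \<and> q z \<le> a z \<and> a z \<le> M * q z"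
        using rate q(2)
      proof eventually_elim
        fix z assume a: "0 \<le> \<alpha>1 (snd z) \<and> \<alpha>1 (snd z) \<le> a z \<and> 0 \<le> a z \<and> a z \<le> \<alpha>2 (snd z) \<and> \<alpha>2 (snd z) \<le> M * \<alpha>1 (snd z)"
          and b: "\<alpha>1 (snd z) \<le> q z \<and> q z \<le> a z"
        have "M * \<alpha>1 (snd z) \<le> M * q z" using b M_pos by simp
        with a b show "0 \<le> q z \<and> q z \<le> \<alpha>2 (snd z) \<and> \<alpha>2 (snd z) \<le> M * q z \<and> q z \<le> a z \<and> a z \<le> M * q z"
          by linarith
      qed
      have "\<exists>C. kernel_operator \<Omega> r q k C"
        by (rule kernel_operator_dominated[OF \<Omega> k _ alpha_loc(2) M_pos beta_meas s1 c moment])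
          (use qr in eventually_elim, simp)
      then obtain C where C: "kernel_operator \<Omega> r q k C" by blast
      have q\<alpha>: "AE z in lebesgue_on ?S. q z \<le> \<alpha>2 (snd z)" using qr by eventually_elim simp
      have um: "u \<in> borel_measurable (Xr \<Omega> r)" if "u \<in> L1 (Xr \<Omega> r)" for u
        using that by (auto simp: L1_def)
      have am: "a \<in> borel_measurable (Xr \<Omega> r)" "q \<in> borel_measurable (Xr \<Omega> r)"
        using a_meas q(1) by (simp_all add: L1_Xr_measurable)
      \<comment> \<open>Since q \<le> a \<le> M q, multiplication by q and by \<open>a\<close> have
        the same domain; this identifies the domain with \<open>T_dom\<close>.\<close>
      have "(\<lambda>z. q z * u z) \<in> L1 (Xr \<Omega> r) \<longleftrightarrow> (\<lambda>z. a z * u z) \<in> L1 (Xr \<Omega> r)" if u: "u \<in> L1 (Xr \<Omega> r)" for u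
      proof
        assume "(\<lambda>z. q z * u z) \<in> L1 (Xr \<Omega> r)"
        then have i: "integrable (Xr \<Omega> r) (\<lambda>z. M * (q z * u z))" by (simp add: L1_def)
        have "integrable (Xr \<Omega> r) (\<lambda>z. a z * u z)"
        proof (rule Bochner_Integration.integrable_bound[OF i])
          show "(\<lambda>z. a z * u z) \<in> borel_measurable (Xr \<Omega> r)" using am(1) um[OF u] by measurable
          show "AE z in Xr \<Omega> r. norm (a z * u z) \<le> norm (M * (q z * u z))"
            unfolding AE_Xr_iff(1)[OF \<Omega>] using qr
          proof eventually_elim
            fix z assume z: "0 \<le> q z \<and> q z \<le> \<alpha>2 (snd z) \<and> \<alpha>2 (snd z) \<le> M * q z \<and> q z \<le> a z \<and> a z \<le> M * q z"
            then have "a z * \<bar>u z\<bar> \<le> (M * q z) * \<bar>u z\<bar>" by (intro mult_right_mono) auto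
            then show "norm (a z * u z) \<le> norm (M * (q z * u z))"
              using z M_pos by (simp add: abs_mult mult.assoc)
          qed
        qed
        then show "(\<lambda>z. a z * u z) \<in> L1 (Xr \<Omega> r)" by (simp add: L1_def)
      next
        assume "(\<lambda>z. a z * u z) \<in> L1 (Xr \<Omega> r)"
        then have i: "integrable (Xr \<Omega> r) (\<lambda>z. a z * u z)" by (simp add: L1_def)
        have "integrable (Xr \<Omega> r) (\<lambda>z. q z * u z)"
        proof (rule Bochner_Integration.integrable_bound[OF i])
          show "(\<lambda>z. q z * u z) \<in> borel_measurable (Xr \<Omega> r)" using am(2) um[OF u] by measurable
          show "AE z in Xr \<Omega> r. norm (q z * u z) \<le> norm (a z * u z)"
            unfolding AE_Xr_iff(1)[OF \<Omega>] using qr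
            by eventually_elim (auto simp: abs_mult intro: mult_right_mono)
        qed
        then show "(\<lambda>z. q z * u z) \<in> L1 (Xr \<Omega> r)" by (simp add: L1_def)
      qed
      then have "T0_dom \<Omega> r T0 D0 \<inter> {u \<in> L1 (Xr \<Omega> r). (\<lambda>z. q z * u z) \<in> L1 (Xr \<Omega> r)} = T_dom \<Omega> r T0 D0 a"
        by (auto simp: T_dom_def A_dom_def)
      then show ?thesis
        using fragmentation_generates[OF C q(1) alpha_loc(2) q\<alpha> Gx T0_gen_fibrewise[OF r_nonneg]] by simp
    qed
    have beta3: "(\<lambda>z. \<beta> (snd z)) \<in> borel_measurable (lebesgue_on ?S3)"
    proof -
      have "(\<lambda>z. indicator ({0..} \<times> {0..}) z * \<beta> z) \<in> borel_measurable lebesgue"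
        using beta_meas by (subst (asm) borel_measurable_restrict_space_iff)
          (auto intro!: sets_completionI_sets borel_Times)
      from borel_measurable_lebesgue_snd[OF this]
      have "(\<lambda>z :: 'x \<times> real \<times> real. indicator ({0..} \<times> {0..}) (snd z) * \<beta> (snd z)) \<in> borel_measurable (lebesgue_on ?S3)"
        by (rule measurable_restrict_space1)
      then show ?thesis by (subst measurable_cong) (auto simp: space_restrict_space)
    qed
    have a3: "(\<lambda>z. a (fst z, snd (snd z))) \<in> borel_measurable (lebesgue_on ?S3)"
    proof -
      have "(\<lambda>z. indicator ?S z * a z) \<in> borel_measurable lebesgue"
        using a_meas Xr_sets(1)[OF \<Omega>] by (simp add: borel_measurable_restrict_space_iff)
      from borel_measurable_lebesgue_outer[OF this]
      have "(\<lambda>z :: 'x \<times> real \<times> real. indicator ?S (fst z, snd (snd z)) * a (fst z, snd (snd z))) \<in> borel_measurable (lebesgue_on ?S3)"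
        by (rule measurable_restrict_space1)
      then show ?thesis by (subst measurable_cong) (auto simp: space_restrict_space)
    qed
    have in_S3: "AE z in lebesgue_on ?S3. z \<in> ?S3" by (rule AE_I2) (simp add: space_restrict_space)
    show "generates_positive_semigroup (Xr \<Omega> r) (maj_K_op \<Omega> r T0 \<alpha>1 \<alpha>2 \<beta>) (T_dom \<Omega> r T0 D0 a) \<and>
      ((AE (x, m, s) in lebesgue_on ?S3. m \<le> s \<longrightarrow> b (x, m, s) \<le> \<beta> (m, s)) \<longrightarrow>
        generates_positive_semigroup (Xr \<Omega> r) (K_op \<Omega> r T0 a b) (T_dom \<Omega> r T0 D0 a))"
    proof (intro conjI impI)
      let ?k = "\<lambda>z :: 'x \<times> real \<times> real. \<alpha>2 (snd (snd z)) * \<beta> (snd z)"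
      have "?k \<in> borel_measurable (lebesgue_on ?S3)"
        using borel_measurable_Xr_snd(2)[OF \<Omega> \<alpha>_meas(2)] beta3 by (rule borel_measurable_times)
      moreover have "AE z in lebesgue_on ?S3. 0 \<le> ?k z"
        using rate3 in_S3 by eventually_elim (use beta_nonneg in force)
      moreover have "AE z in lebesgue_on ?S. \<alpha>1 (snd z) \<le> \<alpha>1 (snd z) \<and> \<alpha>1 (snd z) \<le> a z"
        using rate by eventually_elim simp
      ultimately have "generates_positive_semigroup (Xr \<Omega> r)
          (\<lambda>u z. T0_op \<Omega> r T0 u z - \<alpha>1 (snd z) * u z + kern ?k u z) (T_dom \<Omega> r T0 D0 a)"
        by (intro generates \<alpha>1_meas) auto
      moreover have "maj_K_op \<Omega> r T0 \<alpha>1 \<alpha>2 \<beta> = (\<lambda>u z. T0_op \<Omega> r T0 u z - \<alpha>1 (snd z) * u z + kern ?k u z)"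
        by (auto simp: fun_eq_iff maj_K_op_def maj_A_op_def maj_B_op_def kern_def)
      ultimately show "generates_positive_semigroup (Xr \<Omega> r) (maj_K_op \<Omega> r T0 \<alpha>1 \<alpha>2 \<beta>) (T_dom \<Omega> r T0 D0 a)"
        by simp
    next
      assume bb: "AE (x, m, s) in lebesgue_on ?S3. m \<le> s \<longrightarrow> b (x, m, s) \<le> \<beta> (m, s)"
      let ?k = "\<lambda>z :: 'x \<times> real \<times> real. b z * a (fst z, snd (snd z))"
      have "?k \<in> borel_measurable (lebesgue_on ?S3)"
        using b_meas a3 by (rule borel_measurable_times)
      moreover have "AE z in lebesgue_on ?S3. 0 \<le> ?k z"
        using rate3 in_S3 by eventually_elim (use b_nonneg in force)
      moreover have "AE z in lebesgue_on ?S3. ?k z \<le> \<alpha>2 (snd (snd z)) * \<beta> (snd z)"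
        using rate3 in_S3 bb
      proof eventually_elim
        fix z :: "'x \<times> real \<times> real"
        assume r: "0 \<le> a (fst z, snd (snd z)) \<and> a (fst z, snd (snd z)) \<le> \<alpha>2 (snd (snd z))"
          and z: "z \<in> ?S3" and bz: "case z of (x, m, s) \<Rightarrow> m \<le> s \<longrightarrow> b (x, m, s) \<le> \<beta> (m, s)"
        obtain x m s where xms: "z = (x, m, s)" by (cases z)
        have "x \<in> \<Omega>" "0 \<le> m" "0 \<le> s" using z xms by auto
        \<comment> \<open>The comparison is assumed for m \<le> s; for m > s the left side is 0 by
          the support condition.\<close>
        then have "b (x, m, s) \<le> \<beta> (m, s)" "0 \<le> \<beta> (m, s)"
          using bz xms b_supp[of x s m] beta_nonneg[of m s] by (cases "m \<le> s", auto)
        then have "b (x, m, s) * a (x, s) \<le> \<beta> (m, s) * \<alpha>2 s"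
          using r xms by (intro mult_mono) auto
        then show "?k z \<le> \<alpha>2 (snd (snd z)) * \<beta> (snd z)" using xms by (simp add: mult.commute)
      qed
      moreover have "AE z in lebesgue_on ?S. \<alpha>1 (snd z) \<le> a z \<and> a z \<le> a z"
        using rate by eventually_elim simp
      ultimately have "generates_positive_semigroup (Xr \<Omega> r)
          (\<lambda>u z. T0_op \<Omega> r T0 u z - a z * u z + kern ?k u z) (T_dom \<Omega> r T0 D0 a)"
        by (intro generates a_meas)
      moreover have "K_op \<Omega> r T0 a b = (\<lambda>u z. T0_op \<Omega> r T0 u z - a z * u z + kern ?k u z)"
        by (auto simp: fun_eq_iff K_op_def A_op_def B_op_def kern_def)
      ultimately show "generates_positive_semigroup (Xr \<Omega> r) (K_op \<Omega> r T0 a b) (T_dom \<Omega> r T0 D0 a)"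
        by simp
    qed
  qed
qed

end
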